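(* Let $q \ge 3$, $d \ge 3$ and $m \ge 3$, and let $\mathcal{X} \subset \mathbb{P}^m$ be a hypersurface of degree $d$ defined over $\mathbb{F}_q$ with $|\mathcal{X}(\mathbb{F}_q)| < dq^{m-1} + p_{m-2}$. Then: (a) if $3 \le d \le \frac{q+3}{2}$, then $|\mathcal{X}(\mathbb{F}_q)| \le dq^{m-1} + p_{m-2} - (d-2)q^{m-2}$, and equality holds only if $\mathcal{X}$ is a union of hyperplanes defined over $\mathbb{F}_q$; (b) if $\frac{q+3}{2} < d \le q$, then $|\mathcal{X}(\mathbb{F}_q)| \le (d-1)q^{m-1} + dq^{m-2} + p_{m-3} - (d-2)q^{m-3}$.
   Context: $\mathbb{F}_q$ is the finite field with $q$ elements. A projective hypersurface of degree $d$ defined over $\mathbb{F}_q$ is the zero set in $\mathbb{P}^m$ of a nonzero homogeneous polynomial of degree $d$ in $m+1$ variables over $\mathbb{F}_q$; $\mathcal{X}(\mathbb{F}_q)$ denotes its $\mathbb{F}_q$-rational points. $p_k = q^k + \dots + q + 1$ for $k \ge 0$. *)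

theory Defs
  imports Main "HOL-Library.Poly_Mapping"
begin

text \<open>Multivariate polynomials over a ring 'a in the variables X_0, X_1, ...:
  finitely supported maps from exponent vectors (monomials) to coefficients.
  Multiplication is the convolution product provided by Poly_Mapping.\<close>
type_synonym 'a mpoly = "(nat \<Rightarrow>\<^sub>0 nat) \<Rightarrow>\<^sub>0 'a"

definition mon_deg :: "(nat \<Rightarrow>\<^sub>0 nat) \<Rightarrow> nat" where
  "mon_deg \<alpha> = (\<Sum>i\<in>Poly_Mapping.keys \<alpha>. Poly_Mapping.lookup \<alpha> i)"

definition homog_poly :: "nat \<Rightarrow> nat \<Rightarrow> 'a::zero mpoly \<Rightarrow> bool" where
  "homog_poly m d F \<longleftrightarrow> F \<noteq> 0 \<and>
     (\<forall>\<alpha>\<in>Poly_Mapping.keys F. mon_deg \<alpha> = d \<and> Poly_Mapping.keys \<alpha> \<subseteq> {0..m})"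

definition eval_mpoly :: "'a::comm_semiring_1 mpoly \<Rightarrow> (nat \<Rightarrow> 'a) \<Rightarrow> 'a" where
  "eval_mpoly F x = (\<Sum>\<alpha>\<in>Poly_Mapping.keys F. Poly_Mapping.lookup F \<alpha> * (\<Prod>i\<in>Poly_Mapping.keys \<alpha>. x i ^ Poly_Mapping.lookup \<alpha> i))"

definition nonzero_vecs :: "nat \<Rightarrow> (nat \<Rightarrow> 'a::zero) set" where
  "nonzero_vecs m = {x. (\<forall>i>m. x i = 0) \<and> (\<exists>i\<le>m. x i \<noteq> 0)}"

definition proj_points :: "nat \<Rightarrow> (nat \<Rightarrow> 'a::field) set set" where
  "proj_points m = (\<lambda>x. {(\<lambda>i. c * x i) | c. c \<noteq> 0}) ` nonzero_vecs m"

definition hyp_rat_points :: "nat \<Rightarrow> 'a::field mpoly \<Rightarrow> (nat \<Rightarrow> 'a) set set" where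
  "hyp_rat_points m F = {P \<in> proj_points m. \<forall>x\<in>P. eval_mpoly F x = 0}"

definition pk :: "nat \<Rightarrow> nat \<Rightarrow> nat" where
  "pk q k = (\<Sum>i\<le>k. q ^ i)"

definition union_of_rat_hyperplanes :: "nat \<Rightarrow> 'a::field mpoly \<Rightarrow> bool" where
  "union_of_rat_hyperplanes m F \<longleftrightarrow>
     (\<exists>c Ls. c \<noteq> 0 \<and> (\<forall>L\<in>set Ls. homog_poly m 1 L) \<and>
        F = Poly_Mapping.single 0 c * prod_list Ls)"

end

theory Submission
  imports Defs "HOL-Library.Function_Algebras" "HOL-Library.Cardinality" "HOL-Library.FuncSet"
    "HOL-Computational_Algebra.Polynomial"
begin

text \<open>Zeros are counted as vectors of the ambient vector space, so that all bounds become homogeneous in the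
  sizes of subspaces. Since \<open>d \<le> q\<close>, a form of degree \<open>d\<close> may be identified with the function that it defines.

  If the form vanishes on a hyperplane, the remaining zeros are those of an affine function of degree
  \<open>d - 1\<close>, and the second weight of affine Reed--Muller codes gives the bound; in the case of equality a
  pencil count shows that hyperplanes can be split off one after the other. Otherwise let \<open>L\<close> be a maximal
  subspace of zeros and count along the subspaces of one dimension more that contain \<open>L\<close>. Each of them has at most
  \<open>(d - 1) (q - 1) |L| / q\<close> zeros outside \<open>L\<close>, and by the second weight there is a gap below this value.
  If \<open>L\<close> has codimension two, not all members can attain the maximum: the zero set would behave like a generalized
  quadrangle with \<open>d\<close> lines through each point, and a plane section without lines would be a set whose
  lines meet it in \<open>0\<close>, \<open>1\<close> or \<open>d\<close> points; this forces \<open>(d - 1)\<^sup>2 \<le> q\<close>.\<close>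

subsection \<open>Subspaces and linear functionals over a finite field\<close>

text \<open>Put \<open>e = d - 1\<close>. On a coset \<open>w + L\<close> of a zero subspace a
  linear form splits off, leaving a residual function of degree \<open>e\<close>. Call a coset full
  if it attains the maximum \<open>e * card L / q\<close>. Three configurations give all the
  numbers. A zero hyperplane with full residual has exactly the count excluded by the hypothesis; a
  zero hyperplane whose residual has the second largest count gives bound (a); a zero subspace of
  codimension two with one member at the second count and all others full gives bound (b). In
  codimension at least two, charging every coset the maximum gives \<open>e * q^2 + q - e\<close> in
  place of the coefficient of (a). The difference is \<open>(q - 1) * (q + 1 - 2 * e)\<close>, whose
  sign is the threshold \<open>(q + 3) / 2\<close>. From \<open>q + 1 \<le> 2 * e\<close> follows
  \<open>q < e^2\<close>, so the quadrangle argument applies exactly where (a) is not already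
  strict. The technical obstacle is \<open>t^q = t\<close> together with \<open>d = q\<close>: a
  form and its tangent map are not read off from values alone. Hence expansions along lines are kept
  as formal polynomials, with their top coefficients recorded.\<close>

lemma finite_has_maximal_measure:
  fixes g :: "'c \<Rightarrow> nat"
  assumes "finite A" "a \<in> A"
  shows "\<exists>x\<in>A. \<forall>y\<in>A. g y \<le> g x"
proof -
  have "Max (g ` A) \<in> g ` A" using assms by (intro Max_in) auto
  then obtain x where "x \<in> A" "g x = Max (g ` A)" by auto
  then show ?thesis using assms by (metis Max_ge finite_imageI imageI)
qed

text \<open>Dimension never occurs: finite subspaces are measured by cardinality, and codimension
  one reads \<open>card W = q * card S\<close>. The ambient space may be infinite, so that
  coordinate spaces can later sit inside \<open>nat \<Rightarrow> 'a\<close>.\<close>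

locale finite_field_space = vector_space scale
  for scale :: "'a::{field,finite} \<Rightarrow> 'b::ab_group_add \<Rightarrow> 'b" (infixr "*s" 75) +
  fixes q :: nat
  assumes card_UNIV_q [simp]: "CARD('a) = q"
begin

lemma q_pos: "q > 0"
  by (metis card_UNIV_q zero_less_card_finite)

definition lf :: "('b \<Rightarrow> 'a) \<Rightarrow> bool" where
  "lf l \<longleftrightarrow> (\<forall>x y. l (x + y) = l x + l y) \<and> (\<forall>c x. l (c *s x) = c * l x)"

lemma lf_add: "lf l \<Longrightarrow> l (x + y) = l x + l y"
  and lf_scale: "lf l \<Longrightarrow> l (c *s x) = c * l x"
  by (auto simp: lf_def)

lemma lf_zero: "lf l \<Longrightarrow> l 0 = 0"
  by (metis lf_scale mult_zero_left scale_zero_left)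

lemma lf_diff: "lf l \<Longrightarrow> l (x - y) = l x - l y"
  by (metis add_diff_cancel_right' diff_add_cancel lf_add)

lemmas lf_simps = lf_add lf_scale lf_zero lf_diff

lemma lf_comb: "lf l \<Longrightarrow> lf k \<Longrightarrow> lf (\<lambda>x. a * l x + b * k x)"
  by (auto simp: lf_def algebra_simps)

lemma lf_const_zero: "lf (\<lambda>_. 0)"
  by (auto simp: lf_def)

lemma lf_exists:
  assumes "subspace S" "w \<notin> S"
  obtains l where "lf l" "l w = 1" "\<forall>x\<in>S. l x = 0"
proof -
  interpret vs: vector_space_pair scale "(*) :: 'a \<Rightarrow> 'a \<Rightarrow> 'a"
    by unfold_locales (auto simp: algebra_simps)
  obtain B where B: "B \<subseteq> S" "independent B" "S \<subseteq> span B"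
    using maximal_independent_subset by blast
  have spanB: "span B = S"
    using B assms(1) by (simp add: span_subspace)
  have "independent (insert w B)"
    using B(2) assms(2) spanB by (simp add: independent_insertI)
  then obtain g where g: "Vector_Spaces.linear scale (*) g"
    "\<forall>x\<in>insert w B. g x = (if x = w then 1 else 0)"
    using vs.linear_independent_extend[of "insert w B" "\<lambda>x. if x = w then 1 else 0"] by blast
  interpret g: Vector_Spaces.linear scale "(*)" g by (rule g)
  have "lf g" unfolding lf_def by (simp add: g.add g.scale)
  moreover have "g w = 1" using g(2) by auto
  moreover have "g x = 0" if "x \<in> S" for x
  proof (rule vs.linear_eq_0_on_span[OF g(1)])
    show "x \<in> span B" using that spanB by simp
    show "g b = 0" if "b \<in> B" for b
      using that g(2) assms(2) B(1) by auto
  qed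
  ultimately show ?thesis using that by blast
qed

text \<open>For a subspace \<open>S\<close> this is the span of \<open>S\<close> and
  \<open>w\<close>. The parametrisation by pairs is a bijection when \<open>w \<notin> S\<close>, so
  counts become sums over lines in direction \<open>w\<close> or over translates of
  \<open>S\<close>.\<close>

definition ext :: "'b set \<Rightarrow> 'b \<Rightarrow> 'b set" where
  "ext S w = (\<lambda>(y, t). y + t *s w) ` (S \<times> UNIV)"

lemma extI: "y \<in> S \<Longrightarrow> y + t *s w \<in> ext S w"
  unfolding ext_def by force

lemma extE:
  assumes "x \<in> ext S w" obtains y t where "y \<in> S" "x = y + t *s w"
  using assms unfolding ext_def by auto

lemma subset_ext: "S \<subseteq> ext S w"
  using extI[of _ S 0 w] by auto

lemma mem_ext: "subspace S \<Longrightarrow> w \<in> ext S w"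
  using extI[of 0 S 1 w] by (auto simp: subspace_0)

lemma scale_mem_ext: "subspace S \<Longrightarrow> t *s w \<in> ext S w"
  using extI[of 0 S t w] by (auto simp: subspace_0)

lemma ext_subset: "subspace V \<Longrightarrow> S \<subseteq> V \<Longrightarrow> w \<in> V \<Longrightarrow> ext S w \<subseteq> V"
  by (auto elim!: extE intro!: subspace_add subspace_scale)

lemma subspace_ext:
  assumes "subspace S" shows "subspace (ext S w)"
proof (rule subspaceI)
  show "0 \<in> ext S w" using subset_ext assms subspace_0 by blast
  fix x y assume "x \<in> ext S w" "y \<in> ext S w"
  then obtain a s b t where *: "a \<in> S" "b \<in> S" "x = a + s *s w" "y = b + t *s w"
    by (metis extE)
  have "x + y = (a + b) + (s + t) *s w" using * by (simp add: scale_left_distrib)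
  then show "x + y \<in> ext S w" using * assms by (metis extI subspace_add)
next
  fix c x assume "x \<in> ext S w"
  then obtain a s where *: "a \<in> S" "x = a + s *s w" by (metis extE)
  have "c *s x = c *s a + (c * s) *s w" using * by (simp add: scale_right_distrib)
  then show "c *s x \<in> ext S w" using * assms by (metis extI subspace_scale)
qed

lemma scale_notin: "subspace S \<Longrightarrow> w \<notin> S \<Longrightarrow> t *s w \<in> S \<Longrightarrow> t = 0"
  by (metis left_inverse scale_one scale_scale subspace_scale)

lemma ext_inj:
  assumes "subspace S" "w \<notin> S"
  shows "inj_on (\<lambda>(y, t). y + t *s w) (S \<times> UNIV)"
proof (rule inj_onI, clarsimp)
  fix y t y' t' assume *: "y \<in> S" "y' \<in> S" "y + t *s w = y' + t' *s w"
  then have "y - y' = (t' - t) *s w" by (simp add: algebra_simps scale_left_diff_distrib)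
  then have "(t' - t) *s w \<in> S" using * assms subspace_diff by metis
  then have "t' = t" using scale_notin assms by fastforce
  then show "y = y' \<and> t = t'" using * by auto
qed

lemma card_ext: "subspace S \<Longrightarrow> w \<notin> S \<Longrightarrow> card (ext S w) = q * card S"
  unfolding ext_def by (simp add: card_image[OF ext_inj] card_cartesian_product)

lemma finite_ext: "finite S \<Longrightarrow> finite (ext S w)"
  unfolding ext_def by simp

lemma card_ext_filter:
  assumes "subspace S" "w \<notin> S" "finite S"
  shows "card {x \<in> ext S w. P x} = (\<Sum>y\<in>S. card {t. P (y + t *s w)})"
proof -
  have "{x \<in> ext S w. P x} = (\<lambda>(y, t). y + t *s w) ` (SIGMA y:S. {t. P (y + t *s w)})"
    unfolding ext_def by auto
  moreover have "inj_on (\<lambda>(y, t). y + t *s w) (SIGMA y:S. {t. P (y + t *s w)})"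
    by (rule inj_on_subset[OF ext_inj[OF assms(1,2)]]) auto
  ultimately show ?thesis using assms(3) by (simp add: card_image)
qed

lemma card_ext_filter':
  assumes "subspace S" "w \<notin> S" "finite S"
  shows "card {x \<in> ext S w. P x} = (\<Sum>t\<in>UNIV. card {y \<in> S. P (y + t *s w)})"
proof -
  have "card {x \<in> ext S w. P x} = (\<Sum>y\<in>S. \<Sum>t\<in>UNIV. if P (y + t *s w) then 1 else 0)"
    by (simp add: card_ext_filter[OF assms] sum.If_cases)
  also have "\<dots> = (\<Sum>t\<in>UNIV. \<Sum>y\<in>S. if P (y + t *s w) then 1 else 0)"
    by (rule sum.swap)
  finally show ?thesis using assms by (simp add: sum.If_cases Int_def)
qed

lemma ext_eq_if_card:
  assumes "subspace S" "subspace V" "finite V" "S \<subseteq> V" "w \<in> V" "w \<notin> S" "card V = q * card S"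
  shows "ext S w = V"
  using assms by (intro card_subset_eq ext_subset) (auto simp: card_ext)

lemma card_subspace_pos: "subspace S \<Longrightarrow> finite S \<Longrightarrow> card S > 0"
  using subspace_0 card_gt_0_iff by blast

lemma card_subspace_le:
  assumes "subspace S" "subspace V" "finite V" "S \<subseteq> V" "S \<noteq> V"
  shows "q * card S \<le> card V"
proof -
  obtain w where "w \<in> V" "w \<notin> S" using assms by blast
  then show ?thesis using assms card_ext[of S w] card_mono[OF assms(3) ext_subset[of V S w]]
    by simp
qed

text \<open>Codimension one versus at least two: adjoining a vector to \<open>S\<close> either fills
  \<open>V\<close> or leaves room for a further factor \<open>q\<close>.\<close>

lemma card_subspace_cases:
  assumes "subspace S" "subspace V" "finite V" "S \<subseteq> V" "S \<noteq> V"
  shows "card V = q * card S \<or> q ^ 2 * card S \<le> card V"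
proof -
  obtain w where w: "w \<in> V" "w \<notin> S" using assms by blast
  show ?thesis
  proof (cases "ext S w = V")
    case True
    then show ?thesis using card_ext w assms by metis
  next
    case False
    then have "q * card (ext S w) \<le> card V"
      using assms w by (intro card_subspace_le subspace_ext ext_subset) auto
    then show ?thesis using assms w by (simp add: card_ext power2_eq_square)
  qed
qed

lemma subspace_kernel:
  assumes "lf l" "subspace W" shows "subspace {x \<in> W. l x = 0}"
  using assms by (auto simp: subspace_def lf_simps)

lemma kernel_split:
  assumes "lf l" "subspace W" "w \<in> W" "l w \<noteq> 0"
  shows "ext {x \<in> W. l x = 0} w = W" "w \<notin> {x \<in> W. l x = 0}"
proof -
  show "w \<notin> {x \<in> W. l x = 0}" using assms by simp
  show "ext {x \<in> W. l x = 0} w = W"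
  proof
    show "ext {x \<in> W. l x = 0} w \<subseteq> W" using assms by (intro ext_subset) auto
    show "W \<subseteq> ext {x \<in> W. l x = 0} w"
    proof
      fix x assume "x \<in> W"
      then have "x - (l x / l w) *s w \<in> {x \<in> W. l x = 0}"
        using assms by (auto simp: lf_simps subspace_diff subspace_scale)
      from extI[OF this, of "l x / l w" w] show "x \<in> ext {x \<in> W. l x = 0} w" by simp
    qed
  qed
qed

lemma card_kernel:
  assumes "lf l" "subspace W" "w \<in> W" "l w \<noteq> 0"
  shows "card W = q * card {x \<in> W. l x = 0}"
  using kernel_split[OF assms] card_ext[OF subspace_kernel[OF assms(1,2)], of w] by simp

lemma complement_exists:
  assumes W: "subspace W" "w \<in> W" "w \<noteq> 0"
  obtains S l where "subspace S" "S \<subseteq> W" "w \<notin> S" "ext S w = W" "lf l" "l w = 1"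
    "\<forall>x\<in>S. l x = 0"
proof -
  have "w \<notin> {0}" using W by simp
  then obtain l where l: "lf l" "l w = 1" "\<forall>x\<in>{0}. l x = 0"
    by (rule lf_exists[OF subspace_single_0])
  have nz: "l w \<noteq> 0" using l by simp
  show ?thesis
    by (rule that[OF subspace_kernel[OF l(1) W(1)] _ kernel_split(2)[OF l(1) W(1,2) nz]
      kernel_split(1)[OF l(1) W(1,2) nz] l(1,2)]) auto
qed

lemma subspace_induct [consumes 2, case_names zero ext]:
  assumes "subspace W" "finite W"
    and "P {0}"
    and "\<And>S w. subspace S \<Longrightarrow> finite S \<Longrightarrow> w \<notin> S \<Longrightarrow> P S \<Longrightarrow> P (ext S w)"
  shows "P W"
  using assms(1,2)
proof (induction "card W" arbitrary: W rule: less_induct)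
  case less
  show ?case
  proof (cases "W = {0}")
    case False
    then obtain w where w: "w \<in> W" "w \<noteq> 0" using less.prems subspace_0 by blast
    from complement_exists[OF less.prems(1) this] obtain S where
      S: "subspace S" "S \<subseteq> W" "w \<notin> S" "ext S w = W" by metis
    have fin: "finite S" using S less.prems finite_subset by blast
    have "card S < card W" using S w less.prems by (intro psubset_card_mono) auto
    then have "P S" using less.hyps S fin by blast
    then show ?thesis using assms(4)[OF S(1) fin S(3)] S(4) by simp
  qed (use assms(3) in simp)
qed

text \<open>Double counting of pairs: \<open>A\<close> is a union of cosets of \<open>S\<close>, so
  each fixed \<open>y\<close> permutes \<open>A\<close> by translation. With \<open>A\<close> the
  complement of a subspace this turns bounds on single cosets into bounds on the zero set.\<close>

lemma translate_count:
  assumes "subspace S" "finite S" "finite A" "\<And>x y. x \<in> A \<Longrightarrow> y \<in> S \<Longrightarrow> x + y \<in> A"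
  shows "(\<Sum>x\<in>A. card {y \<in> S. P (x + y)}) = card S * card {x \<in> A. P x}"
proof -
  have "(\<Sum>x\<in>A. card {y \<in> S. P (x + y)}) = (\<Sum>x\<in>A. \<Sum>y\<in>S. if P (x + y) then 1 else 0)"
    using assms by (simp add: sum.If_cases Int_def)
  also have "\<dots> = (\<Sum>y\<in>S. \<Sum>x\<in>A. if P (x + y) then 1 else 0)" by (rule sum.swap)
  also have "\<dots> = (\<Sum>y\<in>S. \<Sum>x\<in>A. if P x then 1 else 0)"
  proof (rule sum.cong[OF refl])
    fix y assume y: "y \<in> S"
    show "(\<Sum>x\<in>A. if P (x + y) then 1 else 0) = (\<Sum>x\<in>A. if P x then 1 else (0::nat))"
    proof (rule sum.reindex_bij_witness[where i="\<lambda>x. x - y" and j="\<lambda>x. x + y"])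
      fix x assume "x \<in> A"
      then show "x - y \<in> A" using assms(4)[of x "- y"] y assms(1) subspace_neg by simp
    qed (use assms y in auto)
  qed
  finally show ?thesis using assms by (simp add: sum.If_cases Int_def)
qed

lemma exists_maximal_subspace:
  assumes "finite V" "subspace V" "P {0}"
  obtains S where "subspace S" "S \<subseteq> V" "P S"
    "\<And>T. subspace T \<Longrightarrow> T \<subseteq> V \<Longrightarrow> P T \<Longrightarrow> card T \<le> card S"
proof -
  let ?\<S> = "{S. subspace S \<and> S \<subseteq> V \<and> P S}"
  have "finite ?\<S>" by (rule finite_subset[of _ "Pow V"]) (use assms in auto)
  moreover have "{0} \<in> ?\<S>" using assms subspace_0 by auto
  ultimately obtain S where S: "S \<in> ?\<S>" "\<forall>T\<in>?\<S>. card T \<le> card S"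
    using finite_has_maximal_measure[of ?\<S> "{0}" card] by blast
  show ?thesis by (rule that[of S]) (use S in auto)
qed

subsection \<open>Polynomial functions\<close>

text \<open>\<open>PF e\<close> means representable by a polynomial of degree at most
  \<open>e\<close>, and \<open>HP e\<close> by a form of degree \<open>e\<close>. These are
  coordinate-free predicates on functions; since \<open>t^q = t\<close> they do not define a degree,
  and the zero function satisfies every \<open>HP e\<close>.\<close>

inductive PF :: "nat \<Rightarrow> ('b \<Rightarrow> 'a) \<Rightarrow> bool" where
  const: "PF e (\<lambda>_. c)"
| mult: "lf l \<Longrightarrow> PF e g \<Longrightarrow> PF (Suc e) (\<lambda>x. l x * g x)"
| add: "PF e f \<Longrightarrow> PF e g \<Longrightarrow> PF e (\<lambda>x. f x + g x)"

inductive HP :: "nat \<Rightarrow> ('b \<Rightarrow> 'a) \<Rightarrow> bool" where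
  const: "HP 0 (\<lambda>_. c)"
| mult: "lf l \<Longrightarrow> HP e g \<Longrightarrow> HP (Suc e) (\<lambda>x. l x * g x)"
| add: "HP e f \<Longrightarrow> HP e g \<Longrightarrow> HP e (\<lambda>x. f x + g x)"

lemma PF_Suc: "PF e f \<Longrightarrow> PF (Suc e) f"
  by (induction rule: PF.induct) (auto intro: PF.intros)

lemma PF_mono: "PF e f \<Longrightarrow> e \<le> e' \<Longrightarrow> PF e' f"
  by (induction e') (auto intro: PF_Suc simp: le_Suc_eq)

lemma HP_imp_PF: "HP e f \<Longrightarrow> PF e f"
  by (induction rule: HP.induct) (auto intro: PF.intros)

lemma HP_zero: "HP e (\<lambda>_. 0)"
proof (induction e)
  case (Suc e)
  then show ?case using HP.mult[OF lf_const_zero] by fastforce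
qed (rule HP.const)

lemma PF_cmult: "PF e f \<Longrightarrow> PF e (\<lambda>x. c * f x)"
proof (induction rule: PF.induct)
  case (mult l e g)
  then show ?case using PF.mult[of l e "\<lambda>x. c * g x"] by (simp add: algebra_simps)
qed (auto intro: PF.intros simp: algebra_simps)

lemma HP_cmult: "HP e f \<Longrightarrow> HP e (\<lambda>x. c * f x)"
proof (induction rule: HP.induct)
  case (mult l e g)
  then show ?case using HP.mult[of l e "\<lambda>x. c * g x"] by (simp add: algebra_simps)
qed (auto intro: HP.intros simp: algebra_simps)

lemma PF_diff: "PF e f \<Longrightarrow> PF e g \<Longrightarrow> PF e (\<lambda>x. f x - g x)"
  using PF.add[OF _ PF_cmult[of e g "-1"]] by simp

lemma HP_sum: "(\<And>i. i \<in> I \<Longrightarrow> HP e (f i)) \<Longrightarrow> HP e (\<lambda>x. \<Sum>i\<in>I. f i x)"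
  by (induction I rule: infinite_finite_induct) (auto intro: HP.intros HP_zero)

lemma PF_mult: "PF a f \<Longrightarrow> PF b g \<Longrightarrow> PF (a + b) (\<lambda>x. f x * g x)"
proof (induction rule: PF.induct)
  case (const e c)
  then show ?case using PF_mono[OF PF_cmult] by simp
next
  case (mult l e h)
  then show ?case using PF.mult[of l "e + b" "\<lambda>x. h x * g x"] by (simp add: mult.assoc)
qed (auto intro: PF.intros simp: algebra_simps)

lemma HP_mult: "HP a f \<Longrightarrow> HP b g \<Longrightarrow> HP (a + b) (\<lambda>x. f x * g x)"
proof (induction rule: HP.induct)
  case (const c)
  then show ?case using HP_cmult by simp
next
  case (mult l e h)
  then show ?case using HP.mult[of l "e + b" "\<lambda>x. h x * g x"] by (simp add: mult.assoc)
qed (auto intro: HP.intros simp: algebra_simps)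

lemma PF_lf: "lf l \<Longrightarrow> PF (Suc 0) l"
  using PF.mult[OF _ PF.const[of 0 1], of l] by simp

lemma PF_mult_affine: "lf l \<Longrightarrow> PF e g \<Longrightarrow> PF (Suc e) (\<lambda>x. (l x + c) * g x)"
  using PF.add[OF PF.mult[of l e g] PF_Suc[OF PF_cmult[of e g c]]] by (simp add: algebra_simps)

lemma PF_translate: "PF e f \<Longrightarrow> PF e (\<lambda>x. f (a + x))"
proof (induction rule: PF.induct)
  case (mult l e g)
  then show ?case using PF_mult_affine[of l e "\<lambda>x. g (a + x)" "l a"]
    by (simp add: lf_simps algebra_simps)
qed (auto intro: PF.intros)

lemma PF_0_const: "PF e f \<Longrightarrow> e = 0 \<Longrightarrow> \<exists>c. \<forall>x. f x = c"
proof (induction rule: PF.induct)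
  case (add e f g)
  then obtain c d where "\<forall>x. f x = c" "\<forall>x. g x = d" by blast
  then show ?case by (intro exI[of _ "c + d"]) auto
qed auto

lemma HP_homogeneous: "HP e f \<Longrightarrow> f (c *s x) = c ^ e * f x"
  by (induction rule: HP.induct) (auto simp: lf_simps algebra_simps)

lemma HP_at_zero: "HP (Suc e) f \<Longrightarrow> f 0 = 0"
  using HP_homogeneous[of "Suc e" f 0 0] by simp

text \<open>The case distinction guards against truncated subtraction: in degree \<open>0\<close>
  the lower part must be zero, while \<open>PF (0 - 1)\<close> would still admit constants.\<close>

lemma PF_top_form: "PF e f \<Longrightarrow> \<exists>g h. HP e h \<and> (if e = 0 then g = (\<lambda>_. 0) else PF (e - 1) g) \<and> f = (\<lambda>x. g x + h x)"
proof (induction rule: PF.induct)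
  case (const e c)
  show ?case
  proof (cases e)
    case 0
    then show ?thesis by (intro exI[of _ "\<lambda>_. 0"] exI[of _ "\<lambda>_. c"]) (auto intro: HP.const)
  next
    case (Suc n)
    then show ?thesis
      by (intro exI[of _ "\<lambda>_. c"] exI[of _ "\<lambda>_. 0"]) (auto intro: HP_zero PF.const)
  qed
next
  case (mult l e g)
  then obtain g' h where *: "HP e h" "if e = 0 then g' = (\<lambda>_. 0) else PF (e - 1) g'" "g = (\<lambda>x. g' x + h x)"
    by blast
  have "PF e (\<lambda>x. l x * g' x)"
    using *(2) mult.hyps PF.mult[of l "e - 1" g'] by (auto intro: PF.const split: if_splits)
  moreover have "HP (Suc e) (\<lambda>x. l x * h x)" using * mult.hyps HP.mult by blast
  ultimately show ?case using * by (intro exI[of _ "\<lambda>x. l x * g' x"] exI[of _ "\<lambda>x. l x * h x"])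
    (auto simp: algebra_simps)
next
  case (add e f g)
  then obtain f' fh g' gh where *: "HP e fh" "if e = 0 then f' = (\<lambda>_. 0) else PF (e - 1) f'"
    "f = (\<lambda>x. f' x + fh x)" "HP e gh" "if e = 0 then g' = (\<lambda>_. 0) else PF (e - 1) g'" "g = (\<lambda>x. g' x + gh x)"
    by blast
  then show ?case by (intro exI[of _ "\<lambda>x. f' x + g' x"] exI[of _ "\<lambda>x. fh x + gh x"])
    (auto simp: algebra_simps intro: HP.add PF.add)
qed

text \<open>The expansion of \<open>t \<mapsto> f (x + t w)\<close> is recorded as a polynomial in \<open>t\<close> because values do not
  determine coefficients once the degree reaches \<open>q\<close>.\<close>

definition expansion :: "('b \<Rightarrow> 'a) \<Rightarrow> nat \<Rightarrow> 'b \<Rightarrow> ('b \<Rightarrow> 'a poly) \<Rightarrow> bool" where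
  "expansion f e w p \<longleftrightarrow> (\<forall>x t. f (x + t *s w) = poly (p x) t) \<and> (\<forall>x. degree (p x) \<le> e) \<and>
     (\<forall>j\<le>e. PF (e - j) (\<lambda>x. coeff (p x) j))"

lemma coeff_linear_mult:
  "coeff ([:a, b:] * p) j = a * coeff p j + (if j = 0 then 0 else b * coeff p (j - 1))"
  by (cases j) (auto simp: algebra_simps)

lemma expansion_const: "expansion (\<lambda>_. c) e w (\<lambda>_. [:c:])"
  unfolding expansion_def by (auto intro: PF.const)

lemma expansion_mult:
  assumes p: "expansion g e w p" and l: "lf l"
  shows "expansion (\<lambda>x. l x * g x) (Suc e) w (\<lambda>x. [:l x, l w:] * p x)"
proof -
  let ?p = "\<lambda>x. [:l x, l w:] * p x"
  have "PF (Suc e - j) (\<lambda>x. coeff (?p x) j)" if j: "j \<le> Suc e" for j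
  proof -
    have 1: "PF (Suc e - j) (\<lambda>x. l x * coeff (p x) j)"
    proof (cases "j = Suc e")
      case True
      then have "coeff (p x) j = 0" for x using p unfolding expansion_def
        by (metis coeff_eq_0 le_imp_less_Suc)
      then show ?thesis using PF.const[of _ 0] by simp
    next
      case False
      then show ?thesis using p j l PF.mult[of l "e - j"] unfolding expansion_def
        by (simp add: Suc_diff_le)
    qed
    have 2: "PF (Suc e - j) (\<lambda>x. if j = 0 then 0 else l w * coeff (p x) (j - 1))"
    proof (cases j)
      case (Suc i)
      then show ?thesis using p j PF_cmult[of "e - i" "\<lambda>x. coeff (p x) i" "l w"]
        unfolding expansion_def by simp
    qed (auto intro: PF.const)
    show ?thesis unfolding coeff_linear_mult using PF.add[OF 1 2] .
  qed
  moreover have "degree (?p x) \<le> Suc e" for x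
  proof -
    have "degree [:l x, l w:] \<le> 1" "degree (p x) \<le> e"
      using p by (auto simp: expansion_def)
    then show ?thesis using degree_mult_le[of "[:l x, l w:]" "p x"] by linarith
  qed
  moreover have "l (x + t *s w) * g (x + t *s w) = poly (?p x) t" for x t
    using p l unfolding expansion_def by (simp add: lf_simps algebra_simps)
  ultimately show ?thesis unfolding expansion_def by simp
qed

lemma expansion_add:
  "expansion f e w p \<Longrightarrow> expansion g e w r \<Longrightarrow> expansion (\<lambda>x. f x + g x) e w (\<lambda>x. p x + r x)"
  unfolding expansion_def by (auto intro: PF.add degree_add_le)

lemma expansion_Suc:
  assumes "expansion f e w p" shows "expansion f (Suc e) w p"
proof -
  have "PF (Suc e - j) (\<lambda>x. coeff (p x) j)" if j: "j \<le> Suc e" for j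
  proof (cases "j = Suc e")
    case True
    then have "coeff (p x) j = 0" for x using assms unfolding expansion_def
      by (metis coeff_eq_0 le_imp_less_Suc)
    then show ?thesis using PF.const[of _ 0] by simp
  next
    case False
    then show ?thesis using j assms PF_mono unfolding expansion_def by (simp add: Suc_diff_le PF_Suc)
  qed
  then show ?thesis using assms unfolding expansion_def by (auto intro: le_SucI)
qed

lemma PF_expansion: "PF e f \<Longrightarrow> \<exists>p. expansion f e w p"
  by (induction rule: PF.induct) (auto intro: expansion_const expansion_mult expansion_add)

text \<open>The top coefficient along \<open>w\<close> does not depend on the base point. If
  \<open>f w \<noteq> 0\<close>, all restrictions to lines in direction \<open>w\<close> become
  monic after one common scaling.\<close>

lemma HP_expansion: "HP e f \<Longrightarrow> \<exists>p. expansion f e w p \<and> (\<forall>x. coeff (p x) e = f w)"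
proof (induction rule: HP.induct)
  case (const c)
  then show ?case using expansion_const[of c 0 w] by (intro exI[of _ "\<lambda>_. [:c:]"]) auto
next
  case (mult l e g)
  then obtain p where p: "expansion g e w p" "\<forall>x. coeff (p x) e = g w" by blast
  have "coeff (p x) (Suc e) = 0" for x
    using p(1) unfolding expansion_def by (metis coeff_eq_0 le_imp_less_Suc)
  then have "\<forall>x. coeff ([:l x, l w:] * p x) (Suc e) = l w * g w"
    unfolding coeff_linear_mult using p(2) by simp
  then show ?case using expansion_mult[OF p(1) mult.hyps(1)] by blast
next
  case (add e f g)
  then obtain p r where "expansion f e w p" "expansion g e w r"
    "\<forall>x. coeff (p x) e = f w" "\<forall>x. coeff (r x) e = g w" by blast
  then show ?case using expansion_add[of f e w p g r]
    by (intro exI[of _ "\<lambda>x. p x + r x"]) auto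
qed

text \<open>The counterpart of \<open>expansion\<close> with the base point \<open>a\<close> fixed
  and the direction varying. \<open>D\<close> is the formal differential at \<open>a\<close>; its
  linearity in the direction is what the later arguments exploit.\<close>

definition tangent :: "('b \<Rightarrow> 'a) \<Rightarrow> nat \<Rightarrow> 'b \<Rightarrow> ('b \<Rightarrow> 'a) \<Rightarrow> ('b \<Rightarrow> 'a poly) \<Rightarrow> bool" where
  "tangent f e a D p \<longleftrightarrow> lf D \<and> (\<forall>x. degree (p x) \<le> e \<and> coeff (p x) 1 = D x \<and>
     (\<forall>t. f (a + t *s x) = poly (p x) t))"

lemma tangent_const: "tangent (\<lambda>_. c) e a (\<lambda>_. 0) (\<lambda>_. [:c:])"
  unfolding tangent_def by (auto intro: lf_const_zero)

lemma tangent_add: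
  "tangent f e a D p \<Longrightarrow> tangent g e a E r \<Longrightarrow>
    tangent (\<lambda>x. f x + g x) e a (\<lambda>x. D x + E x) (\<lambda>x. p x + r x)"
  using lf_comb[of D E 1 1] unfolding tangent_def by (auto intro: degree_add_le)

lemma tangent_mult:
  assumes p: "tangent g e a D p" and l: "lf l"
  shows "tangent (\<lambda>x. l x * g x) (Suc e) a (\<lambda>x. l a * D x + g a * l x) (\<lambda>x. [:l a, l x:] * p x)"
proof -
  have "degree ([:l a, l x:] * p x) \<le> Suc e" for x
  proof -
    have "degree [:l a, l x:] \<le> 1" "degree (p x) \<le> e"
      using p by (auto simp: tangent_def)
    then show ?thesis using degree_mult_le[of "[:l a, l x:]" "p x"] by linarith
  qed
  moreover have "coeff (p x) 0 = g a" for x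
    using p unfolding tangent_def by (metis add.right_neutral poly_0_coeff_0 scale_zero_left)
  moreover have "l (a + t *s x) * g (a + t *s x) = poly ([:l a, l x:] * p x) t" for x t
    using p l unfolding tangent_def by (simp add: lf_simps algebra_simps)
  ultimately show ?thesis using p lf_comb[of D l "l a" "g a"] l unfolding tangent_def coeff_linear_mult
    by (simp add: algebra_simps)
qed

lemma PF_tangent: "PF e f \<Longrightarrow> \<exists>D p. tangent f e a D p"
  by (induction rule: PF.induct) (blast intro: tangent_const tangent_mult tangent_add)+

text \<open>The top coefficient is recorded for forms of degree \<open>q\<close>: two expansions
  with equal top coefficient differ by a polynomial of degree below \<open>q\<close>, which its
  values determine.\<close>

lemma HP_tangent: "HP e f \<Longrightarrow> \<exists>D p. tangent f e a D p \<and> (\<forall>x. coeff (p x) e = f x)"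
proof (induction rule: HP.induct)
  case (const c)
  then show ?case using tangent_const[of c 0 a]
    by (intro exI[of _ "\<lambda>_. 0"] exI[of _ "\<lambda>_. [:c:]"]) auto
next
  case (mult l e g)
  then obtain D p where p: "tangent g e a D p" "\<forall>x. coeff (p x) e = g x" by blast
  have "coeff (p x) (Suc e) = 0" for x
    using p(1) unfolding tangent_def by (metis coeff_eq_0 le_imp_less_Suc)
  then have "\<forall>x. coeff ([:l a, l x:] * p x) (Suc e) = l x * g x"
    unfolding coeff_linear_mult using p(2) by simp
  then show ?case using tangent_mult[OF p(1) mult.hyps(1)] by blast
next
  case (add e f g)
  then obtain D p E r where "tangent f e a D p" "tangent g e a E r"
    "\<forall>x. coeff (p x) e = f x" "\<forall>x. coeff (r x) e = g x" by blast
  then show ?case using tangent_add[of f e a D p g E r]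
    by (intro exI[of _ "\<lambda>x. D x + E x"] exI[of _ "\<lambda>x. p x + r x"]) auto
qed

end

section \<open>Univariate polynomials over a finite field\<close>

lemma finite_field_power_card:
  fixes x :: "'a::{field,finite}"
  shows "x ^ CARD('a) = x"
proof (cases "x = 0")
  case False
  let ?U = "UNIV - {0 :: 'a}"
  have "bij_betw (\<lambda>y. x * y) ?U ?U"
    by (rule bij_betw_byWitness[where f' = "\<lambda>y. y / x"]) (use False in auto)
  then have "(\<Prod>y\<in>?U. x * y) = (\<Prod>y\<in>?U. y)"
    by (rule prod.reindex_bij_betw)
  then have "x ^ card ?U * (\<Prod>y\<in>?U. y) = (\<Prod>y\<in>?U. y)" by (simp add: prod.distrib)
  moreover have "(\<Prod>y\<in>?U. y) \<noteq> 0" by simp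
  ultimately have 1: "x ^ card ?U = 1" by simp
  have "CARD('a) = Suc (card ?U)"
    by (rule card.remove) auto
  then have "x ^ CARD('a) = x * x ^ card ?U" by (simp only: power_Suc)
  then show ?thesis unfolding 1 by simp
qed simp

lemma card_roots_le:
  fixes p :: "'a::{field,finite} poly"
  assumes "p \<noteq> 0" "degree p \<le> j"
  shows "card {t. poly p t = 0} \<le> j"
  using card_poly_roots_bound[OF assms(1)] assms(2) by simp

lemma poly_eq_0_if_values:
  fixes p :: "'a::{field,finite} poly"
  assumes "degree p < CARD('a)" "\<And>t. poly p t = 0"
  shows "p = 0"
  using card_roots_le[of p "degree p"] assms by (cases "p = 0") auto

text \<open>Picks the highest power of \<open>t\<close> that occurs anywhere on \<open>S\<close>.
  The zero polynomial also has degree \<open>0\<close>, so if it attains the maximal degree, all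
  degrees vanish and \<open>p y0\<close> supplies the nonzero coefficient for
  \<open>j = 0\<close>.\<close>

lemma exists_top_index:
  fixes p :: "'b \<Rightarrow> 'a::zero poly"
  assumes "finite S" "y0 \<in> S" "p y0 \<noteq> 0"
  obtains j where "\<forall>y\<in>S. degree (p y) \<le> j" "\<exists>y\<in>S. coeff (p y) j \<noteq> 0"
proof -
  obtain z where z: "z \<in> S" "\<forall>y\<in>S. degree (p y) \<le> degree (p z)"
    using finite_has_maximal_measure[OF assms(1,2), of "\<lambda>y. degree (p y)"] by blast
  show ?thesis
  proof (cases "p z = 0")
    case True
    then have "degree (p y0) = 0" using z assms by auto
    then have "coeff (p y0) 0 \<noteq> 0" using assms(3) by (metis leading_coeff_0_iff)
    then show ?thesis using that[of 0] z True assms(2) by auto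
  next
    case False
    then show ?thesis using that[of "degree (p z)"] z by (metis leading_coeff_0_iff)
  qed
qed

section \<open>The two largest zero counts of polynomial functions\<close>

context finite_field_space
begin

abbreviation zeros :: "('b \<Rightarrow> 'a) \<Rightarrow> 'b set \<Rightarrow> nat" where
  "zeros f W \<equiv> card {x \<in> W. f x = 0}"

abbreviation zeros_at :: "('b \<Rightarrow> 'a) \<Rightarrow> 'b \<Rightarrow> 'b set \<Rightarrow> nat" where
  "zeros_at f w W \<equiv> card {y \<in> W. f (w + y) = 0}"

lemma power_q: "(t :: 'a) ^ q = t"
  using finite_field_power_card[of t] by simp

lemma q_ge_2: "q \<ge> 2"
proof -
  have "card {0, 1 :: 'a} \<le> CARD('a)" by (intro card_mono) auto
  then show ?thesis by simp
qed

lemma card_zeros_nonzeros: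
  assumes "finite W" shows "card {x \<in> W. f x = (0::'a)} + card {x \<in> W. f x \<noteq> 0} = card W"
proof -
  have "card W = card ({x \<in> W. f x = 0} \<union> {x \<in> W. f x \<noteq> 0})" by (rule arg_cong[of _ _ card]) auto
  also have "\<dots> = card {x \<in> W. f x = 0} + card {x \<in> W. f x \<noteq> 0}"
    using assms by (intro card_Un_disjoint) auto
  finally show ?thesis by simp
qed

lemma card_nonroots_ge:
  assumes "(p :: 'a poly) \<noteq> 0" "degree p \<le> j"
  shows "q - j \<le> card {t. poly p t \<noteq> 0}"
  using card_zeros_nonzeros[of UNIV "poly p"] card_roots_le[OF assms] by simp

text \<open>Where the coefficient of \<open>t^j\<close> survives, the line through \<open>y\<close>
  in direction \<open>w\<close> carries a nonzero polynomial of degree at most \<open>j\<close>,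
  hence at least \<open>q - j\<close> non-zeros.\<close>

lemma card_nonzeros_slice:
  assumes S: "subspace S" "w \<notin> S" "finite S"
    and p: "\<And>y t. y \<in> S \<Longrightarrow> f (y + t *s w) = poly (p y) t" "\<And>y. y \<in> S \<Longrightarrow> degree (p y) \<le> j"
  shows "(q - j) * card {y \<in> S. coeff (p y) j \<noteq> 0} \<le> card {x \<in> ext S w. f x \<noteq> 0}"
proof -
  have "(q - j) * card {y \<in> S. coeff (p y) j \<noteq> 0} = (\<Sum>y\<in>{y \<in> S. coeff (p y) j \<noteq> 0}. q - j)"
    by simp
  also have "\<dots> \<le> (\<Sum>y\<in>{y \<in> S. coeff (p y) j \<noteq> 0}. card {t. f (y + t *s w) \<noteq> 0})"
  proof (rule sum_mono)
    fix y assume y: "y \<in> {y \<in> S. coeff (p y) j \<noteq> 0}"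
    then have "q - j \<le> card {t. poly (p y) t \<noteq> 0}" using p by (intro card_nonroots_ge) auto
    then show "q - j \<le> card {t. f (y + t *s w) \<noteq> 0}" using p y by simp
  qed
  also have "\<dots> \<le> (\<Sum>y\<in>S. card {t. f (y + t *s w) \<noteq> 0})"
    using S by (intro sum_mono2) auto
  also have "\<dots> = card {x \<in> ext S w. f x \<noteq> 0}" using card_ext_filter[OF S] by simp
  finally show ?thesis .
qed

text \<open>Induction along one direction: the top coefficient in \<open>t\<close>, at index
  \<open>j\<close>, is a function of degree \<open>e - j\<close> on \<open>S\<close>, and each of
  its non-zeros yields \<open>q - j\<close> non-zeros of \<open>f\<close>. The step closes because
  \<open>(q - j) * (q - (e - j))\<close> equals \<open>q * (q - e) + j * (e - j)\<close>.\<close>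

lemma schwartz_zippel:
  assumes "subspace W" "finite W" "PF e f" "e \<le> q" "\<exists>x\<in>W. f x \<noteq> 0"
  shows "(q - e) * card W \<le> q * card {x \<in> W. f x \<noteq> 0}"
  using assms
proof (induction W arbitrary: e f rule: subspace_induct)
  case zero
  then have "{x \<in> {0}. f x \<noteq> 0} = {0}" by auto
  then have "card {x \<in> {0}. f x \<noteq> 0} = 1" by simp
  then show ?case by simp
next
  case (ext S w)
  obtain p where p: "expansion f e w p" using PF_expansion ext.prems by blast
  obtain y0 where y0: "y0 \<in> S" "p y0 \<noteq> 0"
  proof -
    obtain x where "x \<in> ext S w" "f x \<noteq> 0" using ext.prems by blast
    moreover from this(1) obtain y t where "y \<in> S" "x = y + t *s w" by (rule extE)
    ultimately have "y \<in> S" "poly (p y) t \<noteq> 0" using p unfolding expansion_def by auto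
    then show ?thesis using that[of y] poly_0 by metis
  qed
  obtain j where j: "\<forall>y\<in>S. degree (p y) \<le> j" "\<exists>y\<in>S. coeff (p y) j \<noteq> 0"
    by (rule exists_top_index[where p = p, OF ext.hyps(2) y0])
  have je: "j \<le> e" using j p unfolding expansion_def by (metis le_degree le_trans)
  have IH: "(q - (e - j)) * card S \<le> q * card {y \<in> S. coeff (p y) j \<noteq> 0}"
    using ext.IH[of "e - j" "\<lambda>y. coeff (p y) j"] j(2) p je ext.prems unfolding expansion_def by auto
  have sl: "(q - j) * card {y \<in> S. coeff (p y) j \<noteq> 0} \<le> card {x \<in> ext S w. f x \<noteq> 0}"
    using card_nonzeros_slice[of S w f p j] ext.hyps j p unfolding expansion_def by auto
  have arith: "q * (q - e) \<le> (q - j) * (q - (e - j))"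
  proof -
    obtain i where i: "e = j + i" using je le_Suc_ex by blast
    obtain k where "q = e + k" using ext.prems le_Suc_ex by blast
    then show ?thesis using i by (simp add: algebra_simps)
  qed
  have "(q - e) * card (ext S w) = q * (q - e) * card S"
    using ext.hyps by (simp add: card_ext)
  also have "\<dots> \<le> (q - j) * (q - (e - j)) * card S" using arith by (rule mult_le_mono1)
  also have "\<dots> \<le> (q - j) * (q * card {y \<in> S. coeff (p y) j \<noteq> 0})"
    using IH by (simp add: mult.assoc)
  also have "\<dots> \<le> q * card {x \<in> ext S w. f x \<noteq> 0}"
    using mult_le_mono2[OF sl, of q] by (simp only: mult_ac)
  finally show ?case .
qed

lemma card_zeros_le:
  assumes "subspace W" "finite W" "PF e f" "\<exists>x\<in>W. f x \<noteq> 0"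
  shows "q * zeros f W \<le> e * card W"
proof (cases "e \<le> q")
  case True
  have "q * card W = q * zeros f W + q * card {x \<in> W. f x \<noteq> 0}"
    unfolding card_zeros_nonzeros[OF assms(2), of f, symmetric] by (rule distrib_left)
  moreover have "q * card W = (q - e) * card W + e * card W"
    using True by (simp flip: add_mult_distrib)
  ultimately show ?thesis using schwartz_zippel[OF assms(1-3) True assms(4)] by linarith
next
  case False
  then show ?thesis using assms by (intro mult_le_mono card_mono) auto
qed

text \<open>In degree \<open>q\<close> the top coefficient is folded into the linear one by \<open>t ^ q = t\<close>.\<close>

lemma schwartz_zippel_q:
  assumes "subspace W" "finite W" "PF q f" "\<exists>x\<in>W. f x \<noteq> 0"
  shows "(q - 1) * card W \<le> q ^ 2 * card {x \<in> W. f x \<noteq> 0}"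
  using assms
proof (induction W arbitrary: f rule: subspace_induct)
  case zero
  then have "{x \<in> {0}. f x \<noteq> 0} = {0}" by auto
  then have "card {x \<in> {0}. f x \<noteq> 0} = 1" by simp
  moreover have "q - 1 \<le> q ^ 2" using power2_nat_le_imp_le[of q] self_le_power[of q 2] q_ge_2 by linarith
  ultimately show ?case by simp
next
  case (ext S w)
  obtain p' where p': "expansion f q w p'" using PF_expansion ext.prems by blast
  define p where "p y = p' y + monom (coeff (p' y) q) 1 - monom (coeff (p' y) q) q" for y
  have fp: "f (y + t *s w) = poly (p y) t" for y t
    using p' unfolding expansion_def p_def by (simp add: poly_monom power_q)
  have cp: "coeff (p y) j = (if j = q then 0 else if j = 1 then coeff (p' y) 1 + coeff (p' y) q else coeff (p' y) j)" for y j
    unfolding p_def using q_ge_2 by auto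
  have degp: "degree (p y) \<le> q - 1" for y
  proof (rule degree_le, intro allI impI)
    fix i assume "q - 1 < i"
    then have "i = q \<or> (q < i \<and> i \<noteq> 1)" using q_ge_2 by linarith
    moreover have "q < i \<Longrightarrow> coeff (p' y) i = 0"
      using p' unfolding expansion_def by (meson coeff_eq_0 le_less_trans)
    ultimately show "coeff (p y) i = 0" using cp by auto
  qed
  have PFp: "PF (q - j) (\<lambda>y. coeff (p y) j)" if "j \<le> q" for j
  proof -
    consider "j = q" | "j = 1" "j \<noteq> q" | "j \<noteq> 1" "j \<noteq> q" by blast
    then show ?thesis
    proof cases
      case 2
      then have "PF (q - j) (\<lambda>y. coeff (p' y) 1 + coeff (p' y) q)"
        using p' that PF_mono[of 0 "\<lambda>y. coeff (p' y) q" "q - j"] unfolding expansion_def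
        by (intro PF.add) auto
      then show ?thesis using 2 by (simp add: cp)
    qed (use p' that in \<open>auto simp: cp expansion_def intro: PF.const\<close>)
  qed
  obtain y0 where y0: "y0 \<in> S" "p y0 \<noteq> 0"
  proof -
    obtain x where "x \<in> ext S w" "f x \<noteq> 0" using ext.prems by blast
    moreover from this(1) obtain y t where "y \<in> S" "x = y + t *s w" by (rule extE)
    ultimately have "y \<in> S" "poly (p y) t \<noteq> 0" using fp by auto
    then show ?thesis using that[of y] poly_0 by metis
  qed
  obtain j where j: "\<forall>y\<in>S. degree (p y) \<le> j" "\<exists>y\<in>S. coeff (p y) j \<noteq> 0"
    by (rule exists_top_index[where p = p, OF ext.hyps(2) y0])
  have jq: "j \<le> q - 1" using j degp by (metis le_degree le_trans)
  let ?n = "card {y \<in> S. coeff (p y) j \<noteq> 0}"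
  have sl: "(q - j) * ?n \<le> card {x \<in> ext S w. f x \<noteq> 0}"
    using card_nonzeros_slice[of S w f p j] ext.hyps j fp by auto
  have cext: "card (ext S w) = q * card S" using ext.hyps by (simp add: card_ext)
  \<comment> \<open>For \<open>j = 0\<close> the function is constant along \<open>w\<close> and may
    still need degree \<open>q\<close> on \<open>S\<close>, so the induction hypothesis is used.
    Otherwise the coefficient has degree \<open>q - j < q\<close>, the previous lemma applies, and
    \<open>(q - j) * j\<close> is smallest at \<open>j = 1\<close> and
    \<open>j = q - 1\<close>.\<close>
  show ?case
  proof (cases "j = 0")
    case True
    then have "(q - 1) * card S \<le> q ^ 2 * ?n"
      using ext.IH[of "\<lambda>y. coeff (p y) j"] PFp[of 0] j by simp
    then have "(q - 1) * card (ext S w) \<le> q ^ 2 * ((q - j) * ?n)"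
      using True cext by (simp add: mult.left_commute)
    then show ?thesis using sl by (meson le_trans mult_le_mono2)
  next
    case False
    have "j * card S \<le> q * ?n"
      using schwartz_zippel[OF ext.hyps(1,2) PFp, of j] j jq by auto
    from mult_le_mono2[OF this, of "q - j"]
    have 1: "(q - j) * (j * card S) \<le> q * ((q - j) * ?n)" by (simp only: mult_ac)
    have "q - 1 \<le> (q - j) * j"
    proof -
      obtain i where "j = Suc i" using False not0_implies_Suc by blast
      moreover obtain k where "q = Suc (j + k)" using jq q_ge_2
        by (metis add_Suc less_iff_Suc_add Suc_diff_1 le_imp_less_Suc q_pos)
      ultimately show ?thesis by (simp add: algebra_simps)
    qed
    from mult_le_mono1[OF this, of "card S"]
    have "(q - 1) * card S \<le> q * ((q - j) * ?n)" using 1 by (simp only: mult.assoc)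
    also have "\<dots> \<le> q * card {x \<in> ext S w. f x \<noteq> 0}" using sl by simp
    finally have "q * ((q - 1) * card S) \<le> q * (q * card {x \<in> ext S w. f x \<noteq> 0})"
      by (rule mult_le_mono2)
    then show ?thesis using cext by (simp add: power2_eq_square mult_ac)
  qed
qed

text \<open>Division of \<open>x^k\<close> by the monic \<open>Q y\<close>, uniformly in
  \<open>y\<close>. If \<open>x\<close> has weight one, \<open>Q y\<close> has weight
  \<open>e\<close> and \<open>x^k\<close> weight \<open>k\<close>; reduction respects weights, so
  the coefficient of \<open>x^j\<close> in the remainder has degree at most \<open>k - j\<close> in
  \<open>y\<close>.\<close>

lemma power_mod_coefficients:
  assumes Q: "\<And>y. degree (Q y) = e" "\<And>y. coeff (Q y) e = 1" "e \<ge> 1"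
    "\<And>j. j \<le> e \<Longrightarrow> PF (e - j) (\<lambda>y. coeff (Q y) j)"
  shows "\<exists>\<rho>. (\<forall>y. Q y dvd monom 1 k - \<rho> y) \<and> (\<forall>y. \<forall>j\<ge>e. coeff (\<rho> y) j = 0) \<and>
    (\<forall>j\<le>k. PF (k - j) (\<lambda>y. coeff (\<rho> y) j)) \<and> (\<forall>j>k. \<forall>y. coeff (\<rho> y) j = 0)"
proof (induction k)
  case 0
  show ?case using Q(3)
    by (intro exI[of _ "\<lambda>_. monom 1 0"]) (auto intro: PF.const)
next
  case (Suc k)
  then obtain \<rho> where \<rho>: "\<And>y. Q y dvd monom 1 k - \<rho> y" "\<And>y j. j \<ge> e \<Longrightarrow> coeff (\<rho> y) j = 0"
    "\<And>j. j \<le> k \<Longrightarrow> PF (k - j) (\<lambda>y. coeff (\<rho> y) j)" "\<And>j y. j > k \<Longrightarrow> coeff (\<rho> y) j = 0"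
    by blast
  have Q0: "coeff (Q y) j = 0" if "j > e" for y j using Q(1) that by (simp add: coeff_eq_0)
  \<comment> \<open>Multiply the previous remainder by \<open>x\<close> and cancel the new term in
    \<open>x^e\<close> with a multiple of the monic \<open>Q y\<close>.\<close>
  define \<sigma> where "\<sigma> y = pCons 0 (\<rho> y) - smult (coeff (\<rho> y) (e - 1)) (Q y)" for y
  have c\<sigma>: "coeff (\<sigma> y) j = (if j = 0 then 0 else coeff (\<rho> y) (j - 1)) - coeff (\<rho> y) (e - 1) * coeff (Q y) j" for y j
    unfolding \<sigma>_def by (cases j) auto
  have "Q y dvd monom 1 (Suc k) - \<sigma> y" for y
  proof -
    have "monom 1 (Suc k) - \<sigma> y = [:0, 1:] * (monom 1 k - \<rho> y) + smult (coeff (\<rho> y) (e - 1)) (Q y)"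
      unfolding \<sigma>_def by (simp add: monom_Suc)
    moreover have "Q y dvd [:0, 1:] * (monom 1 k - \<rho> y)" using \<rho>(1) by (rule dvd_mult)
    moreover have "Q y dvd smult (coeff (\<rho> y) (e - 1)) (Q y)" by (rule dvd_smult) simp
    ultimately show ?thesis by (simp only: dvd_add)
  qed
  moreover have "coeff (\<sigma> y) j = 0" if "j \<ge> e" for y j
  proof (cases "j = e")
    case True
    then show ?thesis using Q(2,3) by (simp add: c\<sigma>)
  next
    case False
    then show ?thesis using that Q0[of j y] \<rho>(2)[of "j - 1" y] by (simp add: c\<sigma>)
  qed
  moreover have "PF (Suc k - j) (\<lambda>y. coeff (\<sigma> y) j)" if j: "j \<le> Suc k" for j
  proof -
    have 1: "PF (Suc k - j) (\<lambda>y. if j = 0 then 0 else coeff (\<rho> y) (j - 1))"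
      using \<rho>(3)[of "j - 1"] j by (cases j) (auto intro: PF.const)
    have 2: "PF (Suc k - j) (\<lambda>y. coeff (\<rho> y) (e - 1) * coeff (Q y) j)"
    proof (cases "e - 1 \<le> k \<and> j \<le> e")
      case True
      then have "PF (k - (e - 1) + (e - j)) (\<lambda>y. coeff (\<rho> y) (e - 1) * coeff (Q y) j)"
        using \<rho>(3) Q(4) by (intro PF_mult) auto
      moreover have "k - (e - 1) + (e - j) = Suc k - j" using True Q(3) j by linarith
      ultimately show ?thesis by simp
    next
      case False
      then have "coeff (\<rho> y) (e - 1) * coeff (Q y) j = 0" for y
        using \<rho>(4)[of "e - 1" y] Q0[of j y] by auto
      then show ?thesis by (simp only: PF.const)
    qed
    show ?thesis unfolding c\<sigma> using PF_diff[OF 1 2] .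
  qed
  moreover have "coeff (\<sigma> y) j = 0" if "j > Suc k" for y j
  proof -
    have "coeff (\<rho> y) (j - 1) = 0" using \<rho>(4) that by simp
    moreover have "coeff (\<rho> y) (e - 1) = 0 \<or> coeff (Q y) j = 0"
      using \<rho>(4)[of "e - 1" y] Q0[of j y] that by linarith
    ultimately show ?thesis by (auto simp: c\<sigma>)
  qed
  ultimately show ?case by blast
qed

text \<open>Write \<open>x^q - x = p * s\<close>. Every field element is a root of \<open>p\<close>
  or of \<open>s\<close>, while the degrees add up to at most \<open>q\<close>; so neither factor
  can have fewer roots than its degree.\<close>

lemma card_roots_eq_degree:
  fixes p :: "'a poly"
  assumes "p dvd monom 1 q - monom 1 1"
  shows "card {t. poly p t = 0} = degree p"
proof -
  let ?X = "monom 1 q - monom 1 1 :: 'a poly"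
  obtain s where s: "?X = p * s" using assms by (auto simp: dvd_def)
  have "coeff ?X q = 1" using q_ge_2 by simp
  then have X0: "?X \<noteq> 0" by (metis coeff_0 zero_neq_one)
  have "degree ?X \<le> q" by (intro degree_diff_le) (use q_ge_2 in \<open>auto simp: degree_monom_eq\<close>)
  moreover have "p \<noteq> 0" "s \<noteq> 0" using X0 s by auto
  ultimately have deg: "degree p + degree s \<le> q" using s degree_mult_eq[of p s] by simp
  have "poly p t = 0 \<or> poly s t = 0" for t
  proof -
    have "poly (p * s) t = 0" unfolding s[symmetric] by (simp add: poly_monom power_q)
    then show ?thesis by simp
  qed
  then have "UNIV = {t. poly p t = 0} \<union> {t. poly s t = 0}" by auto
  then have "q \<le> card {t. poly p t = 0} + card {t. poly s t = 0}"
    by (metis card_UNIV_q card_Un_le)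
  then show ?thesis using deg card_roots_le[OF \<open>p \<noteq> 0\<close> order_refl] card_roots_le[OF \<open>s \<noteq> 0\<close> order_refl]
    by linarith
qed

lemma sum_deficit:
  assumes "finite S" "\<And>y. y \<in> S \<Longrightarrow> r y \<le> (e::nat)" "\<And>y. y \<in> S \<Longrightarrow> P y \<Longrightarrow> r y \<le> j" "j \<le> e"
  shows "sum r S + (e - j) * card {y \<in> S. P y} \<le> e * card S"
proof -
  have "sum r S + (e - j) * card {y \<in> S. P y} = (\<Sum>y\<in>S. r y + (if P y then e - j else 0))"
    using assms(1) by (simp add: sum.distrib sum.If_cases Int_def)
  also have "\<dots> \<le> (\<Sum>y\<in>S. e)" using assms(2-4) by (intro sum_mono) force
  finally show ?thesis by (simp add: mult.commute)
qed

text \<open>The second weight of affine Reed--Muller codes. In a direction where the top form does not vanish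
  the restrictions to lines are monic of degree \<open>e\<close>. The remainder of \<open>x ^ q - x\<close> modulo them
  vanishes exactly on the lines with \<open>e\<close> zeros, and its coefficients are polynomial functions of small
  degree on the base.\<close>

theorem second_weight:
  assumes W: "subspace W" "finite W" and f: "PF e f" and e: "1 \<le> e" "e < q" and ex: "\<exists>x\<in>W. f x \<noteq> 0"
  defines "v \<equiv> zeros f W"
  shows "q * v = e * card W \<or> q ^ 2 * v + (e - 1) * card W \<le> e * q * card W"
proof -
  obtain g h where gh: "HP e h" "PF (e - 1) g" "f = (\<lambda>x. g x + h x)"
    using PF_top_form[OF f] e(1) by auto
  show ?thesis
  proof (cases "\<forall>x\<in>W. h x = 0")
    \<comment> \<open>If the top form vanishes on \<open>W\<close>, then \<open>f\<close> agrees
      there with a function of degree \<open>e - 1\<close>, whose maximal count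
      \<open>(e - 1) * card W / q\<close> already lies below the second one.\<close>
    case True
    then have fg: "f x = g x" if "x \<in> W" for x using gh that by simp
    have "{x \<in> W. f x = 0} = {x \<in> W. g x = 0}" using fg by auto
    moreover have "\<exists>x\<in>W. g x \<noteq> 0" using ex fg by auto
    ultimately have "q * v \<le> (e - 1) * card W"
      using card_zeros_le[OF W gh(2)] v_def by simp
    then have "q * (q * v) \<le> q * ((e - 1) * card W)" by (rule mult_le_mono2)
    moreover have "q * ((e - 1) * card W) + (e - 1) * card W \<le> e * q * card W"
    proof -
      obtain i where i: "e = Suc i" using e(1) by (cases e) auto
      then have "i * card W \<le> q * card W" using e by simp
      then show ?thesis using i by (simp add: algebra_simps)
    qed
    ultimately have "q * (q * v) + (e - 1) * card W \<le> e * q * card W" by linarith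
    then show ?thesis by (intro disjI2) (simp only: power2_eq_square mult.assoc)
  next
    case False
    then obtain w where w: "w \<in> W" "h w \<noteq> 0" by blast
    have "w \<noteq> 0" using w gh(1) e(1) HP_at_zero[of "e - 1" h] by (cases e) auto
    then obtain S l where S: "subspace S" "S \<subseteq> W" "w \<notin> S" "ext S w = W" "lf l" "l w = 1" "\<forall>x\<in>S. l x = 0"
      by (rule complement_exists[OF W(1) w(1)])
    have finS: "finite S" using S(2) W(2) finite_subset by blast
    have cW: "card W = q * card S" using card_ext[OF S(1,3)] S(4) by simp
    obtain pg where pg: "expansion g (e - 1) w pg" using PF_expansion[OF gh(2)] by blast
    obtain ph where ph: "expansion h e w ph" "\<forall>x. coeff (ph x) e = h w" using HP_expansion[OF gh(1)] by blast
    have pg': "expansion g e w pg" using expansion_Suc[OF pg] e(1) by simp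
    have pge: "coeff (pg x) e = 0" for x
    proof -
      have "degree (pg x) \<le> e - 1" using pg unfolding expansion_def by blast
      then show ?thesis using e(1) by (intro coeff_eq_0) simp
    qed
    have P: "expansion f e w (\<lambda>x. pg x + ph x)" unfolding gh(3) by (rule expansion_add[OF pg' ph(1)])
    define Q where "Q x = smult (inverse (h w)) (pg x + ph x)" for x
    have Qe: "coeff (Q x) e = 1" for x using ph(2) pge w(2) unfolding Q_def by simp
    have "degree (Q x) \<le> e" for x
      using P unfolding Q_def expansion_def by (meson degree_smult_le le_trans)
    then have Qdeg: "degree (Q x) = e" for x
      using le_degree[of "Q x" e] Qe[of x] by (simp add: antisym)
    have Q0: "Q x \<noteq> 0" for x using Qe[of x] by (metis coeff_0 zero_neq_one)
    have QPF: "PF (e - j) (\<lambda>y. coeff (Q y) j)" if "j \<le> e" for j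
      using P that PF_cmult[of "e - j" "\<lambda>y. coeff (pg y + ph y) j" "inverse (h w)"]
      unfolding Q_def expansion_def by simp
    have fQ: "f (y + t *s w) = 0 \<longleftrightarrow> poly (Q y) t = 0" for y t
      using P w(2) unfolding Q_def expansion_def by simp
    obtain \<rho> where \<rho>: "\<forall>y. Q y dvd monom 1 q - \<rho> y" "\<forall>y. \<forall>j\<ge>e. coeff (\<rho> y) j = 0"
      "\<forall>j\<le>q. PF (q - j) (\<lambda>y. coeff (\<rho> y) j)"
      using power_mod_coefficients[of Q e q, OF Qdeg Qe e(1) QPF] by blast
    define R where "R y = \<rho> y - monom 1 1" for y
    have RPF: "PF (q - j) (\<lambda>y. coeff (R y) j)" if "j \<le> q" for j
      unfolding R_def coeff_diff using \<rho>(3) that by (intro PF_diff PF.const) blast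
    have QR: "Q y dvd (monom 1 q - monom 1 1) - R y" for y
      using \<rho>(1) unfolding R_def by simp
    define r where "r y = card {t. poly (Q y) t = 0}" for y
    have re: "r y \<le> e" for y unfolding r_def using card_roots_le[OF Q0] Qdeg by simp
    have vr: "v = sum r S"
      using card_ext_filter[OF S(1,3) finS, of "\<lambda>x. f x = 0"] S(4) fQ unfolding v_def r_def by simp
    show ?thesis
    proof (cases "\<forall>y\<in>S. R y = 0")
      \<comment> \<open>A zero remainder everywhere means that each \<open>Q y\<close> divides
        \<open>x^q - x\<close>, so every line in direction \<open>w\<close> has exactly
        \<open>e\<close> zeros and the maximum is attained.\<close>
      case True
      then have "r y = e" if "y \<in> S" for y
        using QR[of y] that Qdeg card_roots_eq_degree[of "Q y"] unfolding r_def by simp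
      then have "v = e * card S" using vr by simp
      then show ?thesis using cW by simp
    next
      case False
      then obtain y0 where y0: "y0 \<in> S" "R y0 \<noteq> 0" by blast
      obtain j where j: "\<forall>y\<in>S. degree (R y) \<le> j" "\<exists>y\<in>S. coeff (R y) j \<noteq> 0"
        by (rule exists_top_index[where p = R, OF finS y0])
      define n where "n = card {y \<in> S. coeff (R y) j \<noteq> 0}"
      have rj: "r y \<le> j" if "y \<in> S" "coeff (R y) j \<noteq> 0" for y
      proof -
        have "{t. poly (Q y) t = 0} \<subseteq> {t. poly (R y) t = 0}"
        proof
          fix t assume "t \<in> {t. poly (Q y) t = 0}"
          moreover obtain k where k: "(monom 1 q - monom 1 1) - R y = Q y * k" using QR[of y] by (rule dvdE)
          ultimately have "poly ((monom 1 q - monom 1 1) - R y) t = 0" unfolding k by simp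
          then show "t \<in> {t. poly (R y) t = 0}" by (simp add: poly_monom power_q)
        qed
        then have "r y \<le> card {t. poly (R y) t = 0}" unfolding r_def by (intro card_mono) auto
        also have "\<dots> \<le> j" using that j(1) by (intro card_roots_le) auto
        finally show ?thesis .
      qed
      show ?thesis
      proof (cases "j < e")
        case False
        text \<open>only possible for \<open>e = 1\<close>, where the remainder has the coefficient \<open>-1\<close> at \<open>x\<close>\<close>
        have je: "e = 1 \<and> j = 1"
        proof -
          obtain y where "y \<in> S" "coeff (R y) j \<noteq> 0" using j by blast
          moreover have "coeff (\<rho> y) j = 0" for y using \<rho>(2) False by simp
          ultimately show ?thesis using False e(1) unfolding R_def by (auto split: if_splits)
        qed
        have "q * v \<le> e * card W" unfolding v_def by (rule card_zeros_le[OF W f ex])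
        from mult_le_mono2[OF this, of q] have "q ^ 2 * v \<le> e * q * card W"
          unfolding power2_eq_square by (simp only: mult_ac)
        then show ?thesis using je by simp
      next
        case True
        have def: "v + (e - j) * n \<le> e * card S"
          unfolding vr n_def using True by (intro sum_deficit finS re rj) auto
        \<comment> \<open>Each of the \<open>n\<close> lines whose remainder has a nonzero
          coefficient at \<open>j\<close> misses at least \<open>e - j\<close> zeros. For
          \<open>j > 0\<close> this coefficient has degree \<open>q - j\<close>, so
          \<open>q * n \<ge> j * card S\<close>, and \<open>(e - j) * j \<ge> e - 1\<close>. For
          \<open>j = 0\<close> its degree may be \<open>q\<close>, and
          \<open>schwartz_zippel_q\<close> gives the weaker bound on \<open>n\<close>, which
          suffices because then \<open>e\<close> zeros are missing per line.\<close>
        show ?thesis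
        proof (cases "j = 0")
          case False
          have "j * card S \<le> q * n"
            using schwartz_zippel[OF S(1) finS RPF, of j] j(2) True e unfolding n_def by simp
          from mult_le_mono2[OF this, of "e - j"]
          have "(e - j) * (j * card S) \<le> q * ((e - j) * n)" by (simp only: mult_ac)
          moreover have "q * v + q * ((e - j) * n) \<le> q * (e * card S)"
            using mult_le_mono2[OF def, of q] by (simp only: add_mult_distrib2)
          moreover have "(e - 1) * card S \<le> (e - j) * (j * card S)"
          proof -
            obtain i k where "j = Suc i" "e = Suc (j + k)" using False True
              by (metis less_iff_Suc_add not0_implies_Suc)
            then show ?thesis by (simp add: algebra_simps)
          qed
          ultimately have "q * v + (e - 1) * card S \<le> q * (e * card S)" by linarith
          then have "q * (q * v + (e - 1) * card S) \<le> q * (q * (e * card S))" by (rule mult_le_mono2)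
          then show ?thesis using cW by (simp add: power2_eq_square algebra_simps)
        next
          case j0: True
          have "(q - 1) * card S \<le> q ^ 2 * n"
            using schwartz_zippel_q[OF S(1) finS, of "\<lambda>y. coeff (R y) j"] RPF[of j] j(2) j0 unfolding n_def by simp
          from mult_le_mono2[OF this, of e]
          have "e * ((q - 1) * card S) \<le> q ^ 2 * (e * n)" by (simp only: mult_ac)
          moreover have "q ^ 2 * v + q ^ 2 * (e * n) \<le> q ^ 2 * (e * card S)"
            using mult_le_mono2[OF def, of "q ^ 2"] j0 by (simp only: add_mult_distrib2 minus_nat.diff_0)
          moreover have "(e - 1) * (q * card S) \<le> e * ((q - 1) * card S)"
          proof -
            obtain i where i: "e = Suc i" using e(1) by (cases e) auto
            obtain k where k: "q = Suc (e + k)" using e(2) less_iff_Suc_add by blast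
            show ?thesis using i k by (simp add: algebra_simps)
          qed
          ultimately have "q ^ 2 * v + (e - 1) * (q * card S) \<le> q ^ 2 * (e * card S)" by linarith
          then show ?thesis using cW by (simp add: power2_eq_square algebra_simps)
        qed
      qed
    qed
  qed
qed


section \<open>Splitting off affine factors from functions with many zeros\<close>

text \<open>Division by \<open>l - t\<close> with remainder. When \<open>l w = 1\<close>, the point
  \<open>x - (l x - t) *s w\<close> is the projection of \<open>x\<close> to the slice
  \<open>l = t\<close> along \<open>w\<close>, so the remainder depends only on the values on that
  slice.\<close>

lemma PF_split_affine:
  assumes l: "lf l"
  shows "PF e f \<Longrightarrow> \<exists>g. (if e = 0 then g = (\<lambda>_. 0) else PF (e - 1) g) \<and>
    (\<forall>x. f x = f (x - (l x - t) *s w) + (l x - t) * g x)"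
proof (induction rule: PF.induct)
  case (const e c)
  show ?case by (intro exI[of _ "\<lambda>_. 0"]) (auto intro: PF.const)
next
  case (mult k e h)
  then obtain g where g: "if e = 0 then g = (\<lambda>_. 0) else PF (e - 1) g"
    "\<And>x. h x = h (x - (l x - t) *s w) + (l x - t) * g x" by blast
  let ?g = "\<lambda>x. (k x - (l x - t) * k w) * g x + k w * h x"
  have 1: "PF e (\<lambda>x. (k x - (l x - t) * k w) * g x)"
  proof (cases "e = 0")
    case True
    then show ?thesis using g(1) PF.const[of _ 0] by simp
  next
    case False
    have "lf (\<lambda>x. 1 * k x + (- k w) * l x)" using mult.hyps(1) l by (rule lf_comb)
    from PF_mult_affine[OF this, of "e - 1" g "t * k w"] False g(1)
    show ?thesis by (simp add: algebra_simps)
  qed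
  have 2: "PF e ?g" using 1 PF_cmult[OF mult.hyps(2)] by (rule PF.add)
  have 3: "k x * h x = k (x - (l x - t) *s w) * h (x - (l x - t) *s w) + (l x - t) * ?g x" for x
  proof -
    define a where "a = l x - t"
    have H: "h (x - a *s w) = h x - a * g x" using g(2)[of x] unfolding a_def[symmetric] by (metis add_diff_cancel_right')
    have K: "k (x - a *s w) = k x - a * k w" using mult.hyps(1) by (simp add: lf_simps)
    show ?thesis unfolding a_def[symmetric] H K by (simp only: algebra_simps)
  qed
  show ?case
  proof (intro exI conjI)
    show "if Suc e = 0 then ?g = (\<lambda>_. 0) else PF (Suc e - 1) ?g" using 2 by simp
    show "\<forall>x. k x * h x = k (x - (l x - t) *s w) * h (x - (l x - t) *s w) + (l x - t) * ?g x"
      using 3 by blast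
  qed
next
  case (add e f g)
  then obtain f' g' where *: "if e = 0 then f' = (\<lambda>_. 0) else PF (e - 1) f'"
    "if e = 0 then g' = (\<lambda>_. 0) else PF (e - 1) g'"
    "\<forall>x. f x = f (x - (l x - t) *s w) + (l x - t) * f' x"
    "\<forall>x. g x = g (x - (l x - t) *s w) + (l x - t) * g' x" by blast
  have "f x + g x = f (x - (l x - t) *s w) + g (x - (l x - t) *s w) + (l x - t) * (f' x + g' x)" for x
    by (subst *(3)[rule_format], subst *(4)[rule_format]) (simp add: algebra_simps)
  then have 3: "\<forall>x. f x + g x = f (x - (l x - t) *s w) + g (x - (l x - t) *s w) + (l x - t) * (f' x + g' x)"
    by blast
  have "if e = 0 then (\<lambda>x. f' x + g' x) = (\<lambda>_. 0) else PF (e - 1) (\<lambda>x. f' x + g' x)"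
    using *(1,2) by (auto intro: PF.add)
  with 3 show ?case by blast
qed

lemma factor_slice:
  assumes "subspace W" "w \<in> W" "lf l" "l w = 1" "PF e f"
    and zero: "\<And>x. x \<in> W \<Longrightarrow> l x = t \<Longrightarrow> f x = 0" and nz: "\<exists>x\<in>W. f x \<noteq> 0"
  obtains e' g where "e = Suc e'" "PF e' g" "\<forall>x\<in>W. f x = (l x - t) * g x"
proof -
  obtain g where g: "if e = 0 then g = (\<lambda>_. 0) else PF (e - 1) g"
    "\<forall>x. f x = f (x - (l x - t) *s w) + (l x - t) * g x"
    using PF_split_affine[OF assms(3,5), of t w] by blast
  have fg: "\<forall>x\<in>W. f x = (l x - t) * g x"
  proof
    fix x assume "x \<in> W"
    then have "f (x - (l x - t) *s w) = 0"
      using assms(1-4) by (intro zero) (auto simp: lf_simps subspace_diff subspace_scale)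
    then show "f x = (l x - t) * g x" using g(2)[rule_format, of x] by simp
  qed
  then have "e \<noteq> 0" using nz g(1) by (auto split: if_splits)
  then have "e = Suc (e - 1)" "PF (e - 1) g" using g(1) by auto
  then show ?thesis using fg by (rule that)
qed

lemma factor_slices:
  assumes W: "subspace W" "w \<in> W" "lf l" "l w = 1" and T: "finite T"
  shows "PF e f \<Longrightarrow> (\<And>x. x \<in> W \<Longrightarrow> l x \<in> T \<Longrightarrow> f x = 0) \<Longrightarrow> \<exists>x\<in>W. f x \<noteq> 0 \<Longrightarrow>
    card T \<le> e \<and> (\<exists>h. PF (e - card T) h \<and> (\<forall>x\<in>W. f x = (\<Prod>t\<in>T. l x - t) * h x))"
  using T
proof (induction T arbitrary: e f rule: finite_induct)
  case empty
  then show ?case by auto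
next
  case (insert t T)
  have z: "f x = 0" if "x \<in> W" "l x = t" for x using insert.prems(2) that by simp
  obtain e' g where g: "e = Suc e'" "PF e' g" "\<forall>x\<in>W. f x = (l x - t) * g x"
    by (rule factor_slice[OF W insert.prems(1) z insert.prems(3)])
  have "g x = 0" if "x \<in> W" "l x \<in> T" for x
    using insert.prems(2)[of x] g(3) that insert.hyps(2) by auto
  moreover have "\<exists>x\<in>W. g x \<noteq> 0" using insert.prems(3) g(3) by auto
  ultimately obtain h where h: "card T \<le> e'" "PF (e' - card T) h" "\<forall>x\<in>W. g x = (\<Prod>t\<in>T. l x - t) * h x"
    using insert.IH[OF g(2)] by blast
  then show ?case using g insert.hyps by (auto simp: mult.assoc)
qed

text \<open>\<open>T\<close> collects the parallel slices contained in the zero set. Dividing by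
  their product leaves degree \<open>e - card T\<close>, which bounds each of the other
  \<open>q - card T\<close> slices; the sum falls short of the maximum by the product
  \<open>card T * (e - card T)\<close>. No shortfall with \<open>T\<close> nonempty thus forces
  \<open>card T = e\<close>.\<close>

lemma slice_bound:
  assumes W: "subspace W" "finite W" "w \<in> W" "lf l" "l w = 1" and f: "PF e f" "\<exists>x\<in>W. f x \<noteq> 0"
  defines "M \<equiv> {x \<in> W. l x = 0}" and "T \<equiv> {t. \<forall>x\<in>W. l x = t \<longrightarrow> f x = 0}"
  shows "card T \<le> e" "q * zeros f W + card T * (e - card T) * card M \<le> e * q * card M"
    "card T = e \<Longrightarrow> \<exists>c. c \<noteq> 0 \<and> (\<forall>x\<in>W. f x = c * (\<Prod>t\<in>T. l x - t))"
proof -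
  have fT: "finite T" by simp
  have zT: "f x = 0" if "x \<in> W" "l x \<in> T" for x using that unfolding T_def by auto
  obtain h where h: "card T \<le> e" "PF (e - card T) h" "\<forall>x\<in>W. f x = (\<Prod>t\<in>T. l x - t) * h x"
    using factor_slices[OF W(1,3,4,5) fT f(1) zT f(2)] by blast
  show "card T \<le> e" by (rule h)
  show "\<exists>c. c \<noteq> 0 \<and> (\<forall>x\<in>W. f x = c * (\<Prod>t\<in>T. l x - t))" if "card T = e"
  proof -
    have "e - card T = 0" using that by simp
    then obtain c where c: "\<forall>x. h x = c" using PF_0_const[OF h(2)] by blast
    moreover have "c \<noteq> 0" using f(2) h(3) c by auto
    ultimately show ?thesis using h(3) by (intro exI[of _ c]) (auto simp: mult.commute)
  qed
  have M: "subspace M" unfolding M_def by (rule subspace_kernel[OF W(4,1)])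
  have lw: "l w \<noteq> 0" using W(5) by simp
  have ext: "ext M w = W" "w \<notin> M"
    using kernel_split[OF W(4,1,3) lw] unfolding M_def by auto
  have finM: "finite M" using W(2) unfolding M_def by simp
  have lM: "l (y + t *s w) = t" if "y \<in> M" for y t
    using that W(4,5) unfolding M_def by (simp add: lf_simps)
  have inW: "y + t *s w \<in> W" if "y \<in> M" for y t using extI[OF that] ext(1) by blast
  define n where "n t = card {y \<in> M. f (y + t *s w) = 0}" for t
  have nT: "n t \<le> card M" for t unfolding n_def using finM by (intro card_mono) auto
  have nnT: "q * n t \<le> (e - card T) * card M" if "t \<notin> T" for t
  proof -
    have prod: "(\<Prod>s\<in>T. t - s) \<noteq> 0" using that by auto
    have fh: "f (y + t *s w) = 0 \<longleftrightarrow> h (t *s w + y) = 0" if "y \<in> M" for y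
      using h(3) inW[OF that] lM[OF that] prod by (simp add: add.commute)
    obtain x where x: "x \<in> W" "l x = t" "f x \<noteq> 0" using \<open>t \<notin> T\<close> unfolding T_def by auto
    have "x - t *s w \<in> M" using x W unfolding M_def by (auto simp: lf_simps subspace_diff subspace_scale)
    moreover have "h (t *s w + (x - t *s w)) \<noteq> 0" using x h(3) by auto
    ultimately have ex: "\<exists>y\<in>M. h (t *s w + y) \<noteq> 0" by blast
    have "q * card {y \<in> M. h (t *s w + y) = 0} \<le> (e - card T) * card M"
      by (rule card_zeros_le[OF M finM PF_translate[OF h(2)] ex])
    moreover have "{y \<in> M. f (y + t *s w) = 0} = {y \<in> M. h (t *s w + y) = 0}" using fh by auto
    ultimately show ?thesis unfolding n_def by simp
  qed
  have "zeros f W = sum n UNIV"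
    using card_ext_filter'[OF M ext(2) finM, of "\<lambda>x. f x = 0"] ext(1) unfolding n_def by simp
  also have "\<dots> = sum n T + sum n (- T)"
    using sum.subset_diff[of T UNIV n] by (simp add: Compl_eq_Diff_UNIV add.commute)
  finally have v: "q * zeros f W = q * sum n T + (\<Sum>t\<in>-T. q * n t)"
    by (simp add: add_mult_distrib2 sum_distrib_left)
  have "sum n T \<le> card T * card M" using sum_mono[of T n "\<lambda>_. card M"] nT by simp
  then have 1: "q * sum n T \<le> q * card T * card M" by simp
  have "card (- T) = q - card T" by (simp add: Compl_eq_Diff_UNIV card_Diff_subset)
  then have 2: "(\<Sum>t\<in>-T. q * n t) \<le> (q - card T) * ((e - card T) * card M)"
    using sum_mono[of "- T" "\<lambda>t. q * n t" "\<lambda>_. (e - card T) * card M"] nnT by simp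
  have "card T \<le> q" using card_mono[of UNIV T] by simp
  then obtain a b where ab: "q = card T + a" "e = card T + b" using h(1) le_Suc_ex by metis
  define r where "r = card T"
  have "q * card T * card M + (q - card T) * ((e - card T) * card M) + card T * (e - card T) * card M = e * q * card M"
    unfolding r_def[symmetric] using ab unfolding r_def[symmetric] by (simp add: algebra_simps)
  then show "q * zeros f W + card T * (e - card T) * card M \<le> e * q * card M"
    using v 1 2 by linarith
qed

text \<open>Outside \<open>M\<close>, the space \<open>ext M w\<close> consists of the cosets of
  \<open>t *s w\<close> with \<open>t \<noteq> 0\<close>. Scaling by \<open>t\<close> and
  translation by \<open>M\<close> both permute \<open>W - M\<close>, which produces the factors
  \<open>q - 1\<close> and \<open>card M\<close>.\<close>

lemma sum_scaled_translates:
  assumes W: "subspace W" "finite W" "subspace M" "M \<subseteq> W"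
  shows "(\<Sum>w\<in>W - M. card {x \<in> ext M w. x \<notin> M \<and> P x}) = (q - 1) * card M * card {x \<in> W - M. P x}"
proof -
  have finM: "finite M" using W finite_subset by blast
  have inv: "x + y \<in> W - M" if "x \<in> W - M" "y \<in> M" for x y
    using that W by (metis Diff_iff add_diff_cancel_right' subsetD subspace_add subspace_diff)
  have card_U: "card (UNIV - {0 :: 'a}) = q - 1" by (simp add: card_Diff_singleton)
  have 1: "card {x \<in> ext M w. x \<notin> M \<and> P x} = (\<Sum>t\<in>UNIV - {0}. card {y \<in> M. P (t *s w + y)})"
    if w: "w \<in> W - M" for w
  proof -
    have "y + t *s w \<in> M \<longleftrightarrow> t = 0" if "y \<in> M" for y t
      using scale_notin[OF W(3), of w t] w that W(3)
      by (metis DiffD2 add_diff_cancel_left' add.right_neutral scale_zero_left subspace_diff)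
    then have eq: "{y \<in> M. y + t *s w \<notin> M \<and> P (y + t *s w)} = (if t = 0 then {} else {y \<in> M. P (t *s w + y)})" for t
      by (auto simp: add.commute)
    have "card {x \<in> ext M w. x \<notin> M \<and> P x} = (\<Sum>t\<in>UNIV. card (if t = 0 then {} else {y \<in> M. P (t *s w + y)}))"
      using card_ext_filter'[OF W(3) _ finM, of w "\<lambda>x. x \<notin> M \<and> P x"] w unfolding eq by simp
    also have "\<dots> = (\<Sum>t\<in>UNIV - {0}. card {y \<in> M. P (t *s w + y)})"
      by (rule sum.mono_neutral_cong_right) auto
    finally show ?thesis .
  qed
  have 2: "(\<Sum>w\<in>W - M. card {y \<in> M. P (t *s w + y)}) = card M * card {x \<in> W - M. P x}" if t: "t \<noteq> 0" for t
  proof -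
    have "(\<Sum>w\<in>W - M. card {y \<in> M. P (t *s w + y)}) = (\<Sum>w\<in>W - M. card {y \<in> M. P (w + y)})"
    proof (rule sum.reindex_bij_witness[where i = "\<lambda>x. inverse t *s x" and j = "\<lambda>x. t *s x"])
      fix x assume x: "x \<in> W - M"
      show "t *s x \<in> W - M" "inverse t *s x \<in> W - M"
        using x t W scale_notin[OF W(3), of x t] scale_notin[OF W(3), of x "inverse t"]
        by (auto simp: subspace_scale)
    qed (use t in auto)
    also have "\<dots> = card M * card {x \<in> W - M. P x}"
      by (rule translate_count[OF W(3) finM _ inv]) (use W in auto)
    finally show ?thesis .
  qed
  have "(\<Sum>w\<in>W - M. card {x \<in> ext M w. x \<notin> M \<and> P x}) =
    (\<Sum>w\<in>W - M. \<Sum>t\<in>UNIV - {0}. card {y \<in> M. P (t *s w + y)})"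
    by (rule sum.cong[OF refl 1])
  also have "\<dots> = (\<Sum>t\<in>UNIV - {0}. \<Sum>w\<in>W - M. card {y \<in> M. P (t *s w + y)})" by (rule sum.swap)
  also have "\<dots> = (\<Sum>t\<in>UNIV - {0 :: 'a}. card M * card {x \<in> W - M. P x})"
    by (rule sum.cong[OF refl]) (use 2 in auto)
  finally show ?thesis using card_U by simp
qed

text \<open>Counting along the pencil of subspaces through a maximal zero subspace \<open>M\<close>. The inequality is
  strict if \<open>M\<close> has codimension at least two: one member of the pencil is tangent at the origin, and there
  the residual factor has a zero that is not counted.\<close>

lemma pencil_bound_strict:
  assumes W: "subspace W" "finite W" "subspace M" "M \<subseteq> W"
    and f: "PF (Suc e) f" "\<And>x. x \<in> M \<Longrightarrow> f x = 0" "Suc e < q"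
    and max: "\<And>w. w \<in> W - M \<Longrightarrow> \<exists>y\<in>ext M w. f y \<noteq> 0"
    and codim: "q ^ 2 * card M \<le> card W"
  shows "(q - 1) * zeros f W + Suc e * card M < e * card W + q * card M"
proof -
  have finM: "finite M" using W finite_subset by blast
  have cM: "card M > 0" using W finM card_subspace_pos by blast
  define N where "N w = card {x \<in> ext M w. x \<notin> M \<and> f x = 0}" for w
  have residual: "\<exists>l g. lf l \<and> l w = 1 \<and> (\<forall>x\<in>M. l x = 0) \<and> PF e g \<and> (\<forall>x\<in>ext M w. f x = l x * g x) \<and>
      N w \<le> card {x \<in> ext M w. x \<notin> M \<and> g x = 0} \<and> zeros g (ext M w) \<le> e * card M"
    if w: "w \<in> W - M" for w
  proof -
    have wM: "w \<notin> M" using w by blast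
    obtain l where l: "lf l" "l w = 1" "\<forall>x\<in>M. l x = 0" by (rule lf_exists[OF W(3) wM])
    have l0: "l x = 0 \<longleftrightarrow> x \<in> M" if x: "x \<in> ext M w" for x
    proof -
      obtain y t where yt: "y \<in> M" "x = y + t *s w" using x by (rule extE)
      then have "l x = t" using l by (simp add: lf_simps)
      moreover have "t = 0 \<Longrightarrow> x \<in> M" using yt by simp
      ultimately show ?thesis using l(3) by auto
    qed
    have z: "f x = 0" if "x \<in> ext M w" "l x = 0" for x using that l0 f(2) by blast
    obtain e' g where g: "Suc e = Suc e'" "PF e' g" "\<forall>x\<in>ext M w. f x = (l x - 0) * g x"
      by (rule factor_slice[OF subspace_ext[OF W(3)] mem_ext[OF W(3)] l(1,2) f(1) z max[OF w]])
    have "{x \<in> ext M w. x \<notin> M \<and> f x = 0} \<subseteq> {x \<in> ext M w. x \<notin> M \<and> g x = 0}"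
      using g(3) l0 by auto
    then have "N w \<le> card {x \<in> ext M w. x \<notin> M \<and> g x = 0}"
      unfolding N_def by (intro card_mono) (auto simp: finite_ext finM)
    moreover have "zeros g (ext M w) \<le> e * card M"
    proof -
      have "\<exists>x\<in>ext M w. g x \<noteq> 0" using max[OF w] g(3) by auto
      then have "q * zeros g (ext M w) \<le> e' * card (ext M w)"
        by (rule card_zeros_le[OF subspace_ext[OF W(3)] finite_ext[OF finM] g(2)])
      also have "\<dots> = q * (e * card M)" using g(1) card_ext[OF W(3) wM] by simp
      finally show ?thesis using q_pos by simp
    qed
    ultimately show ?thesis using l g by auto
  qed
  have Ne: "N w \<le> e * card M" if "w \<in> W - M" for w
  proof -
    obtain g :: "'b \<Rightarrow> 'a" where "N w \<le> card {x \<in> ext M w. x \<notin> M \<and> g x = 0}"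
      "zeros g (ext M w) \<le> e * card M"
      using residual[OF \<open>w \<in> W - M\<close>] by blast
    moreover have "card {x \<in> ext M w. x \<notin> M \<and> g x = 0} \<le> zeros g (ext M w)"
      by (intro card_mono) (auto simp: finite_ext finM)
    ultimately show ?thesis by linarith
  qed
  obtain D p where D: "tangent f (Suc e) 0 D p" using PF_tangent[OF f(1)] by blast
  have lD: "lf D" using D unfolding tangent_def by blast
  \<comment> \<open>Codimension at least two provides two vectors independent modulo
    \<open>M\<close>; a combination of them lies outside \<open>M\<close> and is killed by the
    differential at the origin.\<close>
  obtain w where w: "w \<in> W - M" "D w = 0"
  proof -
    have "card M < card W"
    proof -
      have "1 * card M < q ^ 2 * card M" using cM q_ge_2
        by (intro mult_strict_right_mono one_less_power) auto
      then show ?thesis using codim by linarith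
    qed
    then obtain a where a: "a \<in> W" "a \<notin> M" using W(4) by (metis less_irrefl subsetI subset_antisym)
    have "card (ext M a) < card W"
    proof -
      have "q * card M < q ^ 2 * card M" using cM q_ge_2 by (simp add: power2_eq_square)
      then show ?thesis using codim card_ext[OF W(3) a(2)] by linarith
    qed
    moreover have "ext M a \<subseteq> W" using W a by (intro ext_subset) auto
    ultimately obtain b where b: "b \<in> W" "b \<notin> ext M a" by (metis less_irrefl subsetI subset_antisym)
    show ?thesis
    proof (cases "D a = 0")
      case True
      then show ?thesis using that a by blast
    next
      case False
      let ?w = "b - (D b / D a) *s a"
      have "?w \<in> W" using a b W by (simp add: subspace_diff subspace_scale)
      moreover have "?w \<notin> M"
      proof
        assume "?w \<in> M"
        then have "?w + (D b / D a) *s a \<in> ext M a" by (rule extI)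
        then show False using b by simp
      qed
      moreover have "D ?w = 0" using lD False by (simp add: lf_simps)
      ultimately show ?thesis using that by blast
    qed
  qed
  have Nw: "N w < e * card M"
  proof -
    obtain l g where lg: "lf l" "l w = 1" "\<forall>x\<in>M. l x = 0" "PF e g" "\<forall>x\<in>ext M w. f x = l x * g x"
      "N w \<le> card {x \<in> ext M w. x \<notin> M \<and> g x = 0}" "zeros g (ext M w) \<le> e * card M"
      using residual[OF w(1)] by blast
    obtain r where r: "expansion g e w r" using PF_expansion[OF lg(4)] by blast
    \<comment> \<open>Along \<open>w\<close> the identity \<open>f = l * g\<close> reads
      \<open>f (t *s w) = t * g (t *s w)\<close>. As \<open>Suc e < q\<close>, it holds for the
      formal polynomials, and the linear coefficients give \<open>g 0 = D w = 0\<close>. This zero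
      of \<open>g\<close> lies in \<open>M\<close> and is therefore not among those counted by
      \<open>N w\<close>.\<close>
    have "p w - pCons 0 (r 0) = 0"
    proof (rule poly_eq_0_if_values)
      have "degree (p w) \<le> Suc e" using D unfolding tangent_def by blast
      moreover have "degree (pCons 0 (r 0)) \<le> Suc e" using r unfolding expansion_def
        by (metis degree_pCons_le le_trans Suc_le_mono)
      ultimately have "degree (p w - pCons 0 (r 0)) \<le> Suc e" by (rule degree_diff_le)
      then show "degree (p w - pCons 0 (r 0)) < CARD('a)" using f(3) by simp
      fix t
      have "f (0 + t *s w) = t * g (0 + t *s w)"
        using lg scale_mem_ext[OF W(3)] by (simp add: lf_simps)
      moreover have "f (0 + t *s w) = poly (p w) t" using D unfolding tangent_def by blast
      moreover have "g (0 + t *s w) = poly (r 0) t" using r unfolding expansion_def by blast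
      ultimately show "poly (p w - pCons 0 (r 0)) t = 0" by simp
    qed
    then have "coeff (p w) 1 = coeff (r 0) 0" by simp
    moreover have "coeff (p w) 1 = 0" using D w(2) unfolding tangent_def by simp
    moreover have "poly (r 0) 0 = g (0 + 0 *s w)" using r unfolding expansion_def by metis
    ultimately have "g 0 = 0" by (simp add: poly_0_coeff_0)
    then have "card {x \<in> ext M w. x \<notin> M \<and> g x = 0} < zeros g (ext M w)"
      using subspace_0[OF W(3)] subspace_0[OF subspace_ext[OF W(3)]]
      by (intro psubset_card_mono) (auto simp: finite_ext finM)
    then show ?thesis using lg by linarith
  qed
  have finWM: "finite (W - M)" using W by simp
  have "sum N (W - M) < (\<Sum>w\<in>W - M. e * card M)"
    by (rule sum_strict_mono_ex1[OF finWM]) (use Ne Nw w in auto)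
  moreover have "sum N (W - M) = (q - 1) * card M * zeros f (W - M)"
    unfolding N_def by (rule sum_scaled_translates[OF W])
  ultimately have "card M * ((q - 1) * zeros f (W - M)) < card M * (e * card (W - M))"
    by (simp add: mult_ac)
  then have 1: "(q - 1) * zeros f (W - M) < e * card (W - M)" by simp
  have "{x \<in> W. f x = 0} = {x \<in> W - M. f x = 0} \<union> M" using f(2) W(4) by auto
  then have "zeros f W = zeros f (W - M) + card M"
    using finWM finM by (subst \<open>{x \<in> W. f x = 0} = _\<close>, intro card_Un_disjoint) auto
  then have 2: "(q - 1) * zeros f W = (q - 1) * zeros f (W - M) + (q - 1) * card M"
    by (simp only: add_mult_distrib2)
  have "card W = card (W - M) + card M" using W finM by (metis card_Diff_subset card_mono le_add_diff_inverse2)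
  then have 3: "e * card W = e * card (W - M) + e * card M" by (simp only: add_mult_distrib2)
  have "(q - 1) * card M + card M = q * card M" using q_pos by (metis Suc_diff_1 add.commute mult_Suc)
  then show ?thesis using 1 2 3 by simp
qed

lemma card_zeros_translate:
  assumes "subspace W" "a \<in> W"
  shows "card {x \<in> W. P (a + x)} = card {x \<in> W. P x}"
proof (rule bij_betw_same_card[of "\<lambda>x. a + x"])
  show "bij_betw (\<lambda>x. a + x) {x \<in> W. P (a + x)} {x \<in> W. P x}"
    by (rule bij_betw_byWitness[where f' = "\<lambda>x. x - a"])
      (use assms in \<open>auto simp: subspace_add subspace_diff\<close>)
qed

text \<open>Hypothesis \<open>big\<close> contradicts the strict pencil bound after
  \<open>card M\<close> has been replaced by its largest possible value \<open>card W / q^2\<close>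
  in codimension at least two. So a maximal affine zero subspace has codimension one. All terms are
  arranged to avoid subtraction of naturals.\<close>

lemma zero_set_contains_hyperplane:
  assumes W: "subspace W" "finite W" and f: "PF e f" "\<exists>x\<in>W. f x \<noteq> 0" and e: "1 \<le> e" "e < q"
    and big: "e * q ^ 2 * card W + q * card W \<le> (q - 1) * q ^ 2 * zeros f W + e * card W + q ^ 2 * card W"
  obtains l u t where "lf l" "u \<in> W" "l u = 1" "\<forall>x\<in>W. l x = t \<longrightarrow> f x = 0"
proof -
  define v where "v = zeros f W"
  obtain e' where e': "e = Suc e'" using e(1) by (cases e) auto
  have cW: "card W > 0" using W card_subspace_pos by blast
  have "v \<noteq> 0"
  proof
    assume "v = 0"
    then have "e' * q ^ 2 * card W + q * card W \<le> e * card W" using big e' unfolding v_def[symmetric] by (simp add: add_mult_distrib)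
    moreover have "e * card W < q * card W" using e cW by simp
    ultimately show False by linarith
  qed
  then obtain a where a: "a \<in> W" "f a = 0" unfolding v_def by (metis (mono_tags, lifting) Collect_empty_eq card.empty)
  \<comment> \<open>Translation by a zero \<open>a\<close> turns affine zero subspaces through
    \<open>a\<close> into linear ones, to which the pencil bound applies.\<close>
  obtain M where M: "subspace M" "M \<subseteq> W" "\<forall>y\<in>M. f (a + y) = 0"
    "\<And>T. subspace T \<Longrightarrow> T \<subseteq> W \<Longrightarrow> \<forall>y\<in>T. f (a + y) = 0 \<Longrightarrow> card T \<le> card M"
    using exists_maximal_subspace[OF W(2,1), of "\<lambda>M. \<forall>y\<in>M. f (a + y) = 0"] a(2) by auto
  have finM: "finite M" using M W finite_subset by blast
  have cM: "card M > 0" using M finM card_subspace_pos by blast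
  have max: "\<exists>y\<in>ext M w. f (a + y) \<noteq> 0" if w: "w \<in> W - M" for w
  proof (rule ccontr)
    assume "\<not> ?thesis"
    then have "card (ext M w) \<le> card M" using w W M by (intro M(4) subspace_ext ext_subset) auto
    moreover have "card (ext M w) = q * card M" using card_ext M w by blast
    moreover have "1 * card M < q * card M" using cM q_ge_2 by (intro mult_strict_right_mono) auto
    ultimately show False by simp
  qed
  have MW: "M \<noteq> W"
  proof
    assume "M = W"
    moreover obtain x where x: "x \<in> W" "f x \<noteq> 0" using f by blast
    moreover have "x - a \<in> W" using x a W subspace_diff by blast
    ultimately show False using M(3) by (metis add.commute diff_add_cancel)
  qed
  consider "card W = q * card M" | "q ^ 2 * card M \<le> card W"
    using card_subspace_cases[OF M(1) W M(2) MW] by blast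
  then show ?thesis
  proof cases
    case 1
    obtain w where w: "w \<in> W" "w \<notin> M" using MW M by blast
    obtain l where l: "lf l" "l w = 1" "\<forall>x\<in>M. l x = 0" by (rule lf_exists[OF M(1) w(2)])
    have ext: "ext M w = W" by (rule ext_eq_if_card[OF M(1) W M(2) w 1])
    have "f x = 0" if x: "x \<in> W" "l x = l a" for x
    proof -
      have "x - a \<in> ext M w" using x a W ext subspace_diff by blast
      then obtain y t where yt: "y \<in> M" "x - a = y + t *s w" by (rule extE)
      have "l (x - a) = t" unfolding yt(2) using l yt(1) by (simp add: lf_simps)
      then have "t = 0" using x l by (simp add: lf_simps)
      then have "x = a + y" using yt by (simp add: algebra_simps)
      then show ?thesis using M(3) yt by blast
    qed
    then show ?thesis using that[of l w "l a"] l w by blast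
  next
    case 2
    have g: "PF (Suc e') (\<lambda>x. f (a + x))" using PF_translate[OF f(1)] e' by blast
    have "(q - 1) * card {x \<in> W. f (a + x) = 0} + Suc e' * card M < e' * card W + q * card M"
      by (rule pencil_bound_strict[OF W M(1,2) g _ _ max 2]) (use M(3) e e' in auto)
    then have "(q - 1) * v + Suc e' * card M < e' * card W + q * card M"
      using card_zeros_translate[OF W(1) a(1), of "\<lambda>x. f x = 0"] unfolding v_def by simp
    then have "q ^ 2 * ((q - 1) * v + Suc e' * card M) < q ^ 2 * (e' * card W + q * card M)"
      using q_pos by simp
    then have "q ^ 2 * ((q - 1) * v) + e * (q ^ 2 * card M) < q ^ 2 * (e' * card W) + q * (q ^ 2 * card M)"
      unfolding e' by (simp only: add_mult_distrib2 mult_ac)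
    moreover obtain k where k: "q = e + k" using e(2) less_imp_add_positive by blast
    moreover have "q * (q ^ 2 * card M) = e * (q ^ 2 * card M) + k * (q ^ 2 * card M)"
      by (subst k) (rule add_mult_distrib)
    moreover have "k * (q ^ 2 * card M) \<le> k * card W" using 2 by (rule mult_le_mono2)
    moreover have "q ^ 2 * (e * card W) = q ^ 2 * (e' * card W) + q ^ 2 * card W"
      unfolding e' by (simp add: add_mult_distrib2)
    ultimately have "q ^ 2 * ((q - 1) * v) + q ^ 2 * card W < q ^ 2 * (e * card W) + k * card W"
      by linarith
    moreover have "q * card W = e * card W + k * card W" using k by (simp add: algebra_simps)
    moreover have "q ^ 2 * (e * card W) + q * card W \<le> q ^ 2 * ((q - 1) * v) + e * card W + q ^ 2 * card W"
      using big unfolding v_def[symmetric] by (simp only: mult_ac)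
    ultimately show ?thesis by linarith
  qed
qed

text \<open>The maximal count satisfies \<open>big\<close>, so one slice lies in the zero set; the
  shortfall in \<open>slice_bound\<close> must then vanish, which leaves \<open>e\<close> parallel
  hyperplanes. These are the minimum weight words of affine Reed-Muller codes.\<close>

lemma full_zero_set:
  assumes W: "subspace W" "finite W" and f: "PF e f" and e: "1 \<le> e" "e < q"
    and full: "q * zeros f W = e * card W"
  obtains c l u T where "c \<noteq> 0" "lf l" "u \<in> W" "l u = 1" "card T = e"
    "\<forall>x\<in>W. f x = c * (\<Prod>t\<in>T. l x - t)"
proof -
  define v where "v = zeros f W"
  have cW: "card W > 0" using W card_subspace_pos by blast
  have ex: "\<exists>x\<in>W. f x \<noteq> 0"
  proof (rule ccontr)
    assume "\<not> ?thesis"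
    then have "{x \<in> W. f x = 0} = W" by auto
    then show False using full e cW by simp
  qed
  obtain k where k: "q = e + k" using e(2) less_imp_add_positive by blast
  obtain p where p: "q = Suc p" using q_pos by (metis Suc_pred')
  have "(q - 1) * q ^ 2 * v = (q - 1) * q * (e * card W)"
    using full unfolding v_def[symmetric] by (metis mult.assoc power2_eq_square)
  moreover have "e * q ^ 2 * card W + q * card W \<le> (q - 1) * q * (e * card W) + e * card W + q ^ 2 * card W"
  proof -
    have "e * q ^ 2 + q \<le> (q - 1) * q * e + e + q ^ 2"
    proof -
      have "e * q + q \<le> e + q * q"
      proof -
        have "(q - 1) * e \<le> (q - 1) * q" using e by simp
        then show ?thesis using p by (simp add: algebra_simps)
      qed
      then show ?thesis using p by (simp add: algebra_simps power2_eq_square)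
    qed
    from mult_le_mono1[OF this, of "card W"] show ?thesis by (simp only: add_mult_distrib mult.assoc)
  qed
  ultimately have big: "e * q ^ 2 * card W + q * card W \<le> (q - 1) * q ^ 2 * zeros f W + e * card W + q ^ 2 * card W"
    unfolding v_def by linarith
  obtain l u t where l: "lf l" "u \<in> W" "l u = 1" "\<forall>x\<in>W. l x = t \<longrightarrow> f x = 0"
    by (rule zero_set_contains_hyperplane[OF W f ex e big])
  define T where "T = {t. \<forall>x\<in>W. l x = t \<longrightarrow> f x = 0}"
  define M where "M = {x \<in> W. l x = 0}"
  have t: "t \<in> T" using l unfolding T_def by auto
  have sb: "card T \<le> e" "q * v + card T * (e - card T) * card M \<le> e * q * card M"
    "card T = e \<Longrightarrow> \<exists>c. c \<noteq> 0 \<and> (\<forall>x\<in>W. f x = c * (\<Prod>t\<in>T. l x - t))"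
    using slice_bound[OF W l(2,1,3) f ex] unfolding T_def M_def v_def by blast+
  have cWM: "card W = q * card M" unfolding M_def using card_kernel[OF l(1) W(1) l(2)] l(3) by simp
  have "card T * (e - card T) * card M = 0"
    using sb(2) full cWM unfolding v_def by simp
  moreover have "card M > 0" using cW cWM by simp
  moreover have "card T > 0" using t by (auto simp: card_gt_0_iff)
  ultimately have "card T = e" using sb(1) by auto
  then obtain c where "c \<noteq> 0" "\<forall>x\<in>W. f x = c * (\<Prod>t\<in>T. l x - t)" using sb(3) by blast
  then show ?thesis using that[of c l u T] l \<open>card T = e\<close> by blast
qed

text \<open>The hypothesis is inherited by the cofactor of an affine factor, with room to spare.\<close>

lemma splits_into_affine_factors:
  assumes W: "subspace W" "finite W"
  shows "PF e f \<Longrightarrow> \<exists>x\<in>W. f x \<noteq> 0 \<Longrightarrow> e < q \<Longrightarrow>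
    e * q ^ 2 * card W + q * card W \<le> (q - 1) * q ^ 2 * zeros f W + e * card W + q ^ 2 * card W \<Longrightarrow>
    \<exists>c A. length A = e \<and> (\<forall>(l, b)\<in>set A. lf l) \<and> (\<forall>x\<in>W. f x = c * (\<Prod>(l, b)\<leftarrow>A. l x + b))"
proof (induction e arbitrary: f)
  case 0
  then obtain c where "\<forall>x. f x = c" using PF_0_const by blast
  then show ?case by (intro exI[of _ c] exI[of _ "[]"]) auto
next
  case (Suc e)
  obtain l u t where l: "lf l" "u \<in> W" "l u = 1" "\<forall>x\<in>W. l x = t \<longrightarrow> f x = 0"
    by (rule zero_set_contains_hyperplane[OF W Suc.prems(1,2) _ Suc.prems(3,4)]) auto
  obtain e' g where g: "Suc e = Suc e'" "PF e' g" "\<forall>x\<in>W. f x = (l x - t) * g x"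
    by (rule factor_slice[OF W(1) l(2,1,3) Suc.prems(1) _ Suc.prems(2), of t]) (use l(4) in auto)
  have gex: "\<exists>x\<in>W. g x \<noteq> 0" using Suc.prems(2) g(3) by auto
  define v where "v = zeros f W"
  define v' where "v' = zeros g W"
  have "q * v \<le> card W + q * v'"
  proof -
    have "{x \<in> W. f x = 0} \<subseteq> {x \<in> W. l x - t = 0} \<union> {x \<in> W. g x = 0}" using g(3) by auto
    then have "v \<le> card ({x \<in> W. l x - t = 0} \<union> {x \<in> W. g x = 0})"
      unfolding v_def using W by (intro card_mono) auto
    then have vle: "v \<le> card {x \<in> W. l x - t = 0} + v'"
      unfolding v'_def using card_Un_le le_trans by blast
    have "q * card {x \<in> W. l x - t = 0} \<le> 1 * card W"
    proof (rule card_zeros_le[OF W])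
      show "PF 1 (\<lambda>x. l x - t)" using PF_diff[OF PF_lf[OF l(1)] PF.const] by simp
      have "l ((t + 1) *s u) - t \<noteq> 0" using l by (simp add: lf_simps)
      then show "\<exists>x\<in>W. l x - t \<noteq> 0" using l(2) W(1) subspace_scale by blast
    qed
    then show ?thesis using mult_le_mono2[OF vle, of q] unfolding add_mult_distrib2 by linarith
  qed
  from mult_le_mono2[OF this, of "(q - 1) * q"]
  have 1: "(q - 1) * q ^ 2 * v \<le> (q - 1) * q * card W + (q - 1) * q ^ 2 * v'"
    by (simp only: power2_eq_square add_mult_distrib2 mult_ac)
  obtain p where p: "q = Suc p" using q_pos by (metis Suc_pred')
  have "e * q ^ 2 * card W + q * card W \<le> (q - 1) * q ^ 2 * v' + e * card W + q ^ 2 * card W"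
  proof -
    have "Suc e * q ^ 2 * card W + q * card W \<le> (q - 1) * q * card W + (q - 1) * q ^ 2 * v' + Suc e * card W + q ^ 2 * card W"
      using Suc.prems(4) 1 unfolding v_def[symmetric] by linarith
    moreover have "(q - 1) * q * card W + q * card W = q ^ 2 * card W"
      using p by (simp add: power2_eq_square algebra_simps)
    moreover have "card W \<le> q * card W" using q_pos by simp
    moreover have "Suc e * q ^ 2 * card W = e * q ^ 2 * card W + q ^ 2 * card W" "Suc e * card W = e * card W + card W"
      by (simp_all add: algebra_simps)
    ultimately show ?thesis by linarith
  qed
  then obtain c A where A: "length A = e" "\<forall>(l, b)\<in>set A. lf l" "\<forall>x\<in>W. g x = c * (\<Prod>(l, b)\<leftarrow>A. l x + b)"
    using Suc.IH[of g] g gex Suc.prems(3) unfolding v'_def by auto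
  have "f x = c * (\<Prod>(l, b)\<leftarrow>(l, - t) # A. l x + b)" if "x \<in> W" for x
    using g(3) A(3) that by simp
  then show ?case using A l(1) by (intro exI[of _ c] exI[of _ "(l, - t) # A"]) auto
qed


definition line :: "'b \<Rightarrow> 'b set" where "line R = ext {0} R"

lemma line_eq: "line R = range (\<lambda>c. c *s R)"
  unfolding line_def ext_def by force

lemma subspace_line: "subspace (line R)"
  unfolding line_def by (rule subspace_ext[OF subspace_single_0])

lemma finite_line: "finite (line R)"
  unfolding line_def by (rule finite_ext) simp

lemma card_line: "R \<noteq> 0 \<Longrightarrow> card (line R) = q"
  unfolding line_def using card_ext[OF subspace_single_0, of R] by simp

lemma line_subset: "subspace N \<Longrightarrow> R \<in> N \<Longrightarrow> line R \<subseteq> N"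
  unfolding line_eq by (auto simp: subspace_scale)

lemma card_line_filter:
  assumes "R \<noteq> 0" shows "card {y \<in> line R. P y} = card {c. P (c *s R)}"
proof -
  have "{y \<in> line R. P y} = (\<lambda>c. c *s R) ` {c. P (c *s R)}" unfolding line_eq by auto
  moreover have "inj (\<lambda>c. c *s R)" using assms by (auto simp: inj_on_def)
  ultimately show ?thesis by (metis card_image inj_on_subset subset_UNIV)
qed

lemma diff_subspace_add:
  assumes "subspace W" "subspace M" "M \<subseteq> W" "x \<in> W - M" "y \<in> M"
  shows "x + y \<in> W - M"
  using assms by (metis Diff_iff add_diff_cancel_right' subsetD subspace_add subspace_diff)

lemma sum_along_line:
  assumes "subspace N" "finite N" "R \<in> N" "R \<noteq> 0"
  shows "(\<Sum>x\<in>N - line R. card {c. P (x + c *s R)}) = q * card {x \<in> N - line R. P x}"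
proof -
  have "(\<Sum>x\<in>N - line R. card {c. P (x + c *s R)}) = (\<Sum>x\<in>N - line R. card {y \<in> line R. P (x + y)})"
    by (rule sum.cong[OF refl]) (use card_line_filter[OF assms(4)] in simp)
  also have "\<dots> = card (line R) * card {x \<in> N - line R. P x}"
    using assms diff_subspace_add[OF assms(1) subspace_line line_subset]
    by (intro translate_count subspace_line finite_line) auto
  finally show ?thesis using card_line[OF assms(4)] by simp
qed

lemma card_diff_line:
  assumes "subspace N" "finite N" "R \<in> N" "R \<noteq> 0" shows "card (N - line R) + q = card N"
  using assms line_subset card_line finite_line by (metis card_Diff_subset card_mono le_add_diff_inverse2)

text \<open>Double counting of the pairs of a zero and a non-zero whose joining line has a single zero.\<close>

lemma plane_section_count:
  assumes N: "subspace N" "finite N" "card N = q ^ 3" and f: "HP (Suc e) f" and e: "1 \<le> e" "e < q"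
    and z: "zeros f N = q + e * (q ^ 2 - q)"
    and sec: "\<And>R x. R \<in> N \<Longrightarrow> R \<noteq> 0 \<Longrightarrow> f R = 0 \<Longrightarrow> x \<in> N - line R \<Longrightarrow>
      card {s. f (x + s *s R) = 0} = 0 \<or> card {s. f (x + s *s R) = 0} = e"
  shows "e ^ 2 \<le> q"
proof -
  define Z where "Z = {R \<in> N. R \<noteq> 0 \<and> f R = 0}"
  \<comment> \<open>Projectively \<open>N\<close> is a plane with \<open>e * q + 1\<close> zeros,
    and \<open>A R\<close> consists of the points other than \<open>R\<close> on the lines that meet
    the zero set only in \<open>R\<close>. Everything is counted in vectors, hence the recurring
    factor \<open>q - 1\<close>.\<close>
  define A where "A R = {x \<in> N - line R. \<forall>s. f (x + s *s R) \<noteq> 0}" for R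
  have f0: "f 0 = 0" by (rule HP_at_zero[OF f])
  have hom: "f (c *s x) = c ^ Suc e * f x" for c x by (rule HP_homogeneous[OF f])
  have finZ: "finite Z" using N unfolding Z_def by simp
  have "{x \<in> N. f x = 0} = insert 0 Z" using f0 subspace_0[OF N(1)] unfolding Z_def by auto
  then have cZ: "Suc (card Z) = q + e * (q ^ 2 - q)"
    using z finZ unfolding Z_def by simp
  \<comment> \<open>Each line through \<open>R\<close> has \<open>0\<close> or \<open>e\<close>
    further zeros. Comparing with the total count leaves exactly one line with \<open>0\<close>: a
    unique tangent at \<open>R\<close>.\<close>
  have cA: "card (A R) = q ^ 2 - q" if R: "R \<in> Z" for R
  proof -
    have R': "R \<in> N" "R \<noteq> 0" "f R = 0" using R unfolding Z_def by auto
    have lz: "f x = 0" if "x \<in> line R" for x using that R'(3) hom unfolding line_eq by auto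
    have eq: "{x \<in> N. f x = 0} = {x \<in> N - line R. f x = 0} \<union> line R"
      using lz line_subset[OF N(1) R'(1)] by auto
    have "zeros f N = zeros f (N - line R) + q"
      unfolding eq using N finite_line card_line[OF R'(2)] by (subst card_Un_disjoint) auto
    then have 1: "zeros f (N - line R) = e * (q ^ 2 - q)" using z by simp
    define a where "a x = card {s. f (x + s *s R) = 0}" for x
    have "a x + (if x \<in> A R then e else 0) = e" if x: "x \<in> N - line R" for x
    proof -
      have "x \<in> A R \<longleftrightarrow> a x = 0" using x unfolding A_def a_def by auto
      then show ?thesis using sec[OF R' x] e unfolding a_def[symmetric] by auto
    qed
    then have "(\<Sum>x\<in>N - line R. a x + (if x \<in> A R then e else 0)) = (\<Sum>x\<in>N - line R. e)"
      by (rule sum.cong[OF refl])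
    then have "sum a (N - line R) + e * card (A R) = e * card (N - line R)"
      using N by (simp add: sum.distrib sum.If_cases A_def Int_def mult.commute)
    moreover have "sum a (N - line R) = q * (e * (q ^ 2 - q))"
      unfolding a_def using sum_along_line[OF N(1,2) R'(1,2), of "\<lambda>x. f x = 0"] 1 by simp
    ultimately have "e * (q * (q ^ 2 - q) + card (A R)) = e * card (N - line R)"
      by (simp add: algebra_simps)
    then have "q * (q ^ 2 - q) + card (A R) = card (N - line R)" using e by simp
    then have "q * (q ^ 2 - q) + card (A R) + q = q ^ 3"
      using card_diff_line[OF N(1,2) R'(1,2)] N(3) by simp
    moreover have "q * (q ^ 2 - q) + (q ^ 2 - q) + q = q ^ 3"
    proof -
      have "q \<le> q ^ 2" "q * q \<le> q * q ^ 2" using q_pos by (auto simp: power2_eq_square)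
      then show ?thesis by (simp add: power2_eq_square power3_eq_cube diff_mult_distrib2)
    qed
    ultimately show ?thesis by linarith
  qed
  define B where "B = {Q \<in> N. f Q \<noteq> 0}"
  define X where "X Q = card {R \<in> Z. Q \<in> A R}" for Q
  have finB: "finite B" using N unfolding B_def by simp
  have AB: "A R \<subseteq> B" for R
  proof
    fix x assume x: "x \<in> A R"
    then have "f (x + 0 *s R) \<noteq> 0" unfolding A_def by blast
    then show "x \<in> B" using x unfolding A_def B_def by simp
  qed
  \<comment> \<open>The lines through a non-zero \<open>Q\<close> partition the zeros. None has more
    than \<open>e + 1\<close> zeros, and every tangent through \<open>Q\<close> has \<open>e\<close>
    fewer than that.\<close>
  have X: "q * card Z + e * (q * X Q) \<le> Suc e * card (N - line Q)" if Q: "Q \<in> B" for Q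
  proof -
    have Q': "Q \<in> N" "Q \<noteq> 0" "f Q \<noteq> 0" using Q f0 unfolding B_def by auto
    define b where "b y = card {c. f (y + c *s Q) = 0}" for y
    have binv: "b (y + c *s Q) = b y" for y c
    proof -
      have "bij_betw (\<lambda>x. x + c) {x. f (y + c *s Q + x *s Q) = 0} {x. f (y + x *s Q) = 0}"
        by (rule bij_betw_byWitness[where f' = "\<lambda>x. x - c"])
          (auto simp: scale_left_distrib scale_left_diff_distrib algebra_simps)
      then show ?thesis unfolding b_def by (rule bij_betw_same_card)
    qed
    have flip: "f (R + c *s Q) = c ^ Suc e * f (Q + inverse c *s R)" if "c \<noteq> 0" for R c
    proof -
      have "R + c *s Q = c *s (Q + inverse c *s R)" using that by (simp add: scale_right_distrib)
      then show ?thesis using hom by simp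
    qed
    have ZQ: "{x \<in> N - line Q. f x = 0} = Z"
    proof -
      have "x \<notin> line Q" if "x \<in> Z" for x
        using that Q'(3) hom unfolding Z_def line_eq by auto
      moreover have "0 \<in> line Q" using subspace_0[OF subspace_line] .
      ultimately show ?thesis unfolding Z_def by auto
    qed
    have sum_b: "sum b (N - line Q) = q * card Z"
      unfolding b_def using sum_along_line[OF N(1,2) Q'(1,2), of "\<lambda>x. f x = 0"] ZQ by simp
    have bR: "b R \<le> Suc e" if R: "R \<in> Z" for R
    proof -
      have R': "R \<in> N" "R \<noteq> 0" "f R = 0" using R unfolding Z_def by auto
      have "Q \<notin> line R" using R'(3) Q'(3) hom unfolding line_eq by auto
      then have ce: "card {s. f (Q + s *s R) = 0} \<le> e" using sec[OF R', of Q] Q' by auto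
      have "{c. f (R + c *s Q) = 0} \<subseteq> insert 0 (inverse ` {s. f (Q + s *s R) = 0})"
      proof
        fix c assume c: "c \<in> {c. f (R + c *s Q) = 0}"
        show "c \<in> insert 0 (inverse ` {s. f (Q + s *s R) = 0})"
        proof (cases "c = 0")
          case False
          then have "f (Q + inverse c *s R) = 0" using c flip[OF False, of R] by simp
          then have "inverse (inverse c) \<in> inverse ` {s. f (Q + s *s R) = 0}" by blast
          then show ?thesis by simp
        qed simp
      qed
      then have "b R \<le> card (insert 0 (inverse ` {s. f (Q + s *s R) = 0}))"
        unfolding b_def by (intro card_mono) auto
      also have "\<dots> \<le> Suc (card (inverse ` {s. f (Q + s *s R) = 0}))" by (simp add: card_insert_if)
      also have "\<dots> \<le> Suc (card {s. f (Q + s *s R) = 0})" by (simp add: card_image_le)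
      finally show ?thesis using ce by simp
    qed
    have be: "b y \<le> Suc e" if y: "y \<in> N - line Q" for y
    proof (cases "b y = 0")
      case False
      then obtain c where c: "f (y + c *s Q) = 0"
        unfolding b_def by (metis (mono_tags, lifting) Collect_empty_eq card.empty)
      have "c *s Q \<in> line Q" unfolding line_eq by blast
      then have "y + c *s Q \<in> N - line Q"
        by (rule diff_subspace_add[OF N(1) subspace_line line_subset[OF N(1) Q'(1)] y])
      then have "y + c *s Q \<in> Z" using c ZQ by auto
      then show ?thesis using bR binv by metis
    qed simp
    define Y where "Y = {y \<in> N - line Q. b y = 1}"
    have qX: "q * X Q \<le> card Y"
    proof -
      have "X Q \<le> card {x \<in> N - line Q. f x = 0 \<and> b x = 1}"
      proof -
        have "{R \<in> Z. Q \<in> A R} \<subseteq> {x \<in> N - line Q. f x = 0 \<and> b x = 1}"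
        proof
          fix R assume R: "R \<in> {R \<in> Z. Q \<in> A R}"
          then have "f (R + c *s Q) = 0 \<longleftrightarrow> c = 0" for c
            using flip[of c R] Q'(3) unfolding A_def Z_def by (cases "c = 0") auto
          then have "b R = 1" unfolding b_def by simp
          moreover have "R \<in> {x \<in> N - line Q. f x = 0}" using R ZQ by blast
          ultimately show "R \<in> {x \<in> N - line Q. f x = 0 \<and> b x = 1}" by blast
        qed
        then show ?thesis unfolding X_def using N by (intro card_mono) auto
      qed
      then have "q * X Q \<le> q * card {x \<in> N - line Q. f x = 0 \<and> b x = 1}" by simp
      also have "\<dots> = (\<Sum>y\<in>N - line Q. card {c. f (y + c *s Q) = 0 \<and> b (y + c *s Q) = 1})"
        using sum_along_line[OF N(1,2) Q'(1,2), of "\<lambda>x. f x = 0 \<and> b x = 1"] by simp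
      also have "\<dots> = (\<Sum>y\<in>N - line Q. if b y = 1 then 1 else 0)"
        by (rule sum.cong[OF refl]) (simp add: binv, simp add: b_def)
      also have "\<dots> = card Y" unfolding Y_def using N by (simp add: sum.If_cases Int_def)
      finally show ?thesis .
    qed
    have "sum b (N - line Q) + (Suc e - 1) * card Y \<le> Suc e * card (N - line Q)"
      unfolding Y_def using N be by (intro sum_deficit) auto
    then have "q * card Z + e * card Y \<le> Suc e * card (N - line Q)" using sum_b by simp
    then show ?thesis using mult_le_mono2[OF qX, of e] by linarith
  qed
  have sumX: "sum X B = card Z * (q ^ 2 - q)"
  proof -
    have "sum X B = (\<Sum>Q\<in>B. \<Sum>R\<in>Z. if Q \<in> A R then 1 else 0)"
      unfolding X_def using finZ by (simp add: sum.If_cases Int_def)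
    also have "\<dots> = (\<Sum>R\<in>Z. \<Sum>Q\<in>B. if Q \<in> A R then 1 else 0)" by (rule sum.swap)
    also have "\<dots> = (\<Sum>R\<in>Z. card (A R))"
    proof (rule sum.cong[OF refl])
      fix R
      have "{Q \<in> B. Q \<in> A R} = A R" using AB by auto
      then show "(\<Sum>Q\<in>B. if Q \<in> A R then 1 else 0) = card (A R)"
        using finB by (simp add: sum.If_cases Int_def)
    qed
    also have "\<dots> = card Z * (q ^ 2 - q)" using cA by simp
    finally show ?thesis .
  qed
  have cB: "card B + (q + e * (q ^ 2 - q)) = q ^ 3"
    using card_zeros_nonzeros[OF N(2), of f] z N(3) unfolding B_def by simp
  obtain p where p: "q = Suc p" using q_pos by (metis Suc_pred')
  have qq: "q ^ 2 - q = q * p" using p by (simp add: power2_eq_square diff_mult_distrib2)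
  have cZ': "card Z = p * (e * q + 1)" using cZ unfolding qq using p by (simp add: algebra_simps)
  have X': "e * X Q \<le> p * (q + e)" if Q: "Q \<in> B" for Q
  proof -
    have Q': "Q \<in> N" "Q \<noteq> 0" using Q f0 unfolding B_def by auto
    have "card (N - line Q) + q = q ^ 3" using card_diff_line[OF N(1,2) Q'] N(3) by simp
    then have "card (N - line Q) = q * (p * (q + 1))"
      using p by (simp add: power3_eq_cube algebra_simps)
    then have "q * (card Z + e * X Q) \<le> q * (Suc e * (p * (q + 1)))"
      using X[OF Q] by (simp add: algebra_simps)
    then have "card Z + e * X Q \<le> Suc e * (p * (q + 1))" using q_pos by simp
    then show ?thesis unfolding cZ' by (simp add: algebra_simps)
  qed
  \<comment> \<open>Projectively, the \<open>e * q + 1\<close> tangents carry \<open>q\<close>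
    non-zeros each, and each of the \<open>q * (q + 1 - e)\<close> non-zeros lies on at most
    \<open>(q + e) / e\<close> tangents. So
    \<open>e * (e * q + 1) \<le> (q + 1 - e) * (q + e)\<close>, which simplifies to
    \<open>e^2 \<le> q\<close>.\<close>
  have "e * (card Z * (q ^ 2 - q)) = (\<Sum>Q\<in>B. e * X Q)" unfolding sumX[symmetric] by (rule sum_distrib_left)
  also have "\<dots> \<le> (\<Sum>Q\<in>B. p * (q + e))" using X' by (intro sum_mono)
  finally have main: "e * (p * (e * q + 1) * (q * p)) \<le> card B * (p * (q + e))"
    unfolding cZ' qq by (simp only: sum_constant of_nat_id)
  obtain k where k: "q = e + k" using e(2) less_imp_add_positive by blast
  have "card B = q * p * (k + 1)"
  proof -
    have "q * p * (k + 1) + (q + e * (q ^ 2 - q)) = q ^ 3"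
    proof -
      have "q + 1 = (k + 1) + e" using k by simp
      then have "q * p * (q + 1) = q * p * ((k + 1) + e)" by (rule arg_cong)
      then have "q * p * (k + 1) + (q + e * (q * p)) = q * p * (q + 1) + q"
        by (simp add: algebra_simps)
      also have "\<dots> = q ^ 3" using p by (simp add: power3_eq_cube algebra_simps)
      finally show ?thesis unfolding qq .
    qed
    then show ?thesis using cB by linarith
  qed
  with main have "(p * p * q) * (e * (e * q + 1)) \<le> (p * p * q) * ((k + 1) * (q + e))"
    by (simp only: mult_ac)
  moreover have "p * p * q > 0" using p q_ge_2 by simp
  ultimately have "e * (e * q + 1) \<le> (k + 1) * (q + e)" by simp
  then have "e ^ 2 * (q + 1) \<le> q * (q + 1)"
    using k by (simp add: power2_eq_square algebra_simps)
  then show ?thesis by (metis add_gr_0 mult_le_cancel2 zero_less_one)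
qed

section \<open>Residual functions and full members of the pencil through a zero subspace\<close>

text \<open>Since \<open>f\<close> vanishes on \<open>L\<close>, a functional \<open>l\<close> with
  kernel \<open>L\<close> on \<open>ext L w\<close> can be divided out; on the coset
  \<open>w + L\<close> it has the value \<open>1\<close>, so \<open>f\<close> itself agrees there
  with the cofactor of degree \<open>e\<close>.\<close>

lemma HP_translate_residual:
  assumes "HP (Suc e) f" "subspace L" "\<And>x. x \<in> L \<Longrightarrow> f x = 0" "w \<notin> L"
  obtains g where "PF e g" "\<forall>y\<in>L. f (w + y) = g y"
proof -
  obtain l where l: "lf l" "l w = 1" "\<forall>x\<in>L. l x = 0" by (rule lf_exists[OF assms(2,4)])
  obtain g where g: "PF e g" "\<forall>x. f x = f (x - (l x - 0) *s w) + (l x - 0) * g x"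
    using PF_split_affine[OF l(1) HP_imp_PF[OF assms(1)], of 0 w] by auto
  have "f (w + y) = g (w + y)" if y: "y \<in> L" for y
    using g(2)[rule_format, of "w + y"] l y assms(3)[OF y] by (simp add: lf_simps)
  then show ?thesis using that[of "\<lambda>y. g (w + y)"] PF_translate[OF g(1)] by blast
qed

lemma HP_residual_nonzero:
  assumes "HP (Suc e) f" "subspace L" "\<And>x. x \<in> L \<Longrightarrow> f x = 0" "\<exists>x\<in>ext L w. f x \<noteq> 0"
  shows "\<exists>y\<in>L. f (w + y) \<noteq> 0"
proof -
  obtain x where x: "x \<in> ext L w" "f x \<noteq> 0" using assms(4) by blast
  obtain y t where yt: "y \<in> L" "x = y + t *s w" using x(1) by (rule extE)
  have "t \<noteq> 0" using yt x(2) assms(3) by auto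
  then have "x = t *s (w + inverse t *s y)" using yt by (simp add: scale_right_distrib add.commute)
  then have "f x = t ^ Suc e * f (w + inverse t *s y)" using HP_homogeneous[OF assms(1)] by simp
  then have "f (w + inverse t *s y) \<noteq> 0" using x(2) by auto
  then show ?thesis using yt assms(2) subspace_scale by blast
qed

text \<open>By homogeneity, scaling identifies the zeros on the coset of \<open>t *s w\<close> with
  those on the coset of \<open>w\<close> for every \<open>t \<noteq> 0\<close>, so one coset
  determines the whole member of the pencil.\<close>

lemma card_zeros_ext:
  assumes "HP (Suc e) f" "subspace K" "finite K" "w \<notin> K"
  shows "zeros f (ext K w) = zeros f K + (q - 1) * zeros_at f w K"
proof -
  have "card {y \<in> K. f (y + t *s w) = 0} = zeros_at f w K" if t: "t \<noteq> 0" for t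
  proof (rule bij_betw_same_card[OF bij_betw_byWitness[where f = "\<lambda>y. inverse t *s y" and f' = "\<lambda>y. t *s y"]])
    have eq: "f (y + t *s w) = t ^ Suc e * f (w + inverse t *s y)" for y
    proof -
      have "y + t *s w = t *s (w + inverse t *s y)" using t by (simp add: scale_right_distrib add.commute)
      then show ?thesis using HP_homogeneous[OF assms(1)] by simp
    qed
    show "(\<lambda>y. inverse t *s y) ` {y \<in> K. f (y + t *s w) = 0} \<subseteq> {y \<in> K. f (w + y) = 0}"
      using t assms(2) unfolding eq by (auto simp: subspace_scale)
    show "(\<lambda>y. t *s y) ` {y \<in> K. f (w + y) = 0} \<subseteq> {y \<in> K. f (y + t *s w) = 0}"
      using t assms(2) unfolding eq by (auto simp: subspace_scale)
  qed (use t in auto)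
  moreover have "card (UNIV - {0 :: 'a}) = q - 1" by (simp add: card_Diff_singleton)
  ultimately have "(\<Sum>t\<in>UNIV - {0}. card {y \<in> K. f (y + t *s w) = 0}) = (q - 1) * zeros_at f w K"
    by simp
  moreover have "zeros f (ext K w) = card {y \<in> K. f (y + 0 *s w) = 0} + (\<Sum>t\<in>UNIV - {0}. card {y \<in> K. f (y + t *s w) = 0})"
    unfolding card_ext_filter'[OF assms(2,4,3), of "\<lambda>x. f x = 0"] by (rule sum.remove) auto
  ultimately show ?thesis by simp
qed

lemma pencil_count:
  assumes V: "subspace V" "finite V" "subspace K" "K \<subseteq> V"
  shows "(\<Sum>w\<in>V - K. card {y \<in> K. f (w + y) = (0::'a)}) = card K * zeros f (V - K)"
    "zeros f V = zeros f K + zeros f (V - K)"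
    "card V = card K + card (V - K)"
proof -
  have finK: "finite K" using V finite_subset by blast
  show "(\<Sum>w\<in>V - K. zeros_at f w K) = card K * zeros f (V - K)"
    using V diff_subspace_add[OF V(1,3,4)] finK by (intro translate_count) auto
  have eq: "{x \<in> V. f x = 0} = {x \<in> K. f x = 0} \<union> {x \<in> V - K. f x = 0}" using V by auto
  show "zeros f V = zeros f K + zeros f (V - K)"
    unfolding eq using V finK by (intro card_Un_disjoint) auto
  show "card V = card K + card (V - K)"
    using V finK by (metis card_Diff_subset card_mono le_add_diff_inverse)
qed

text \<open>Homogenises \<open>full_zero_set\<close>: on a full member the zero set is
  \<open>L\<close> together with \<open>e\<close> further hyperplanes, all containing the axis
  \<open>k = l = 0\<close>.\<close>

lemma full_pencil_member:
  assumes f: "HP (Suc e) f" and e: "1 \<le> e" "e < q" and L: "subspace L" "finite L" "\<And>x. x \<in> L \<Longrightarrow> f x = 0"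
    and w: "w \<notin> L" and full: "q * zeros_at f w L = e * card L"
  obtains c k T l u where "c \<noteq> 0" "lf l" "l w = 1" "\<forall>x\<in>L. l x = 0" "lf k" "k w = 0" "u \<in> L" "k u = 1"
    "card T = e" "\<forall>x\<in>ext L w. f x = c * l x * (\<Prod>t\<in>T. k x - t * l x)"
proof -
  obtain g where g: "PF e g" "\<forall>y\<in>L. f (w + y) = g y" by (rule HP_translate_residual[OF f L(1,3) w])
  have "{y \<in> L. f (w + y) = 0} = {y \<in> L. g y = 0}" using g(2) by auto
  then have "q * zeros g L = e * card L" using full by simp
  then obtain c k u T where k: "c \<noteq> 0" "lf k" "u \<in> L" "k u = 1" "card T = e" "\<forall>x\<in>L. g x = c * (\<Prod>t\<in>T. k x - t)"
    by (rule full_zero_set[OF L(1,2) g(1) e])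
  obtain l where l: "lf l" "l w = 1" "\<forall>x\<in>L. l x = 0" by (rule lf_exists[OF L(1) w])
  \<comment> \<open>Subtracting a multiple of \<open>l\<close> leaves the values on \<open>L\<close>
    unchanged and normalises \<open>k' w = 0\<close>; then \<open>w\<close> is a zero exactly when
    \<open>0 \<in> T\<close>.\<close>
  define k' where "k' x = 1 * k x + (- k w) * l x" for x
  have k': "lf k'" unfolding k'_def by (rule lf_comb[OF k(2) l(1)])
  have k'L: "k' y = k y" if "y \<in> L" for y using that l unfolding k'_def by simp
  have k'w: "k' w = 0" using l unfolding k'_def by simp
  have "f x = c * l x * (\<Prod>t\<in>T. k' x - t * l x)" if x: "x \<in> ext L w" for x
  proof -
    obtain y s where ys: "y \<in> L" "x = y + s *s w" using x by (rule extE)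
    have lx: "l x = s" using ys l by (simp add: lf_simps)
    have kx: "k' x = k y" using ys k'L k'w k' by (simp add: lf_simps)
    show ?thesis
    proof (cases "s = 0")
      case True
      then show ?thesis using lx ys L(3) by simp
    next
      case False
      then have "x = s *s (w + inverse s *s y)" using ys by (simp add: scale_right_distrib add.commute)
      then have "f x = s ^ Suc e * f (w + inverse s *s y)" using HP_homogeneous[OF f] by simp
      also have "f (w + inverse s *s y) = c * (\<Prod>t\<in>T. k (inverse s *s y) - t)"
        using g(2) k(6) ys L(1) by (simp add: subspace_scale)
      also have "(\<Prod>t\<in>T. k (inverse s *s y) - t) = (\<Prod>t\<in>T. inverse s * (k y - t * s))"
        using False k(2) by (intro prod.cong) (auto simp: lf_simps field_simps)
      also have "\<dots> = inverse s ^ e * (\<Prod>t\<in>T. k y - t * s)" by (simp add: prod.distrib k(5))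
      finally show ?thesis using False lx kx by (simp add: field_simps)
    qed
  qed
  then show ?thesis using that[of c l k' u T] k l k' k'L k'w by auto
qed

text \<open>If every member of the pencil through a zero subspace \<open>L\<close> of codimension two is full, the same holds for
  every other zero subspace of that size, and the zero set behaves like a generalized quadrangle. A plane
  \<open>N\<close> that meets the zero set in no line then has the incidence properties of \<open>plane_section_count\<close>.\<close>

lemma not_all_full:
  assumes f: "HP (Suc e) f" and e: "1 \<le> e" "e < q" "q < e ^ 2"
    and V: "subspace V" "finite V" "subspace L" "L \<subseteq> V" "card V = q ^ 2 * card L"
    and zero: "\<And>x. x \<in> L \<Longrightarrow> f x = 0"
    and max: "\<And>S. subspace S \<Longrightarrow> S \<subseteq> V \<Longrightarrow> card S = q * card L \<Longrightarrow> \<exists>x\<in>S. f x \<noteq> 0"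
  shows "\<exists>w\<in>V - L. q * zeros_at f w L \<noteq> e * card L"
proof (rule ccontr)
  assume "\<not> ?thesis"
  then have full: "q * zeros_at f w L = e * card L" if "w \<in> V - L" for w using that by blast
  have finL: "finite L" using V finite_subset by blast
  have cL: "card L > 0" using V(3) finL by (rule card_subspace_pos)
  have hom: "f (c *s x) = c ^ Suc e * f x" for c x by (rule HP_homogeneous[OF f])
  define zV where "zV = zeros f V"
  have zV: "q * card L + e * card (V - L) = q * zV"
  proof -
    have "q * (card L * zeros f (V - L)) = (\<Sum>w\<in>V - L. q * zeros_at f w L)"
      unfolding pencil_count(1)[OF V(1-4), symmetric] by (rule sum_distrib_left)
    also have "\<dots> = (\<Sum>w\<in>V - L. e * card L)" by (rule sum.cong[OF refl full])
    finally have "card L * (q * zeros f (V - L)) = card L * (e * card (V - L))"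
      by (simp add: mult_ac)
    then have "q * zeros f (V - L) = e * card (V - L)" using cL by simp
    moreover have "{x \<in> L. f x = 0} = L" using zero by auto
    ultimately show ?thesis unfolding zV_def pencil_count(2)[OF V(1-4)] by (simp add: add_mult_distrib2)
  qed
  \<comment> \<open>The total number of zeros is already known and depends only on
    \<open>card L\<close>. For \<open>L'\<close> it equals the sum of the upper bounds over all
    cosets, so each bound is attained.\<close>
  have full': "q * zeros_at f w L' = e * card L'"
    if L': "subspace L'" "L' \<subseteq> V" "card L' = card L" "\<And>x. x \<in> L' \<Longrightarrow> f x = 0" and w: "w \<in> V - L'" for L' w
  proof -
    have finL': "finite L'" using L' V finite_subset by blast
    have le: "q * zeros_at f u L' \<le> e * card L'" if u: "u \<in> V - L'" for u
    proof -
      have uL: "u \<notin> L'" using u by blast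
      have "\<exists>x\<in>ext L' u. f x \<noteq> 0"
        using u L' V(1) card_ext[OF L'(1) uL] by (intro max subspace_ext ext_subset) auto
      then have ex: "\<exists>y\<in>L'. f (u + y) \<noteq> 0" using HP_residual_nonzero[OF f L'(1), of u] L'(4) by blast
      obtain g where g: "PF e g" "\<forall>y\<in>L'. f (u + y) = g y" by (rule HP_translate_residual[OF f L'(1,4) uL])
      have "{y \<in> L'. f (u + y) = 0} = {y \<in> L'. g y = 0}" using g(2) by auto
      then show ?thesis using card_zeros_le[OF L'(1) finL' g(1)] ex g(2) by auto
    qed
    have A: "q * (card L' * zeros f (V - L')) = (\<Sum>w\<in>V - L'. q * zeros_at f w L')"
      unfolding pencil_count(1)[OF V(1,2) L'(1,2), symmetric] by (rule sum_distrib_left)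
    have "{x \<in> L'. f x = 0} = L'" using L'(4) by auto
    then have B: "q * zV = q * card L' + q * zeros f (V - L')"
      unfolding zV_def pencil_count(2)[OF V(1,2) L'(1,2)] by (simp add: add_mult_distrib2)
    have C: "card (V - L') = card (V - L)"
      using pencil_count(3)[OF V(1,2) L'(1,2)] pencil_count(3)[OF V(1-4)] L'(3) by simp
    have "q * zeros f (V - L') = e * card (V - L')" using zV B unfolding C L'(3) by linarith
    then have "card L' * (q * zeros f (V - L')) = card L' * (e * card (V - L'))" by (rule arg_cong)
    then have sum_eq: "(\<Sum>w\<in>V - L'. q * zeros_at f w L') = (\<Sum>w\<in>V - L'. e * card L')"
      unfolding A[symmetric] sum_constant of_nat_id by (simp only: mult_ac)
    show ?thesis
    proof (rule ccontr)
      assume "\<not> ?thesis"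
      then have "q * zeros_at f w L' < e * card L'" using le[OF w] by linarith
      then have "(\<Sum>w\<in>V - L'. q * zeros_at f w L') < (\<Sum>w\<in>V - L'. e * card L')"
        using le w V(2) by (intro sum_strict_mono_ex1 bexI[of _ w]) auto
      then show False using sum_eq by simp
    qed
  qed
  obtain w0 where w0: "w0 \<in> V" "w0 \<notin> L"
  proof -
    have "1 * card L < q ^ 2 * card L" using cL q_ge_2 by (intro mult_strict_right_mono one_less_power) auto
    then have "L \<noteq> V" using V(5) by auto
    then show ?thesis using that V by blast
  qed
  have full0: "q * zeros_at f w0 L = e * card L" using full w0 by blast
  obtain c0 k0 T0 l0 R where st0: "c0 \<noteq> 0" "lf l0" "l0 w0 = 1" "\<forall>x\<in>L. l0 x = 0" "lf k0" "k0 w0 = 0"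
    "R \<in> L" "k0 R = 1" "card T0 = e" "\<forall>x\<in>ext L w0. f x = c0 * l0 x * (\<Prod>t\<in>T0. k0 x - t * l0 x)"
    by (rule full_pencil_member[OF f e(1,2) V(3) finL zero w0(2) full0])
  have R: "R \<in> V" "R \<noteq> 0" "f R = 0" using st0 V zero lf_zero[OF st0(5)] by auto
  \<comment> \<open>\<open>R\<close> was chosen in \<open>L\<close> with \<open>k0 R = 1\<close>,
    hence off the axis of the member through \<open>w0\<close>. This makes \<open>R\<close> a smooth
    point: \<open>D w0 \<noteq> 0\<close>.\<close>
  obtain D p where D: "tangent f (Suc e) R D p" "\<forall>x. coeff (p x) (Suc e) = f x" using HP_tangent[OF f] by blast
  have lD: "lf D" using D unfolding tangent_def by blast
  text \<open>the leading coefficients agree, so the difference has degree less than \<open>q\<close> and is determined by its values\<close>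
  have Deq: "D x = coeff r 1" if r: "degree r \<le> Suc e" "coeff r (Suc e) = f x" "\<And>t. f (R + t *s x) = poly r t" for x r
  proof -
    have "p x - r = 0"
    proof (rule poly_eq_0_if_values)
      have "degree (p x - r) \<le> Suc e" using D r(1) unfolding tangent_def by (intro degree_diff_le) auto
      moreover have "coeff (p x - r) (Suc e) = 0" using D r by simp
      ultimately have "degree (p x - r) \<le> e"
        by (metis degree_0 leading_coeff_0_iff le_SucE old.nat.distinct(1))
      then show "degree (p x - r) < CARD('a)" using e by simp
      show "poly (p x - r) t = 0" for t using D(1) r(3)[of t] unfolding tangent_def by simp
    qed
    moreover have "coeff (p x) 1 = D x" using D(1) unfolding tangent_def by blast
    ultimately show ?thesis by simp
  qed
  have DL: "D x = 0" if x: "x \<in> L" for x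
  proof -
    have "f (R + t *s x) = 0" for t using x st0(7) V(3) zero by (simp add: subspace_add subspace_scale)
    then show ?thesis using Deq[of 0 x] zero x by simp
  qed
  \<comment> \<open>On the member through \<open>w\<close>, the restriction to the line is
    \<open>c\<close> times \<open>t\<close> times the product of \<open>k R - s * t\<close> over
    \<open>s \<in> T\<close>, with linear coefficient \<open>c * k R ^ e\<close>. Hence
    \<open>D w = 0\<close> exactly when \<open>R\<close> lies on the axis of the member.\<close>
  have Dw: "D w = c * k R ^ e"
    if "w \<in> V - L" "lf l" "l w = 1" "\<forall>x\<in>L. l x = 0" "lf k" "k w = 0" "card T = e"
      "\<forall>x\<in>ext L w. f x = c * l x * (\<Prod>t\<in>T. k x - t * l x)" for w c k l T
  proof -
    define r where "r = smult c ([:0, 1:] * (\<Prod>t\<in>T. [:k R, - t:]))"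
    have fr: "f (R + t *s w) = poly r t" for t
      using that st0(7) extI[OF st0(7), of t w]
      by (simp add: r_def poly_prod lf_simps algebra_simps)
    have deg: "degree (\<Prod>t\<in>T. [:k R, - t:]) \<le> e"
    proof -
      have "degree (\<Prod>t\<in>T. [:k R, - t:]) \<le> sum (degree \<circ> (\<lambda>t. [:k R, - t:])) T" by (rule degree_prod_sum_le) simp
      also have "\<dots> \<le> (\<Sum>t\<in>T. 1)" by (intro sum_mono) simp
      finally show ?thesis using that(7) by simp
    qed
    have top: "coeff (\<Prod>t\<in>T. [:k R, - t:]) e = (\<Prod>t\<in>T. - t)"
    proof -
      have "finite S \<Longrightarrow> degree (\<Prod>t\<in>S. [:k R, - t:]) \<le> card S \<and> coeff (\<Prod>t\<in>S. [:k R, - t:]) (card S) = (\<Prod>t\<in>S. - t)" for S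
      proof (induction S rule: finite_induct)
        case (insert t S)
        have "degree ([:k R, - t:] * (\<Prod>t\<in>S. [:k R, - t:])) \<le> Suc (card S)"
        proof -
          have "degree [:k R, - t:] \<le> 1" by simp
          then show ?thesis using insert.IH degree_mult_le[of "[:k R, - t:]" "\<Prod>t\<in>S. [:k R, - t:]"] by linarith
        qed
        moreover have "coeff (\<Prod>t\<in>S. [:k R, - t:]) (Suc (card S)) = 0"
          using insert.IH by (intro coeff_eq_0) simp
        ultimately show ?case using insert.IH insert.hyps
          by (simp add: coeff_linear_mult del: mult_pCons_left)
      qed simp
      from this[of T] show ?thesis using that(7) by simp
    qed
    have "degree r \<le> Suc e"
    proof -
      have "degree ([:0, 1:] * (\<Prod>t\<in>T. [:k R, - t:])) \<le> Suc e"
        using degree_mult_le[of "[:0, 1:]" "\<Prod>t\<in>T. [:k R, - t:]"] deg by simp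
      then show ?thesis unfolding r_def by (meson degree_smult_le le_trans)
    qed
    moreover have "coeff r (Suc e) = f w"
    proof -
      have "f w = c * (\<Prod>t\<in>T. - t)" using that mem_ext[OF V(3), of w] by simp
      then show ?thesis using top unfolding r_def by simp
    qed
    ultimately have "D w = coeff r 1" using fr by (rule Deq)
    also have "\<dots> = c * coeff (\<Prod>t\<in>T. [:k R, - t:]) 0" unfolding r_def by simp
    also have "coeff (\<Prod>t\<in>T. [:k R, - t:]) 0 = k R ^ e"
      using that(7) by (simp add: poly_prod flip: poly_0_coeff_0)
    finally show ?thesis .
  qed
  have D0: "D w0 \<noteq> 0" using Dw[of w0 l0 k0 T0 c0] st0 w0 by simp
  \<comment> \<open>\<open>D\<close> vanishes on \<open>L\<close>, which has codimension two, so its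
    kernel in \<open>V\<close> is one member of the pencil: the tangent hyperplane \<open>K1\<close>
    at \<open>R\<close>.\<close>
  obtain w1 where w1: "w1 \<in> V" "w1 \<notin> L" "D w1 = 0"
  proof -
    have "q * card L < q ^ 2 * card L" using cL q_ge_2 by (simp add: power2_eq_square)
    then have "ext L w0 \<noteq> V" using V(5) card_ext[OF V(3) w0(2)] by auto
    moreover have "ext L w0 \<subseteq> V" using V w0 by (intro ext_subset) auto
    ultimately obtain b where b: "b \<in> V" "b \<notin> ext L w0" by blast
    let ?w = "b - (D b / D w0) *s w0"
    have "?w \<in> V" using w0 b V by (simp add: subspace_diff subspace_scale)
    moreover have "?w \<notin> L"
    proof
      assume "?w \<in> L"
      then have "?w + (D b / D w0) *s w0 \<in> ext L w0" by (rule extI)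
      then show False using b by simp
    qed
    moreover have "D ?w = 0" using lD D0 by (simp add: lf_simps)
    ultimately show ?thesis using that by blast
  qed
  define K1 where "K1 = ext L w1"
  have K1: "subspace K1" "K1 \<subseteq> V" "L \<subseteq> K1" "card K1 = q * card L"
    unfolding K1_def using V w1
    by (simp_all add: subspace_ext ext_subset card_ext subset_ext)
  have DK1: "x \<in> K1 \<longleftrightarrow> D x = 0" if x: "x \<in> V" for x
  proof
    assume "x \<in> K1"
    then obtain y t where "y \<in> L" "x = y + t *s w1" unfolding K1_def by (rule extE)
    then show "D x = 0" using DL w1 lD by (simp add: lf_simps)
  next
    assume Dx: "D x = 0"
    have "w0 \<notin> K1"
    proof
      assume "w0 \<in> K1"
      then obtain y t where "y \<in> L" "w0 = y + t *s w1" unfolding K1_def by (rule extE)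
      then show False using DL w1 lD D0 by (simp add: lf_simps)
    qed
    then have "ext K1 w0 = V" using K1 V w0 by (intro ext_eq_if_card) (auto simp: power2_eq_square)
    then obtain y t where yt: "y \<in> K1" "x = y + t *s w0" using x by (metis extE)
    obtain y' s where "y' \<in> L" "y = y' + s *s w1" using yt(1) unfolding K1_def by (rule extE)
    then have "D y = 0" using DL w1 lD by (simp add: lf_simps)
    then have "t * D w0 = 0" using Dx yt lD by (simp add: lf_simps)
    then show "x \<in> K1" using D0 yt by simp
  qed
  have full1: "q * zeros_at f w1 L = e * card L" using full w1 by blast
  obtain c1 k1 T1 l1 u1 where st1: "c1 \<noteq> 0" "lf l1" "l1 w1 = 1" "\<forall>x\<in>L. l1 x = 0" "lf k1" "k1 w1 = 0"
    "u1 \<in> L" "k1 u1 = 1" "card T1 = e" "\<forall>x\<in>ext L w1. f x = c1 * l1 x * (\<Prod>t\<in>T1. k1 x - t * l1 x)"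
    by (rule full_pencil_member[OF f e(1,2) V(3) finL zero w1(2) full1])
  \<comment> \<open>In the tangent member all \<open>e + 1\<close> hyperplanes pass through
    \<open>R\<close>, so there \<open>f\<close> is invariant under translation by multiples of
    \<open>R\<close>.\<close>
  have k1R: "k1 R = 0" using Dw[of w1 l1 k1 T1 c1] st1 w1 by simp
  obtain Q where Q: "Q \<in> K1" "f Q \<noteq> 0" using max[OF K1(1,2,4)] by blast
  have fRQ: "f (s *s R + t *s Q) = t ^ Suc e * f Q" for s t
  proof -
    have "s *s R + t *s Q \<in> ext L w1" "t *s Q \<in> ext L w1"
      using Q K1 st0(7) unfolding K1_def[symmetric] by (auto intro!: subspace_add subspace_scale)
    then have "f (s *s R + t *s Q) = f (t *s Q)" using st1 st0(7) k1R by (simp add: lf_simps)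
    then show ?thesis using hom by simp
  qed
  have QR: "Q \<notin> line R" using Q(2) hom R(3) unfolding line_eq by auto
  \<comment> \<open>Projectively a tangent line at \<open>R\<close>: by the invariance its only
    zeros are the multiples of \<open>R\<close>.\<close>
  define P where "P = ext (line R) Q"
  have P: "subspace P" "finite P" "card P = q ^ 2" "R \<in> P" "P \<subseteq> K1"
  proof -
    show "subspace P" unfolding P_def by (rule subspace_ext[OF subspace_line])
    show "finite P" unfolding P_def by (rule finite_ext[OF finite_line])
    show "card P = q ^ 2" unfolding P_def using card_ext[OF subspace_line QR] card_line[OF R(2)]
      by (simp add: power2_eq_square)
    have "R \<in> line R" unfolding line_def using mem_ext[OF subspace_single_0] .
    then show "R \<in> P" unfolding P_def using subset_ext by blast
    show "P \<subseteq> K1" unfolding P_def using Q K1 st0(7) by (intro ext_subset line_subset) auto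
  qed
  have Pzero: "x \<in> line R" if "x \<in> P" "f x = 0" for x
  proof -
    obtain y t where yt: "y \<in> line R" "x = y + t *s Q" using \<open>x \<in> P\<close> unfolding P_def by (rule extE)
    obtain s where "y = s *s R" using yt unfolding line_eq by blast
    then have "t = 0" using fRQ[of s t] yt that(2) Q(2) by auto
    then show ?thesis using yt by simp
  qed
  have w0P: "w0 \<notin> P" using P(5) DK1[OF w0(1)] D0 by blast
  \<comment> \<open>A projective plane that meets the tangent hyperplane only in the line
    \<open>P\<close>. Every other line through \<open>R\<close> is transversal and has exactly
    \<open>e\<close> further zeros, which fixes the zero count of \<open>N\<close>.\<close>
  define N where "N = ext P w0"
  have N: "subspace N" "finite N" "card N = q ^ 3" "P \<subseteq> N" "N \<subseteq> V"
    unfolding N_def using P w0P w0 V K1 subset_trans[OF P(5) K1(2)]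
    by (simp_all add: subspace_ext finite_ext ext_subset card_ext subset_ext power3_eq_cube power2_eq_square)
  have ND: "D x \<noteq> 0" if "x \<in> N" "x \<notin> P" for x
  proof -
    obtain y t where yt: "y \<in> P" "x = y + t *s w0" using \<open>x \<in> N\<close> unfolding N_def by (rule extE)
    have "t \<noteq> 0" using yt that(2) by auto
    moreover have "y \<in> K1" "y \<in> V" using yt P K1 by auto
    then have "D y = 0" using DK1 by blast
    ultimately show ?thesis using yt D0 lD by (simp add: lf_simps)
  qed
  have lineP: "line R \<subseteq> P" using P line_subset by blast
  have roots: "card {s. c * (\<Prod>t\<in>T. s * a - t) = (0::'a)} = card T" if "c \<noteq> 0" "a \<noteq> 0" for c a T
  proof -
    have "{s. c * (\<Prod>t\<in>T. s * a - t) = 0} = (\<lambda>t. t / a) ` T"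
      using that by (auto simp: image_iff field_simps)
    moreover have "inj_on (\<lambda>t. t / a) T" using that by (auto simp: inj_on_def)
    ultimately show ?thesis by (simp add: card_image)
  qed
  have secR: "card {s. f (x + s *s R) = 0} = e" if x: "x \<in> N" "x \<notin> P" for x
  proof -
    have Dx: "D x \<noteq> 0" using ND x by blast
    then have xL: "x \<in> V - L" using DL x N(5) by blast
    then have xL': "x \<notin> L" by blast
    obtain c k T l u where st: "c \<noteq> 0" "lf l" "l x = 1" "\<forall>y\<in>L. l y = 0" "lf k" "k x = 0"
      "u \<in> L" "k u = 1" "card T = e" "\<forall>y\<in>ext L x. f y = c * l y * (\<Prod>t\<in>T. k y - t * l y)"
      by (rule full_pencil_member[OF f e(1,2) V(3) finL zero xL' full[OF xL]])
    have kR: "k R \<noteq> 0" using Dw[of x l k T c] st xL Dx e(1) by auto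
    have "f (x + s *s R) = c * (\<Prod>t\<in>T. s * k R - t)" for s
    proof -
      have "x + s *s R \<in> ext L x"
        using extI[of "s *s R" L 1 x] st0(7) V(3) by (simp add: subspace_scale add.commute)
      then show ?thesis using st st0(7) by (simp add: lf_simps)
    qed
    then show ?thesis using roots[OF st(1) kR, of T] st(9) by simp
  qed
  have zN: "zeros f N = q + e * (q ^ 2 - q)"
  proof -
    have lR: "f x = 0" if "x \<in> line R" for x using that R(3) hom unfolding line_eq by auto
    have inv: "x + y \<in> N - P" if "x \<in> N - P" "y \<in> line R" for x y
      using diff_subspace_add[OF N(1) P(1) N(4) that(1)] that(2) lineP by blast
    have "q * zeros f (N - P) = (\<Sum>x\<in>N - P. zeros_at f x (line R))"
      using translate_count[OF subspace_line finite_line _ inv, of R "\<lambda>x. f x = 0"] N card_line[OF R(2)] by simp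
    also have "\<dots> = (\<Sum>x\<in>N - P. e)"
      by (rule sum.cong[OF refl]) (use card_line_filter[OF R(2)] secR in auto)
    also have "\<dots> = e * card (N - P)" by simp
    also have "card (N - P) = q * (q ^ 2 - q)"
      using pencil_count(3)[OF N(1,2) P(1) N(4)] N(3) P(3)
      by (simp add: power3_eq_cube power2_eq_square diff_mult_distrib2)
    finally have "q * zeros f (N - P) = q * (e * (q ^ 2 - q))" by (simp only: mult_ac)
    then have "zeros f (N - P) = e * (q ^ 2 - q)" using q_pos by simp
    moreover have "{x \<in> P. f x = 0} = line R" using Pzero lR lineP by auto
    ultimately show ?thesis using pencil_count(2)[OF N(1,2) P(1) N(4), of f] card_line[OF R(2)] by simp
  qed
  \<comment> \<open>Two projective lines in a plane meet, so a line of zeros would meet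
    \<open>P\<close>, necessarily in \<open>R\<close>. It would then be a line through
    \<open>R\<close> other than \<open>P\<close> with \<open>q\<close> further zeros instead of
    \<open>e\<close>.\<close>
  have noline: "\<exists>z\<in>ext (line R') x. f z \<noteq> 0" if R': "R' \<in> N" "R' \<noteq> 0" and x: "x \<in> N - line R'" for R' x
  proof (rule ccontr)
    assume "\<not> ?thesis"
    then have all: "f z = 0" if "z \<in> ext (line R') x" for z using that by blast
    define S where "S = ext (line R') x"
    have xl: "x \<notin> line R'" using x by blast
    have S: "subspace S" "S \<subseteq> N" "finite S" "card S = q ^ 2"
      unfolding S_def using R' x N card_ext[OF subspace_line xl] card_line[OF R'(2)]
      by (simp_all add: subspace_ext subspace_line finite_ext finite_line power2_eq_square
        ext_subset[OF N(1) line_subset[OF N(1) R'(1)]])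
    have "S \<inter> P \<noteq> {0}"
    proof
      assume SP: "S \<inter> P = {0}"
      have "inj_on (\<lambda>(a, b). a + b) (S \<times> P)"
      proof (rule inj_onI, clarsimp)
        fix a b a' b' assume *: "a \<in> S" "b \<in> P" "a' \<in> S" "b' \<in> P" "a + b = a' + b'"
        then have "a - a' = b' - b" by (simp add: algebra_simps)
        moreover have "a - a' \<in> S" "b' - b \<in> P" using * S P subspace_diff by blast+
        ultimately have "a - a' \<in> S \<inter> P" "b' - b \<in> S \<inter> P" by auto
        then have "a - a' = 0" "b' - b = 0" unfolding SP by blast+
        then show "a = a' \<and> b = b'" by simp
      qed
      moreover have "(\<lambda>(a, b). a + b) ` (S \<times> P) \<subseteq> N" using S N by (auto intro!: subspace_add)
      ultimately have "card (S \<times> P) \<le> card N" using N(2) card_inj_on_le by blast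
      then have "q ^ 2 * q ^ 2 \<le> q ^ 3" using S P N by (simp add: card_cartesian_product)
      then have "q ^ 4 \<le> q ^ 3" by (simp flip: power_add)
      then show False using q_ge_2 by (simp add: power_increasing_iff)
    qed
    moreover have "0 \<in> S \<inter> P" using S P subspace_0 by blast
    ultimately obtain y where y: "y \<in> S" "y \<in> P" "y \<noteq> 0" by blast
    then have "y \<in> line R" using Pzero all unfolding S_def by blast
    then obtain s where s: "y = s *s R" unfolding line_eq by blast
    then have "R = inverse s *s y" using y(3) by auto
    then have RS: "R \<in> S" using y S subspace_scale by metis
    have "S \<noteq> line R"
    proof
      assume "S = line R"
      then have "q ^ 2 = q" using S card_line[OF R(2)] by simp
      then show False using q_ge_2 by (simp add: power2_eq_square)
    qed
    moreover have "line R \<subseteq> S" using line_subset[OF S(1) RS] .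
    ultimately obtain z where z: "z \<in> S" "z \<notin> line R" by blast
    have "z \<notin> P" using Pzero z all unfolding S_def by blast
    then have "card {s. f (z + s *s R) = 0} = e" using secR z S by blast
    moreover have "f (z + s *s R) = 0" for s
      using all z RS S unfolding S_def[symmetric] by (simp add: subspace_add subspace_scale)
    ultimately show False using e by simp
  qed
  have sec: "card {s. f (x + s *s R') = 0} = 0 \<or> card {s. f (x + s *s R') = 0} = e"
    if R': "R' \<in> N" "R' \<noteq> 0" "f R' = 0" and x: "x \<in> N - line R'" for R' x
  proof -
    \<comment> \<open>For \<open>R'\<close> outside \<open>L\<close>, the member through
      \<open>R'\<close> is a product of hyperplanes; as \<open>k R' = 0\<close> and
      \<open>R'\<close> is a zero, \<open>0 \<in> T\<close>, and the hyperplane \<open>k = 0\<close>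
      serves as \<open>L'\<close>.\<close>
    have "\<exists>L'. subspace L' \<and> L' \<subseteq> V \<and> card L' = card L \<and> (\<forall>y\<in>L'. f y = 0) \<and> R' \<in> L'"
    proof (cases "R' \<in> L")
      case True
      then show ?thesis using V zero by blast
    next
      case False
      have RV: "R' \<in> V - L" using False R' N by blast
      obtain c k T l u where st: "c \<noteq> 0" "lf l" "l R' = 1" "\<forall>y\<in>L. l y = 0" "lf k" "k R' = 0"
        "u \<in> L" "k u = 1" "card T = e" "\<forall>y\<in>ext L R'. f y = c * l y * (\<Prod>t\<in>T. k y - t * l y)"
        by (rule full_pencil_member[OF f e(1,2) V(3) finL zero False full[OF RV]])
      have "c * (\<Prod>t\<in>T. - t) = 0" using st R'(3) mem_ext[OF V(3), of R'] by simp
      then have T0: "0 \<in> T" using st(1) by auto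
      define L' where "L' = {y \<in> ext L R'. k y = 0}"
      have "subspace L'" unfolding L'_def by (rule subspace_kernel[OF st(5) subspace_ext[OF V(3)]])
      moreover have "L' \<subseteq> V" unfolding L'_def using ext_subset[OF V(1,4)] RV by blast
      moreover have "card L' = card L"
      proof -
        have "u \<in> ext L R'" using st(7) subset_ext by blast
        then have "card (ext L R') = q * card L'" unfolding L'_def
          using card_kernel[OF st(5) subspace_ext[OF V(3)]] st(8) by simp
        then show ?thesis using card_ext[OF V(3) False] q_pos by simp
      qed
      moreover have "f y = 0" if "y \<in> L'" for y
      proof -
        have "(\<Prod>t\<in>T. k y - t * l y) = 0" using that T0 unfolding L'_def by (intro prod_zero) (auto intro!: bexI[of _ 0])
        then show ?thesis using st(10) that unfolding L'_def by simp
      qed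
      moreover have "R' \<in> L'" unfolding L'_def using mem_ext[OF V(3)] st(6) by blast
      ultimately show ?thesis by blast
    qed
    then obtain L' where L': "subspace L'" "L' \<subseteq> V" "card L' = card L" "\<forall>y\<in>L'. f y = 0" "R' \<in> L'" by blast
    have finL': "finite L'" using L' V finite_subset by blast
    have xL: "x \<notin> L'"
    proof
      assume "x \<in> L'"
      then have "ext (line R') x \<subseteq> L'" using L' by (intro ext_subset line_subset) auto
      then show False using noline[OF R'(1,2) x] L'(4) by blast
    qed
    have zL': "f y = 0" if "y \<in> L'" for y using L'(4) that by blast
    have xV: "x \<in> V - L'" using xL x N by blast
    obtain c k T l u where st: "c \<noteq> 0" "lf l" "l x = 1" "\<forall>y\<in>L'. l y = 0" "lf k" "k x = 0"
      "u \<in> L'" "k u = 1" "card T = e" "\<forall>y\<in>ext L' x. f y = c * l y * (\<Prod>t\<in>T. k y - t * l y)"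
      by (rule full_pencil_member[OF f e(1,2) L'(1) finL' zL' xL full'[OF L'(1-3) zL' xV]])
    have fx: "f (r *s x + s *s R') = c * r * (\<Prod>t\<in>T. s * k R' - t * r)" for r s
    proof -
      have "r *s x + s *s R' \<in> ext L' x"
        using extI[of "s *s R'" L' r x] L' by (simp add: subspace_scale add.commute)
      then show ?thesis using st L'(5) by (simp add: lf_simps)
    qed
    have fx1: "f (x + s *s R') = c * (\<Prod>t\<in>T. s * k R' - t)" for s using fx[of 1 s] by simp
    \<comment> \<open>If \<open>k R' \<noteq> 0\<close>, the \<open>e\<close> values in
      \<open>T\<close> give \<open>e\<close> zeros. If \<open>k R' = 0\<close>, the product is
      constant in \<open>s\<close>; a zero constant would put the whole line into the zero set,
      against \<open>noline\<close>.\<close>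
    show ?thesis
    proof (cases "k R' = 0")
      case False
      then show ?thesis using roots[OF st(1) False, of T] st(9) fx1 by simp
    next
      case True
      have "(\<Prod>t\<in>T. - t) \<noteq> 0"
      proof
        assume 0: "(\<Prod>t\<in>T. - t) = 0"
        then have "0 \<in> T" by auto
        then have "(\<Prod>t\<in>T. s * k R' - t * r) = 0" for r s using True
          by (intro prod_zero) (auto intro!: bexI[of _ 0])
        then have "f (r *s x + s *s R') = 0" for r s using fx by simp
        moreover obtain z where z: "z \<in> ext (line R') x" "f z \<noteq> 0" using noline[OF R'(1,2) x] by blast
        moreover obtain y r where "y \<in> line R'" "z = y + r *s x" using z(1) by (rule extE)
        moreover obtain s where "y = s *s R'" using \<open>y \<in> line R'\<close> unfolding line_eq by blast
        ultimately show False by (simp add: add.commute)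
      qed
      then have "f (x + s *s R') \<noteq> 0" for s using fx1 True st(1) by simp
      then show ?thesis by simp
    qed
  qed
  have "e ^ 2 \<le> q" by (rule plane_section_count[OF N(1-3) f e(1,2) zN sec])
  then show False using e(3) by simp
qed


section \<open>Zero counts from the pencil through a maximal zero subspace\<close>

lemma residual_zeros:
  assumes f: "HP (Suc e) f" and e: "1 \<le> e" "e < q" and L: "subspace L" "finite L" "\<And>x. x \<in> L \<Longrightarrow> f x = 0"
    and w: "w \<notin> L" "\<exists>x\<in>ext L w. f x \<noteq> 0"
  defines "n \<equiv> zeros_at f w L"
  shows "q * n \<le> e * card L" "q * n = e * card L \<or> q ^ 2 * n + (e - 1) * card L \<le> e * q * card L"
proof -
  obtain g where g: "PF e g" "\<forall>y\<in>L. f (w + y) = g y" by (rule HP_translate_residual[OF f L(1,3) w(1)])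
  have n: "n = zeros g L" unfolding n_def using g(2) by (intro arg_cong[of _ _ card]) auto
  have "\<exists>y\<in>L. f (w + y) \<noteq> 0" using HP_residual_nonzero[OF f L(1), of w] L(3) w(2) by blast
  then have ex: "\<exists>y\<in>L. g y \<noteq> 0" using g(2) by auto
  show "q * n \<le> e * card L" unfolding n by (rule card_zeros_le[OF L(1,2) g(1) ex])
  show "q * n = e * card L \<or> q ^ 2 * n + (e - 1) * card L \<le> e * q * card L"
    unfolding n by (rule second_weight[OF L(1,2) g(1) e ex])
qed

text \<open>The complement of \<open>K\<close> is a union of cosets of \<open>L\<close> for every
  \<open>L \<subseteq> K\<close>. This permits removing a special member \<open>K\<close> first and
  still averaging over the cosets of the smaller \<open>L\<close>.\<close>

lemma pencil_le:
  assumes V: "subspace V" "finite V" "subspace K" "K \<subseteq> V" "subspace L" "L \<subseteq> K"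
    and le: "\<And>w. w \<in> V - K \<Longrightarrow> a * card {y \<in> L. f (w + y) = (0::'a)} \<le> b * card L"
  shows "a * zeros f (V - K) \<le> b * card (V - K)"
proof -
  have finL: "finite L" by (rule finite_subset[OF V(6) finite_subset[OF V(4,2)]])
  have cL: "card L > 0" using V(5) finL by (rule card_subspace_pos)
  have "(\<Sum>w\<in>V - K. zeros_at f w L) = card L * zeros f (V - K)"
    using V diff_subspace_add[OF V(1,3,4)] finL by (intro translate_count) auto
  then have "card L * (a * zeros f (V - K)) = (\<Sum>w\<in>V - K. a * zeros_at f w L)"
    unfolding sum_distrib_left[symmetric] by (simp only: mult_ac)
  also have "\<dots> \<le> (\<Sum>w\<in>V - K. b * card L)" by (intro sum_mono le)
  also have "\<dots> = card L * (b * card (V - K))" by simp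
  finally show ?thesis using cL by simp
qed

text \<open>This is \<open>q^2 + (q - 1) * (e * q - e + 1)\<close>: a zero hyperplane plus
  \<open>q - 1\<close> cosets with the second largest count, scaled by \<open>q^3 / card V\<close>.
  It expresses bound (a).\<close>

abbreviation linear_coeff :: "nat \<Rightarrow> int" where
  "linear_coeff e \<equiv> (int e + 1) * int q ^ 2 - (2 * int e - 1) * int q + int e - 1"

text \<open>\<open>linear_coeff e\<close> plus \<open>e * (q^3 - q^2)\<close>: one deficient member
  of a pencil in codimension two plus the \<open>q\<close> remaining members at their maximum. It
  expresses bound (b), scaled by \<open>q^4 / card V\<close>.\<close>

abbreviation codim_two_coeff :: "nat \<Rightarrow> int" where
  "codim_two_coeff e \<equiv> int e * int q ^ 3 + int q ^ 2 - int e * int q - (int q - 1) * (int e - 1)"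

text \<open>\<open>not_all_full\<close> supplies one member below the maximum and
  \<open>second_weight\<close> quantifies its deficit; every coset outside that member is charged
  the maximum.\<close>

lemma codim_two_bound:
  assumes f: "HP (Suc e) f" and e: "1 \<le> e" "e < q" "q < e ^ 2"
    and V: "subspace V" "finite V" "subspace L" "L \<subseteq> V" "card V = q ^ 2 * card L"
    and zero: "\<And>x. x \<in> L \<Longrightarrow> f x = 0"
    and max: "\<And>S. subspace S \<Longrightarrow> S \<subseteq> V \<Longrightarrow> card S = q * card L \<Longrightarrow> \<exists>x\<in>S. f x \<noteq> 0"
  shows "int q ^ 2 * int (zeros f V) \<le>
    codim_two_coeff e * int (card L)"
proof -
  have finL: "finite L" using V finite_subset by blast
  obtain w where w: "w \<in> V - L" "q * zeros_at f w L \<noteq> e * card L"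
    using not_all_full[OF f e V] zero max by blast
  have max': "\<exists>x\<in>ext L u. f x \<noteq> 0" if "u \<in> V - L" for u
    using that V card_ext[OF V(3), of u] by (intro max subspace_ext ext_subset) auto
  have wL: "w \<notin> L" using w by blast
  define n where "n = zeros_at f w L"
  have n: "q ^ 2 * n + (e - 1) * card L \<le> e * q * card L"
    using residual_zeros(2)[OF f e(1,2) V(3) finL zero wL max'[OF w(1)]] w(2) unfolding n_def by blast
  define K where "K = ext L w"
  have K: "subspace K" "K \<subseteq> V" "L \<subseteq> K" "card K = q * card L"
    unfolding K_def using V w wL by (simp_all add: subspace_ext ext_subset card_ext subset_ext)
  have "{x \<in> L. f x = 0} = L" using zero by auto
  then have zK: "zeros f K = card L + (q - 1) * n"
    unfolding K_def n_def using card_zeros_ext[OF f V(3) finL wL] by simp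
  have rest: "q * zeros f (V - K) \<le> e * card (V - K)"
    using V(1,2) K(1,2) V(3) K(3)
  proof (rule pencil_le)
    fix u assume u: "u \<in> V - K"
    then have uL: "u \<in> V - L" "u \<notin> L" using K by auto
    show "q * zeros_at f u L \<le> e * card L"
      by (rule residual_zeros(1)[OF f e(1,2) V(3) finL zero uL(2) max'[OF uL(1)]])
  qed
  have cVK: "int (card (V - K)) = int q ^ 2 * int (card L) - int q * int (card L)"
    using pencil_count(3)[OF V(1,2) K(1,2)] V(5) K(4) by (simp flip: of_nat_power of_nat_mult)
  have z: "int (zeros f V) = int (card L) + (int q - 1) * int n + int (zeros f (V - K))"
    using pencil_count(2)[OF V(1,2) K(1,2), of f] zK q_pos by (simp add: of_nat_diff)
  have n': "int q ^ 2 * int n \<le> (int e * int q - (int e - 1)) * int (card L)"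
  proof -
    have "int (q ^ 2 * n + (e - 1) * card L) \<le> int (e * q * card L)" using n by (rule of_nat_mono)
    then show ?thesis using e(1) by (cases e) (simp_all add: algebra_simps)
  qed
  have "(int q - 1) * (int q ^ 2 * int n) \<le> (int q - 1) * ((int e * int q - (int e - 1)) * int (card L))"
    using n' q_pos by (intro mult_left_mono) auto
  moreover have "int q * int (zeros f (V - K)) \<le> int e * int (card (V - K))"
    using rest by (metis of_nat_le_iff of_nat_mult)
  then have "int q * (int q * int (zeros f (V - K))) \<le> int q * (int e * (int q ^ 2 * int (card L) - int q * int (card L)))"
    unfolding cVK by (intro mult_left_mono) auto
  ultimately show ?thesis unfolding z by (simp add: algebra_simps power2_eq_square power3_eq_cube)
qed

text \<open>The first bound charges every coset of \<open>L\<close> the maximum. For the second,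
  either all cosets show the gap of \<open>second_weight\<close>, or a full member \<open>K\<close>
  exists; then the deficit is found one dimension higher, since \<open>L\<close> has codimension two
  in every \<open>ext K x\<close>.\<close>

lemma no_hyperplane_bound:
  assumes f: "HP (Suc e) f" and e: "1 \<le> e" "e < q"
    and V: "subspace V" "finite V" "subspace L" "L \<subseteq> V" "q ^ 2 * card L \<le> card V"
    and zero: "\<And>x. x \<in> L \<Longrightarrow> f x = 0"
    and max: "\<And>S. subspace S \<Longrightarrow> S \<subseteq> V \<Longrightarrow> card S = q * card L \<Longrightarrow> \<exists>x\<in>S. f x \<noteq> 0"
  shows "int q ^ 3 * int (zeros f V) \<le> (int e * int q ^ 2 + int q - int e) * int (card V)"
    "q < e ^ 2 \<Longrightarrow> int q ^ 4 * int (zeros f V) \<le>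
      codim_two_coeff e * int (card V)"
proof -
  have finL: "finite L" using V finite_subset by blast
  have max': "\<exists>x\<in>ext L u. f x \<noteq> 0" if "u \<in> V - L" for u
    using that V card_ext[OF V(3), of u] by (intro max subspace_ext ext_subset) auto
  have Lz: "{x \<in> L. f x = 0} = L" using zero by auto
  have codim: "int q ^ 2 * int (card L) \<le> int (card V)"
    using V(5) by (metis of_nat_le_iff of_nat_mult of_nat_power)
  have cVL: "int (card (V - L)) = int (card V) - int (card L)"
    using pencil_count(3)[OF V(1-4)] by simp
  have z: "int (zeros f V) = int (card L) + int (zeros f (V - L))"
    using pencil_count(2)[OF V(1-4), of f] Lz by simp
  have "q * zeros f (V - L) \<le> e * card (V - L)"
  proof (rule pencil_le[OF V(1-4) V(3) order_refl])
    fix u assume u: "u \<in> V - L"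
    then have uL: "u \<notin> L" by blast
    show "q * zeros_at f u L \<le> e * card L"
      by (rule residual_zeros(1)[OF f e V(3) finL zero uL max'[OF u]])
  qed
  then have 1: "int q * int (zeros f (V - L)) \<le> int e * (int (card V) - int (card L))"
    unfolding cVL[symmetric] by (metis of_nat_le_iff of_nat_mult)
  have "int q * int (zeros f V) \<le> int e * int (card V) + (int q - int e) * int (card L)"
    unfolding z using 1 by (simp add: algebra_simps)
  then have "int q ^ 2 * (int q * int (zeros f V)) \<le> int q ^ 2 * (int e * int (card V) + (int q - int e) * int (card L))"
    by (rule mult_left_mono) simp
  also have "\<dots> = int e * int q ^ 2 * int (card V) + (int q - int e) * (int q ^ 2 * int (card L))"
    by (simp add: algebra_simps)
  also have "\<dots> \<le> int e * int q ^ 2 * int (card V) + (int q - int e) * int (card V)"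
    using codim e by (intro add_left_mono mult_left_mono) auto
  finally show "int q ^ 3 * int (zeros f V) \<le> (int e * int q ^ 2 + int q - int e) * int (card V)"
    by (simp add: algebra_simps power2_eq_square power3_eq_cube)
  \<comment> \<open>The coefficient left at \<open>card L\<close> (up to a power of
    \<open>q\<close>) in both cases below. As it is nonnegative, \<open>card L\<close> may be
    replaced by \<open>card V / q^2\<close>.\<close>
  define c where "c = int q ^ 2 - int e * int q + int e - 1"
  have "c = int q * (int q - int e) + (int e - 1)" unfolding c_def by (simp add: power2_eq_square algebra_simps)
  then have c0: "c \<ge> 0" using e by simp
  have cL: "c * (int q ^ 2 * int (card L)) \<le> c * int (card V)" using codim c0 by (rule mult_left_mono)
  show "int q ^ 4 * int (zeros f V) \<le>
      codim_two_coeff e * int (card V)" if e2: "q < e ^ 2"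
  proof (cases "\<exists>w\<in>V - L. q * zeros_at f w L = e * card L")
    case False
    have "q ^ 2 * zeros f (V - L) \<le> (e * q - (e - 1)) * card (V - L)"
    proof (rule pencil_le[OF V(1-4) V(3) order_refl])
      fix u assume u: "u \<in> V - L"
      then have uL: "u \<notin> L" by blast
      have "q ^ 2 * zeros_at f u L + (e - 1) * card L \<le> e * q * card L"
        using residual_zeros(2)[OF f e V(3) finL zero uL max'[OF u]] False u by blast
      then show "q ^ 2 * zeros_at f u L \<le> (e * q - (e - 1)) * card L"
        by (simp add: diff_mult_distrib)
    qed
    then have "int (q ^ 2 * zeros f (V - L)) \<le> int ((e * q - (e - 1)) * card (V - L))" by (rule of_nat_mono)
    moreover have "e - 1 \<le> e * q"
    proof -
      have "e * 1 \<le> e * q" using q_pos by (intro mult_le_mono2) simp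
      then show ?thesis by linarith
    qed
    then have coef: "int (e * q - (e - 1)) = int e * int q - int e + 1" using e(1) by (simp add: of_nat_diff)
    ultimately have 2: "int q ^ 2 * int (zeros f (V - L)) \<le> (int e * int q - int e + 1) * (int (card V) - int (card L))"
      unfolding cVL[symmetric] of_nat_mult coef by simp
    have "int q ^ 2 * int (zeros f V) \<le> (int e * int q - int e + 1) * int (card V) + c * int (card L)"
      unfolding z c_def using 2 by (simp add: algebra_simps)
    then have "int q ^ 2 * (int q ^ 2 * int (zeros f V)) \<le>
      int q ^ 2 * ((int e * int q - int e + 1) * int (card V) + c * int (card L))" by (rule mult_left_mono) simp
    also have "\<dots> = int q ^ 2 * (int e * int q - int e + 1) * int (card V) + c * (int q ^ 2 * int (card L))"
      by (simp add: algebra_simps)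
    also have "\<dots> \<le> int q ^ 2 * (int e * int q - int e + 1) * int (card V) + c * int (card V)"
      using cL by simp
    also have "\<dots> = codim_two_coeff e * int (card V)
        - (int e - 1) * int q * (int q - 1) * int (card V)"
      unfolding c_def by (simp add: algebra_simps power2_eq_square power3_eq_cube)
    also have "\<dots> \<le> codim_two_coeff e * int (card V)"
      using e q_pos by simp
    finally show ?thesis by (simp add: power4_eq_xxxx power2_eq_square mult.assoc)
  next
    case True
    then obtain w where w: "w \<in> V - L" "q * zeros_at f w L = e * card L" by blast
    have wL: "w \<notin> L" using w by blast
    define K where "K = ext L w"
    have K: "subspace K" "K \<subseteq> V" "L \<subseteq> K" "card K = q * card L" "finite K"
      unfolding K_def using V w wL finL by (simp_all add: subspace_ext ext_subset card_ext subset_ext finite_ext)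
    have zK: "int q * int (zeros f K) = (int q + int e * (int q - 1)) * int (card L)"
    proof -
      have A: "int q * int (zeros_at f w L) = int e * int (card L)" using w(2) by (metis of_nat_mult)
      have B: "int (zeros f K) = int (card L) + (int q - 1) * int (zeros_at f w L)"
        unfolding K_def using card_zeros_ext[OF f V(3) finL wL] Lz q_pos by (simp add: of_nat_diff)
      have "int q * int (zeros f K) =
        int q * int (card L) + (int q - 1) * (int q * int (zeros_at f w L))"
        unfolding B by (simp add: algebra_simps)
      then show ?thesis unfolding A by (simp add: algebra_simps)
    qed
    \<comment> \<open>Subtracting the exact count on the full member \<open>K\<close> from
      \<open>codim_two_bound\<close> leaves a multiple of \<open>q - 1\<close>, the number of
      nontrivial cosets of \<open>K\<close> in \<open>ext K x\<close>.\<close>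
    have nx: "int q ^ 3 * int (zeros_at f x K) \<le> (int e * int q ^ 2 - int e + 1) * int (card K)"
      if x: "x \<in> V - K" for x
    proof -
      have xK: "x \<notin> K" using x by blast
      have P: "subspace (ext K x)" "finite (ext K x)" "L \<subseteq> ext K x" "card (ext K x) = q ^ 2 * card L" "ext K x \<subseteq> V"
        using K x V subset_trans[OF K(3) subset_ext] by (simp_all add: subspace_ext finite_ext card_ext power2_eq_square ext_subset)
      have maxP: "\<exists>y\<in>S. f y \<noteq> 0" if "subspace S" "S \<subseteq> ext K x" "card S = q * card L" for S
        using max[OF that(1) subset_trans[OF that(2) P(5)] that(3)] .
      have "int q ^ 2 * int (zeros f (ext K x)) \<le>
        codim_two_coeff e * int (card L)"
        by (rule codim_two_bound[OF f e e2 P(1,2) V(3) P(3,4) zero maxP])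
      moreover have "int (zeros f (ext K x)) = int (zeros f K) + (int q - 1) * int (zeros_at f x K)"
        using card_zeros_ext[OF f K(1,5) xK] q_pos by (simp add: of_nat_diff)
      moreover have "int q ^ 2 * int (zeros f K) = int q * ((int q + int e * (int q - 1)) * int (card L))"
        unfolding zK[symmetric] by (simp add: power2_eq_square)
      ultimately have "int q ^ 2 * ((int q - 1) * int (zeros_at f x K)) \<le>
        codim_two_coeff e * int (card L) - int q * ((int q + int e * (int q - 1)) * int (card L))"
        by (simp add: distrib_left)
      then have "(int q - 1) * (int q ^ 2 * int (zeros_at f x K)) \<le>
        (int q - 1) * ((int e * int q ^ 2 - int e + 1) * int (card L))"
        by (simp add: algebra_simps power2_eq_square power3_eq_cube)
      then have "int q ^ 2 * int (zeros_at f x K) \<le> (int e * int q ^ 2 - int e + 1) * int (card L)"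
        using q_ge_2 by simp
      then have "int q * (int q ^ 2 * int (zeros_at f x K)) \<le> int q * ((int e * int q ^ 2 - int e + 1) * int (card L))"
        by (rule mult_left_mono) simp
      then show ?thesis using K(4) by (simp add: power2_eq_square power3_eq_cube algebra_simps)
    qed
    have nonneg: "e - 1 \<le> e * q ^ 2"
    proof -
      have "e * 1 \<le> e * q ^ 2" using q_pos by (intro mult_le_mono2) simp
      then show ?thesis by linarith
    qed
    have coef: "int (e * q ^ 2 - (e - 1)) = int e * int q ^ 2 - int e + 1"
      using nonneg e(1) by (simp add: of_nat_diff)
    have "q ^ 3 * zeros f (V - K) \<le> (e * q ^ 2 - (e - 1)) * card (V - K)"
    proof (rule pencil_le[OF V(1,2) K(1,2,1) order_refl])
      fix u assume u: "u \<in> V - K"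
      have "int (q ^ 3 * zeros_at f u K) \<le> int ((e * q ^ 2 - (e - 1)) * card K)"
        unfolding of_nat_mult coef using nx[OF u] by simp
      then show "q ^ 3 * zeros_at f u K \<le> (e * q ^ 2 - (e - 1)) * card K" by (simp only: of_nat_le_iff)
    qed
    then have "int (q ^ 3 * zeros f (V - K)) \<le> int ((e * q ^ 2 - (e - 1)) * card (V - K))" by (rule of_nat_mono)
    then have 3: "int q ^ 3 * int (zeros f (V - K)) \<le> (int e * int q ^ 2 - int e + 1) * int (card (V - K))"
      unfolding of_nat_mult coef by simp
    have cVK: "int (card (V - K)) = int (card V) - int q * int (card L)"
      using pencil_count(3)[OF V(1,2) K(1,2)] K(4) by simp
    have zz: "int (zeros f V) = int (zeros f K) + int (zeros f (V - K))"
      using pencil_count(2)[OF V(1,2) K(1,2), of f] by simp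
    have "int q ^ 3 * int (zeros f V) =
      int q ^ 2 * (int q * int (zeros f K)) + int q ^ 3 * int (zeros f (V - K))"
      unfolding zz by (simp add: algebra_simps power2_eq_square power3_eq_cube)
    also have "\<dots> \<le> int q ^ 2 * ((int q + int e * (int q - 1)) * int (card L)) + (int e * int q ^ 2 - int e + 1) * (int (card V) - int q * int (card L))"
      unfolding zK using 3 unfolding cVK by simp
    also have "\<dots> = (int e * int q ^ 2 - int e + 1) * int (card V) + c * (int q * int (card L))"
      unfolding c_def by (simp add: algebra_simps power2_eq_square power3_eq_cube)
    finally have "int q * (int q ^ 3 * int (zeros f V)) \<le>
      int q * ((int e * int q ^ 2 - int e + 1) * int (card V) + c * (int q * int (card L)))"
      by (rule mult_left_mono) simp
    also have "\<dots> = int q * (int e * int q ^ 2 - int e + 1) * int (card V) + c * (int q ^ 2 * int (card L))"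
      by (simp add: algebra_simps power2_eq_square)
    also have "\<dots> \<le> int q * (int e * int q ^ 2 - int e + 1) * int (card V) + c * int (card V)" using cL by simp
    also have "\<dots> = codim_two_coeff e * int (card V)"
      unfolding c_def by (simp add: algebra_simps power2_eq_square power3_eq_cube)
    finally show ?thesis by (simp add: power4_eq_xxxx power3_eq_cube mult.assoc)
  qed
qed

text \<open>The affine factors of the residual on \<open>w + H\<close> are homogenised by the form
  \<open>h\<close> that cuts out \<open>H\<close>, and \<open>h\<close> itself is the additional
  factor.\<close>

lemma splits_into_linear_forms:
  assumes f: "HP (Suc e) f" and e: "e < q" and V: "subspace V" "finite V" "subspace H" "H \<subseteq> V" "w \<in> V" "w \<notin> H"
    "card V = q * card H" and zero: "\<And>x. x \<in> H \<Longrightarrow> f x = 0" and ex: "\<exists>x\<in>V. f x \<noteq> 0"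
    and big: "e * q ^ 2 * card H + q * card H \<le> (q - 1) * q ^ 2 * zeros_at f w H + e * card H + q ^ 2 * card H"
  shows "\<exists>c A. length A = Suc e \<and> (\<forall>l\<in>set A. lf l) \<and> (\<forall>x\<in>V. f x = c * (\<Prod>l\<leftarrow>A. l x))"
proof -
  have finH: "finite H" using V finite_subset by blast
  have ext: "ext H w = V" by (rule ext_eq_if_card[OF V(3,1,2,4,5,6,7)])
  obtain g where g: "PF e g" "\<forall>y\<in>H. f (w + y) = g y" by (rule HP_translate_residual[OF f V(3) zero V(6)])
  have n: "zeros_at f w H = zeros g H" using g(2) by (intro arg_cong[of _ _ card]) auto
  have "\<exists>y\<in>H. f (w + y) \<noteq> 0" using HP_residual_nonzero[OF f V(3), of w] zero ex unfolding ext by blast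
  then have gex: "\<exists>y\<in>H. g y \<noteq> 0" using g(2) by auto
  obtain c A where A: "length A = e" "\<forall>(l, b)\<in>set A. lf l" "\<forall>y\<in>H. g y = c * (\<Prod>(l, b)\<leftarrow>A. l y + b)"
    using splits_into_affine_factors[OF V(3) finH g(1) gex e] big unfolding n by blast
  obtain h where h: "lf h" "h w = 1" "\<forall>x\<in>H. h x = 0" by (rule lf_exists[OF V(3,6)])
  \<comment> \<open>The constant \<open>b\<close> becomes a multiple of \<open>h\<close>; the
    correction \<open>- l w\<close> is needed because \<open>l\<close> may be nonzero at
    \<open>w\<close>, so that the form takes the value \<open>l y + b\<close> at
    \<open>w + y\<close>.\<close>
  define lin where "lin = (\<lambda>(l, b) x. 1 * l x + (b - l w) * h x)"
  have lin_lf: "lf (lin p)" if "p \<in> set A" for p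
  proof -
    obtain l b where p: "p = (l, b)" by fastforce
    then have "lf l" using A(2) that by auto
    then show ?thesis unfolding p lin_def using lf_comb[OF _ h(1), of l 1 "b - l w"] by simp
  qed
  have "f x = c * (\<Prod>l\<leftarrow>h # map lin A. l x)" if "x \<in> V" for x
  proof -
    have "x \<in> ext H w" using that ext by simp
    then obtain y t where yt: "y \<in> H" "x = y + t *s w" by (rule extE)
    have hx: "h x = t" using yt h by (simp add: lf_simps)
    show ?thesis
    proof (cases "t = 0")
      case True
      then show ?thesis using hx yt zero by simp
    next
      case False
      then have "x = t *s (w + inverse t *s y)" using yt by (simp add: scale_right_distrib add.commute)
      then have "f x = t ^ Suc e * f (w + inverse t *s y)" using HP_homogeneous[OF f] by simp
      also have "f (w + inverse t *s y) = c * (\<Prod>(l, b)\<leftarrow>A. l (inverse t *s y) + b)"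
        using g(2) A(3) yt V(3) by (simp add: subspace_scale)
      also have "t ^ Suc e * (c * (\<Prod>(l, b)\<leftarrow>A. l (inverse t *s y) + b)) = c * (t * (t ^ length A * (\<Prod>(l, b)\<leftarrow>A. l (inverse t *s y) + b)))"
        using A(1) by simp
      also have "t ^ length A * (\<Prod>(l, b)\<leftarrow>A. l (inverse t *s y) + b) = (\<Prod>p\<leftarrow>A. lin p x)"
        using A(2)
      proof (induction A)
        case (Cons p A)
        obtain l b where p: "p = (l, b)" by fastforce
        have l: "lf l" using Cons.prems p by simp
        have "t * (l (inverse t *s y) + b) = lin p x"
          unfolding p lin_def using yt hx l False by (simp add: lf_simps field_simps)
        moreover have "t ^ length A * (\<Prod>(l, b)\<leftarrow>A. l (inverse t *s y) + b) = (\<Prod>p\<leftarrow>A. lin p x)"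
          using Cons by simp
        moreover have "t ^ length (p # A) * (\<Prod>(l, b)\<leftarrow>p # A. l (inverse t *s y) + b) =
          (t * (l (inverse t *s y) + b)) * (t ^ length A * (\<Prod>(l, b)\<leftarrow>A. l (inverse t *s y) + b))"
          unfolding p by simp
        ultimately show ?case by simp
      qed simp
      finally show ?thesis using hx by (simp add: comp_def)
    qed
  qed
  then show ?thesis using A(1) lin_lf h(1) by (intro exI[of _ c] exI[of _ "h # map lin A"]) auto
qed

text \<open>Hypothesis \<open>small\<close> is the projective hypothesis rewritten for vectors. Its
  right side is the count of a zero hyperplane with full residual, so in the hyperplane case the gap
  of \<open>second_weight\<close> must apply.\<close>

theorem hypersurface_zero_count:
  assumes f: "HP (Suc e) f" and e: "2 \<le> e" "e < q" and V: "subspace V" "finite V"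
  defines "z \<equiv> int (zeros f V)" and "v \<equiv> int (card V)"
  assumes small: "int q ^ 2 * z < ((int e + 1) * int q - int e) * v"
  shows "2 * e \<le> q + 1 \<Longrightarrow> int q ^ 3 * z \<le> linear_coeff e * v"
    "2 * e \<le> q + 1 \<Longrightarrow> int q ^ 3 * z = linear_coeff e * v \<Longrightarrow>
      \<exists>c A. length A = Suc e \<and> (\<forall>l\<in>set A. lf l) \<and> (\<forall>x\<in>V. f x = c * (\<Prod>l\<leftarrow>A. l x))"
    "q + 1 < 2 * e \<Longrightarrow> int q ^ 4 * z \<le> codim_two_coeff e * v"
proof -
  have e1: "1 \<le> e" using e by simp
  have v0: "v > 0" unfolding v_def using card_subspace_pos[OF V] by simp
  have ex: "\<exists>x\<in>V. f x \<noteq> 0"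
  proof (rule ccontr)
    assume "\<not> ?thesis"
    then have "{x \<in> V. f x = 0} = V" by auto
    then have "int q ^ 2 * v < ((int e + 1) * int q - int e) * v" using small unfolding z_def v_def by simp
    then have "int q ^ 2 < (int e + 1) * int q - int e" using v0 by simp
    moreover have "int q ^ 2 - ((int e + 1) * int q - int e) = (int q - 1) * (int q - int e)"
      by (simp add: algebra_simps power2_eq_square)
    moreover have "(int q - 1) * (int q - int e) \<ge> 0" using e by simp
    ultimately show False by linarith
  qed
  have f0: "f 0 = 0" by (rule HP_at_zero[OF f])
  obtain L where L: "subspace L" "L \<subseteq> V" "\<forall>x\<in>L. f x = 0"
    "\<And>T. subspace T \<Longrightarrow> T \<subseteq> V \<Longrightarrow> \<forall>x\<in>T. f x = 0 \<Longrightarrow> card T \<le> card L"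
    using exists_maximal_subspace[OF V(2,1), of "\<lambda>M. \<forall>x\<in>M. f x = 0"] f0 by auto
  have finL: "finite L" using L V finite_subset by blast
  have cL: "card L > 0" using card_subspace_pos[OF L(1) finL] .
  have zero: "f x = 0" if "x \<in> L" for x using L(3) that by blast
  have LV: "L \<noteq> V" using ex L(3) by blast
  consider (hyp) "card V = q * card L" | (nohyp) "q ^ 2 * card L \<le> card V"
    using card_subspace_cases[OF L(1) V L(2) LV] by blast
  then have "(2 * e \<le> q + 1 \<longrightarrow> int q ^ 3 * z \<le> linear_coeff e * v \<and>
    (int q ^ 3 * z = linear_coeff e * v \<longrightarrow>
      (\<exists>c A. length A = Suc e \<and> (\<forall>l\<in>set A. lf l) \<and> (\<forall>x\<in>V. f x = c * (\<Prod>l\<leftarrow>A. l x))))) \<and>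
    (q + 1 < 2 * e \<longrightarrow> int q ^ 4 * z \<le> codim_two_coeff e * v)"
  proof cases
    case nohyp
    have max: "\<exists>x\<in>S. f x \<noteq> 0" if "subspace S" "S \<subseteq> V" "card S = q * card L" for S
    proof (rule ccontr)
      assume "\<not> ?thesis"
      then have "card S \<le> card L" using L(4) that by blast
      moreover have "1 * card L < q * card L" using cL q_ge_2 by (intro mult_strict_right_mono) auto
      ultimately show False using that(3) by simp
    qed
    have b1: "int q ^ 3 * z \<le> (int e * int q ^ 2 + int q - int e) * v"
      unfolding z_def v_def by (rule no_hyperplane_bound(1)[OF f e1 e(2) V L(1,2) nohyp zero max])
    have b2: "q < e ^ 2 \<Longrightarrow> int q ^ 4 * z \<le> codim_two_coeff e * v"
      unfolding z_def v_def by (rule no_hyperplane_bound(2)[OF f e1 e(2) V L(1,2) nohyp zero max])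
    \<comment> \<open>\<open>4 * q < (q + 1)^2 \<le> 4 * e^2\<close>, the first inequality because
      \<open>q > 1\<close>.\<close>
    have sq: "q < e ^ 2" if "q + 1 \<le> 2 * e"
    proof -
      have "(q + 1) ^ 2 \<le> (2 * e) ^ 2" using that by (rule power_mono) simp
      moreover have "4 * q < (q + 1) ^ 2"
      proof -
        obtain p where "q = 2 + p" using q_ge_2 le_Suc_ex by blast
        then show ?thesis by (simp add: power2_eq_square)
      qed
      ultimately show ?thesis by (simp add: power_mult_distrib)
    qed
    define a where "a = linear_coeff e"
    have diff: "a - (int e * int q ^ 2 + int q - int e) = (int q - 1) * (int q + 1 - 2 * int e)"
      unfolding a_def by (simp add: algebra_simps power2_eq_square)
    \<comment> \<open>Strictness shows that equality in (a) never occurs without a zero hyperplane.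
      For \<open>2 * e < q + 1\<close> it comes from \<open>diff\<close>; at
      \<open>2 * e = q + 1\<close> the two coefficients coincide and the finer codimension-two bound
      is required.\<close>
    have "int q ^ 3 * z < a * v" if e2: "2 * e \<le> q + 1"
    proof (cases "2 * e = q + 1")
      case False
      then have "(int q - 1) * (int q + 1 - 2 * int e) > 0" using e2 q_ge_2 by (intro mult_pos_pos) auto
      then have "(int e * int q ^ 2 + int q - int e) * v < a * v" using diff v0 by (intro mult_strict_right_mono) auto
      then show ?thesis using b1 by linarith
    next
      case True
      then have "int q + 1 - 2 * int e = 0" by simp
      then have a: "a = int e * int q ^ 2 + int q - int e" using diff by simp
      have "int q ^ 4 * z \<le> codim_two_coeff e * v"
        using b2 sq True by simp
      also have "\<dots> = int q * (a * v) - (int q - 1) * (int e - 1) * v"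
        unfolding a by (simp add: algebra_simps power2_eq_square power3_eq_cube)
      also have "\<dots> < int q * (a * v)" using v0 e q_ge_2 by simp
      finally have "int q * (int q ^ 3 * z) < int q * (a * v)" by (simp add: power4_eq_xxxx power3_eq_cube mult.assoc)
      then show ?thesis using q_pos by simp
    qed
    then show ?thesis using b2 sq unfolding a_def[symmetric] by auto
  next
    case hyp
    obtain w where w: "w \<in> V" "w \<notin> L" using LV L by blast
    have ext: "ext L w = V" by (rule ext_eq_if_card[OF L(1) V L(2) w hyp])
    define n where "n = zeros_at f w L"
    define h where "h = int (card L)"
    have h0: "h > 0" unfolding h_def using cL by simp
    have vh: "v = int q * h" unfolding v_def h_def using hyp by simp
    have "{x \<in> L. f x = 0} = L" using zero by auto
    then have zn: "z = h + (int q - 1) * int n"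
      using card_zeros_ext[OF f L(1) finL w(2)] q_pos unfolding z_def h_def n_def ext by (simp add: of_nat_diff)
    have "q * n \<noteq> e * card L"
    proof
      assume "q * n = e * card L"
      then have "int q * int n = int e * h" unfolding h_def by (metis of_nat_mult)
      then have "int q * z = int q * h + (int q - 1) * (int e * h)" unfolding zn by (simp add: algebra_simps)
      then have "int q * (int q * z) = int q * (int q * h + (int q - 1) * (int e * h))" by (rule arg_cong)
      also have "\<dots> = ((int e + 1) * int q - int e) * v" unfolding vh by (simp add: algebra_simps)
      finally have "int q * (int q * z) = ((int e + 1) * int q - int e) * v" .
      then show False using small by (simp add: power2_eq_square mult.assoc)
    qed
    moreover have "\<exists>x\<in>ext L w. f x \<noteq> 0" using ex ext by simp
    ultimately have "q ^ 2 * n + (e - 1) * card L \<le> e * q * card L"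
      using residual_zeros(2)[OF f e1 e(2) L(1) finL zero w(2)] unfolding n_def by blast
    then have "int (q ^ 2 * n + (e - 1) * card L) \<le> int (e * q * card L)" by (rule of_nat_mono)
    then have n: "int q ^ 2 * int n \<le> (int e * int q - int e + 1) * h"
      using e unfolding h_def by (cases e) (simp_all add: algebra_simps)
    define a where "a = linear_coeff e"
    have qz: "int q ^ 3 * z = int q * (int q ^ 2 * h + (int q - 1) * (int q ^ 2 * int n))"
      unfolding zn by (simp add: algebra_simps power2_eq_square power3_eq_cube)
    have av: "a * v = int q * (int q ^ 2 * h + (int q - 1) * ((int e * int q - int e + 1) * h))"
      unfolding a_def vh by (simp add: algebra_simps power2_eq_square power3_eq_cube)
    have bound: "int q ^ 3 * z \<le> a * v"
      unfolding qz av using n q_pos by (intro mult_left_mono add_left_mono) auto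
    \<comment> \<open>Equality pins the residual count to the second weight. This meets the
      threshold for splitting into affine factors, with surplus
      \<open>(q - 1) * (q + 1 - 2 * e)\<close> times \<open>card L\<close>; here the range of (a)
      enters.\<close>
    have split: "\<exists>c A. length A = Suc e \<and> (\<forall>l\<in>set A. lf l) \<and> (\<forall>x\<in>V. f x = c * (\<Prod>l\<leftarrow>A. l x))"
      if e2: "2 * e \<le> q + 1" and eq: "int q ^ 3 * z = a * v"
    proof (rule splits_into_linear_forms[OF f e(2) V L(1,2) w hyp zero ex])
      have "(int q - 1) * (int q ^ 2 * int n) = (int q - 1) * ((int e * int q - int e + 1) * h)"
        using eq q_pos unfolding qz av by simp
      moreover have "(int q - 1) * ((int e * int q - int e + 1) * h) - (int e * int q ^ 2 + int q - int e - int q ^ 2) * h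
        = (int q - 1) * (int q + 1 - 2 * int e) * h"
        by (simp add: algebra_simps power2_eq_square)
      moreover have "(int q - 1) * (int q + 1 - 2 * int e) * h \<ge> 0" using e2 q_pos h0 by simp
      ultimately have "(int e * int q ^ 2 + int q - int e - int q ^ 2) * h \<le> (int q - 1) * (int q ^ 2 * int n)"
        by linarith
      then have "int e * int q ^ 2 * h + int q * h \<le> (int q - 1) * (int q ^ 2 * int n) + int e * h + int q ^ 2 * h"
        unfolding left_diff_distrib[of _ _ h] distrib_right[of _ _ h] by linarith
      then have "int (e * q ^ 2 * card L + q * card L) \<le> int ((q - 1) * q ^ 2 * n + e * card L + q ^ 2 * card L)"
        using q_pos unfolding h_def by (simp add: of_nat_diff mult.assoc)
      then show "e * q ^ 2 * card L + q * card L \<le> (q - 1) * q ^ 2 * zeros_at f w L + e * card L + q ^ 2 * card L"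
        unfolding n_def by (simp only: of_nat_le_iff)
    qed
    \<comment> \<open>Beyond the threshold the hyperplane bound is the smaller one, since
      \<open>2 * e - 1 - q \<ge> 1\<close> and \<open>q \<ge> e - 1\<close>.\<close>
    have "int q ^ 4 * z \<le> codim_two_coeff e * v" if e2: "q + 1 < 2 * e"
    proof -
      have "int q ^ 4 * z = int q * (int q ^ 3 * z)" by (simp add: power4_eq_xxxx power3_eq_cube mult.assoc)
      also have "\<dots> \<le> int q * (a * v)" using bound by (intro mult_left_mono) auto
      also have "\<dots> = codim_two_coeff e * v
        - ((int q - 1) * (int q * (2 * int e - 1 - int q) - (int e - 1))) * v"
        unfolding a_def by (simp add: algebra_simps power2_eq_square power3_eq_cube)
      also have "\<dots> \<le> codim_two_coeff e * v"
      proof -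
        have "int q * 1 \<le> int q * (2 * int e - 1 - int q)" using e2 by (intro mult_left_mono) auto
        then have "int q * (2 * int e - 1 - int q) - (int e - 1) \<ge> 0" using e by linarith
        then show ?thesis using q_pos v0 by simp
      qed
      finally show ?thesis .
    qed
    then show ?thesis using bound split unfolding a_def by blast
  qed
  then show "2 * e \<le> q + 1 \<Longrightarrow> int q ^ 3 * z \<le> linear_coeff e * v"
    "2 * e \<le> q + 1 \<Longrightarrow> int q ^ 3 * z = linear_coeff e * v \<Longrightarrow>
      \<exists>c A. length A = Suc e \<and> (\<forall>l\<in>set A. lf l) \<and> (\<forall>x\<in>V. f x = c * (\<Prod>l\<leftarrow>A. l x))"
    "q + 1 < 2 * e \<Longrightarrow> int q ^ 4 * z \<le> codim_two_coeff e * v"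
    by blast+
qed

end

section \<open>Formal multivariate polynomials and their evaluation\<close>

abbreviation "lookup \<equiv> Poly_Mapping.lookup"
abbreviation "keys \<equiv> Poly_Mapping.keys"
abbreviation "single \<equiv> Poly_Mapping.single"

definition mon_eval :: "(nat \<Rightarrow>\<^sub>0 nat) \<Rightarrow> (nat \<Rightarrow> 'a::comm_semiring_1) \<Rightarrow> 'a" where
  "mon_eval \<alpha> x = (\<Prod>i\<in>keys \<alpha>. x i ^ lookup \<alpha> i)"

lemma mon_eval_superset:
  assumes "finite I" "keys \<alpha> \<subseteq> I"
  shows "mon_eval \<alpha> x = (\<Prod>i\<in>I. x i ^ lookup \<alpha> i)"
  unfolding mon_eval_def using assms by (intro prod.mono_neutral_left) (auto simp: in_keys_iff)

lemma mon_deg_superset: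
  assumes "finite I" "keys \<alpha> \<subseteq> I"
  shows "mon_deg \<alpha> = (\<Sum>i\<in>I. lookup \<alpha> i)"
  unfolding mon_deg_def using assms by (intro sum.mono_neutral_left) (auto simp: in_keys_iff)

lemma mon_eval_add: "mon_eval (\<alpha> + \<beta>) x = mon_eval \<alpha> x * mon_eval \<beta> x"
proof -
  let ?I = "keys \<alpha> \<union> keys \<beta>"
  have "mon_eval (\<alpha> + \<beta>) x = (\<Prod>i\<in>?I. x i ^ lookup (\<alpha> + \<beta>) i)"
    using keys_add[of \<alpha> \<beta>] by (intro mon_eval_superset) auto
  also have "\<dots> = (\<Prod>i\<in>?I. x i ^ lookup \<alpha> i) * (\<Prod>i\<in>?I. x i ^ lookup \<beta> i)"
    by (simp add: lookup_add power_add prod.distrib)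
  finally show ?thesis using mon_eval_superset[of ?I \<alpha> x] mon_eval_superset[of ?I \<beta> x] by simp
qed

lemma mon_deg_add: "mon_deg (\<alpha> + \<beta>) = mon_deg \<alpha> + mon_deg \<beta>"
proof -
  let ?I = "keys \<alpha> \<union> keys \<beta>"
  have "mon_deg (\<alpha> + \<beta>) = (\<Sum>i\<in>?I. lookup (\<alpha> + \<beta>) i)"
    using keys_add[of \<alpha> \<beta>] by (intro mon_deg_superset) auto
  then show ?thesis using mon_deg_superset[of ?I \<alpha>] mon_deg_superset[of ?I \<beta>]
    by (simp add: lookup_add sum.distrib)
qed

lemma eval_mpoly_superset:
  assumes "finite K" "keys F \<subseteq> K"
  shows "eval_mpoly F x = (\<Sum>\<alpha>\<in>K. lookup F \<alpha> * mon_eval \<alpha> x)"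
  unfolding eval_mpoly_def mon_eval_def[symmetric] using assms
  by (intro sum.mono_neutral_left) (auto simp: in_keys_iff)

lemma eval_mpoly_add: "eval_mpoly (F + G) x = eval_mpoly F x + eval_mpoly G x"
proof -
  let ?K = "keys F \<union> keys G"
  have "eval_mpoly (F + G) x = (\<Sum>\<alpha>\<in>?K. lookup (F + G) \<alpha> * mon_eval \<alpha> x)"
    using keys_add[of F G] by (intro eval_mpoly_superset) auto
  then show ?thesis using eval_mpoly_superset[of ?K F x] eval_mpoly_superset[of ?K G x]
    by (simp add: lookup_add distrib_right sum.distrib)
qed

lemma eval_mpoly_zero [simp]: "eval_mpoly 0 x = 0"
  by (simp add: eval_mpoly_def)

lemma eval_mpoly_sum: "eval_mpoly (sum F I) x = (\<Sum>i\<in>I. eval_mpoly (F i) x)"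
  by (induction I rule: infinite_finite_induct) (auto simp: eval_mpoly_add)

lemma eval_mpoly_single: "eval_mpoly (single \<alpha> c) x = c * mon_eval \<alpha> x"
  by (simp add: eval_mpoly_def mon_eval_def)

lemma eval_mpoly_diff:
  fixes F G :: "'a::comm_ring_1 mpoly"
  shows "eval_mpoly (F - G) x = eval_mpoly F x - eval_mpoly G x"
  using eval_mpoly_add[of "F - G" G x] by simp

lemma mpoly_sum_monomials: "F = (\<Sum>\<alpha>\<in>keys F. single \<alpha> (lookup F \<alpha>))"
proof (rule poly_mapping_eqI)
  fix \<beta>
  have "lookup (\<Sum>\<alpha>\<in>keys F. single \<alpha> (lookup F \<alpha>)) \<beta> = (\<Sum>\<alpha>\<in>keys F. if \<alpha> = \<beta> then lookup F \<alpha> else 0)"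
    unfolding lookup_sum by (rule sum.cong) (auto simp: lookup_single when_def)
  then show "lookup F \<beta> = lookup (\<Sum>\<alpha>\<in>keys F. single \<alpha> (lookup F \<alpha>)) \<beta>"
    by (simp add: in_keys_iff)
qed

lemma eval_mpoly_mult: "eval_mpoly (F * G) x = eval_mpoly F x * eval_mpoly G x"
proof -
  have "F * G = (\<Sum>\<alpha>\<in>keys F. single \<alpha> (lookup F \<alpha>)) * (\<Sum>\<beta>\<in>keys G. single \<beta> (lookup G \<beta>))"
    using mpoly_sum_monomials[of F] mpoly_sum_monomials[of G] by simp
  also have "\<dots> = (\<Sum>\<alpha>\<in>keys F. \<Sum>\<beta>\<in>keys G. single (\<alpha> + \<beta>) (lookup F \<alpha> * lookup G \<beta>))"
    by (simp add: sum_product mult_single)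
  finally have "eval_mpoly (F * G) x =
      (\<Sum>\<alpha>\<in>keys F. \<Sum>\<beta>\<in>keys G. (lookup F \<alpha> * lookup G \<beta>) * mon_eval (\<alpha> + \<beta>) x)"
    by (simp only: eval_mpoly_sum eval_mpoly_single)
  also have "\<dots> = (\<Sum>\<alpha>\<in>keys F. \<Sum>\<beta>\<in>keys G. (lookup F \<alpha> * mon_eval \<alpha> x) * (lookup G \<beta> * mon_eval \<beta> x))"
    by (simp add: mon_eval_add mult_ac)
  also have "\<dots> = eval_mpoly F x * eval_mpoly G x"
    by (simp add: sum_product eval_mpoly_def mon_eval_def)
  finally show ?thesis .
qed

lemma eval_mpoly_one: "eval_mpoly 1 x = 1"
  unfolding single_one[symmetric] eval_mpoly_single by (simp add: mon_eval_def)

lemma eval_mpoly_prod_list: "eval_mpoly (prod_list Fs) x = (\<Prod>F\<leftarrow>Fs. eval_mpoly F x)"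
  by (induction Fs) (auto simp: eval_mpoly_one eval_mpoly_mult)

text \<open>\<open>homog_poly\<close> without the condition of being nonzero, so that it is closed
  under differences and sums.\<close>

definition homog_keys :: "nat \<Rightarrow> nat \<Rightarrow> 'a::zero mpoly \<Rightarrow> bool" where
  "homog_keys m d F \<longleftrightarrow> (\<forall>\<alpha>\<in>keys F. mon_deg \<alpha> = d \<and> keys \<alpha> \<subseteq> {0..m})"

lemma homog_poly_iff: "homog_poly m d F \<longleftrightarrow> F \<noteq> 0 \<and> homog_keys m d F"
  by (simp add: homog_poly_def homog_keys_def)

lemma homog_keys_diff:
  fixes F G :: "'a::comm_ring_1 mpoly"
  shows "homog_keys m d F \<Longrightarrow> homog_keys m d G \<Longrightarrow> homog_keys m d (F - G)"
  unfolding homog_keys_def using keys_diff[of F G] by blast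

lemma homog_keys_sum: "(\<And>i. i \<in> I \<Longrightarrow> homog_keys m d (F i)) \<Longrightarrow> homog_keys m d (sum F I)"
  unfolding homog_keys_def using keys_sum[of F I] by blast

lemma homog_keys_mult:
  assumes "homog_keys m d F" "homog_keys m e G" shows "homog_keys m (d + e) (F * G)"
  unfolding homog_keys_def
proof
  fix \<gamma> assume "\<gamma> \<in> keys (F * G)"
  then obtain \<alpha> \<beta> where ab: "\<gamma> = \<alpha> + \<beta>" "\<alpha> \<in> keys F" "\<beta> \<in> keys G" using keys_mult[of F G] by blast
  then show "mon_deg \<gamma> = d + e \<and> keys \<gamma> \<subseteq> {0..m}"
    using assms keys_add[of \<alpha> \<beta>] unfolding homog_keys_def by (fastforce simp: mon_deg_add)
qed

lemma homog_keys_const: "homog_keys m 0 (single 0 c)"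
  unfolding homog_keys_def by (auto simp: mon_deg_def)

lemma homog_keys_prod_list:
  fixes Fs :: "'a::comm_semiring_1 mpoly list"
  shows "\<forall>F\<in>set Fs. homog_keys m 1 F \<Longrightarrow> homog_keys m (length Fs) (prod_list Fs)"
proof (induction Fs)
  case Nil
  then show ?case using homog_keys_const[of m "1 :: 'a"] by (simp add: single_one)
next
  case (Cons F Fs)
  then show ?case using homog_keys_mult[of m 1 F "length Fs" "prod_list Fs"] by simp
qed

subsection \<open>Coordinate space\<close>

definition coord_scale :: "'a::times \<Rightarrow> (nat \<Rightarrow> 'a) \<Rightarrow> nat \<Rightarrow> 'a" where
  "coord_scale c x = (\<lambda>i. c * x i)"

interpretation coords: finite_field_space "coord_scale :: 'a::{field,finite} \<Rightarrow> (nat \<Rightarrow> 'a) \<Rightarrow> nat \<Rightarrow> 'a" "CARD('a)"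
  by unfold_locales (auto simp: coord_scale_def fun_eq_iff algebra_simps)

declare coords.card_UNIV_q [simp del]

definition coord_space :: "nat \<Rightarrow> (nat \<Rightarrow> 'a::zero) set" where
  "coord_space m = {x. \<forall>i>m. x i = 0}"

lemma subspace_coord_space: "coords.subspace (coord_space m)"
  by (auto simp: coords.subspace_def coord_space_def coord_scale_def)

lemma bij_coord_space:
  "bij_betw (\<lambda>g i. if i \<le> m then g i else 0) ({0..m} \<rightarrow>\<^sub>E UNIV) (coord_space m :: (nat \<Rightarrow> 'a::zero) set)"
  by (rule bij_betw_byWitness[where f' = "\<lambda>x. restrict x {0..m}"])
    (auto simp: coord_space_def fun_eq_iff PiE_def extensional_def)

lemma finite_coord_space: "finite (coord_space m :: (nat \<Rightarrow> 'a::{zero,finite}) set)"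
  unfolding bij_betw_finite[OF bij_coord_space, symmetric] by (rule finite_PiE) auto

lemma card_coord_space: "card (coord_space m :: (nat \<Rightarrow> 'a::{zero,finite}) set) = CARD('a) ^ Suc m"
  using bij_betw_same_card[OF bij_coord_space[where 'a = 'a, of m]] by (simp add: card_PiE)

lemma lf_coordinate: "coords.lf (\<lambda>x. x i)"
  by (simp add: coords.lf_def coord_scale_def)

lemma HP_one: "coords.HP 0 (\<lambda>_. 1)"
  by (rule coords.HP.const)

lemma HP_power_coordinate: "coords.HP n (\<lambda>x. x i ^ n)"
proof (induction n)
  case (Suc n)
  then show ?case using coords.HP.mult[OF lf_coordinate[of i]] by simp
qed (simp add: HP_one)

lemma HP_prod_coordinates: "finite I \<Longrightarrow> coords.HP (\<Sum>i\<in>I. n i) (\<lambda>x. \<Prod>i\<in>I. x i ^ n i)"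
proof (induction I rule: finite_induct)
  case (insert i I)
  then show ?case using coords.HP_mult[OF HP_power_coordinate[of "n i" i] insert.IH] by simp
qed (simp add: HP_one)

lemma HP_eval_mpoly:
  assumes "homog_keys m d F" shows "coords.HP d (eval_mpoly F)"
proof -
  have "coords.HP d (\<lambda>x. \<Sum>\<alpha>\<in>keys F. lookup F \<alpha> * (\<Prod>i\<in>keys \<alpha>. x i ^ lookup \<alpha> i))"
  proof (intro coords.HP_sum coords.HP_cmult)
    fix \<alpha> assume "\<alpha> \<in> keys F"
    then have "(\<Sum>i\<in>keys \<alpha>. lookup \<alpha> i) = d" using assms unfolding homog_keys_def mon_deg_def by blast
    then show "coords.HP d (\<lambda>x. \<Prod>i\<in>keys \<alpha>. x i ^ lookup \<alpha> i)"
      using HP_prod_coordinates[of "keys \<alpha>" "lookup \<alpha>"] by simp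
  qed
  then show ?thesis unfolding eval_mpoly_def .
qed

subsection \<open>Polynomials of small degree are determined by their values\<close>

text \<open>Lagrange interpolation: \<open>1 - (x - t)^(q - 1)\<close> is the indicator of
  \<open>t\<close>, and \<open>u t\<close> is its coefficient at \<open>x^k\<close>. Interpolating
  \<open>t^j\<close> with \<open>j < q\<close> recovers the monomial itself.\<close>

lemma exists_coefficient_functional:
  fixes k :: nat
  obtains u :: "'a::{field,finite} \<Rightarrow> 'a" where
    "\<And>j. j < CARD('a) \<Longrightarrow> (\<Sum>t\<in>UNIV. u t * t ^ j) = (if j = k then 1 else 0)"
proof -
  let ?q = "CARD('a)"
  have q: "?q > 0" by simp
  define b :: "'a \<Rightarrow> 'a poly" where "b t = 1 - [:- t, 1:] ^ (?q - 1)" for t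
  have deg: "degree (b t) \<le> ?q - 1" for t
    unfolding b_def by (intro degree_diff_le) (auto simp: degree_linear_power)
  have val: "poly (b t) s = (if s = t then 1 else 0)" for s t
  proof -
    have "(s - t) * (s - t) ^ (?q - 1) = (s - t) ^ Suc (?q - 1)" by (rule power_Suc[symmetric])
    also have "\<dots> = s - t" using finite_field_power_card[of "s - t"] q by simp
    finally have "s \<noteq> t \<Longrightarrow> (s - t) ^ (?q - 1) = 1" by simp
    moreover have "?q - 1 > 0"
      using coords.q_ge_2[where 'a = 'a] by simp
    ultimately show ?thesis unfolding b_def by (auto simp: zero_power)
  qed
  have "(\<Sum>t\<in>UNIV. coeff (b t) k * t ^ j) = (if j = k then 1 else 0)" if j: "j < ?q" for j
  proof -
    have "(\<Sum>t\<in>UNIV. smult (t ^ j) (b t)) - monom 1 j = 0"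
    proof (rule poly_eq_0_if_values)
      have "degree (\<Sum>t\<in>UNIV. smult (t ^ j) (b t)) \<le> ?q - 1"
        using deg by (intro degree_sum_le) (auto intro: le_trans[OF degree_smult_le])
      moreover have "degree (monom (1::'a) j) \<le> ?q - 1" using j by (simp add: degree_monom_eq)
      ultimately have "degree ((\<Sum>t\<in>UNIV. smult (t ^ j) (b t)) - monom 1 j) \<le> ?q - 1" by (rule degree_diff_le)
      then show "degree ((\<Sum>t\<in>UNIV. smult (t ^ j) (b t)) - monom 1 j) < ?q" using q by linarith
      show "poly ((\<Sum>t\<in>UNIV. smult (t ^ j) (b t)) - monom 1 j) s = 0" for s
        by (simp add: poly_sum val poly_monom if_distrib[of "\<lambda>x. _ * x"] sum.If_cases cong: if_cong)
    qed
    then have "coeff (\<Sum>t\<in>UNIV. smult (t ^ j) (b t)) k = coeff (monom 1 j) k" by simp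
    then show ?thesis by (simp add: coeff_sum mult.commute)
  qed
  then show ?thesis using that[of "\<lambda>t. coeff (b t) k"] by blast
qed

text \<open>If all exponents are below \<open>q\<close>, coefficient functionals in every variable
  isolate a single coefficient. Only a pure power in degree \<open>d = q\<close> could violate this;
  at the matching unit vector all other monomials of the form vanish, so its coefficient is
  zero.\<close>

lemma eval_mpoly_eq_0_imp:
  fixes F :: "'a::{field,finite} mpoly"
  assumes hom: "homog_keys m d F" and d: "d \<le> CARD('a)" and zero: "\<And>x. x \<in> coord_space m \<Longrightarrow> eval_mpoly F x = 0"
  shows "F = 0"
proof (rule ccontr)
  assume "F \<noteq> 0"
  let ?q = "CARD('a)"
  have keys: "mon_deg \<alpha> = d" "keys \<alpha> \<subseteq> {0..m}" if "\<alpha> \<in> keys F" for \<alpha>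
    using hom that unfolding homog_keys_def by auto
  have le_deg: "lookup \<alpha> i \<le> d" if "\<alpha> \<in> keys F" for \<alpha> i
  proof (cases "i \<in> keys \<alpha>")
    case True
    then have "lookup \<alpha> i \<le> (\<Sum>i\<in>keys \<alpha>. lookup \<alpha> i)" by (intro member_le_sum) auto
    then show ?thesis using keys(1)[OF that] unfolding mon_deg_def by simp
  qed (simp add: in_keys_iff)
  text \<open>a pure power of a variable is detected by evaluating at a unit vector\<close>
  have lt: "lookup \<alpha> i < ?q" if \<alpha>: "\<alpha> \<in> keys F" for \<alpha> i
  proof (rule ccontr)
    assume "\<not> ?thesis"
    then have ld: "lookup \<alpha> i = d" and dq: "d = ?q" using le_deg[OF \<alpha>, of i] d by auto
    have d0: "d > 0" using dq by simp
    have pure: "\<beta> = single i d" if \<beta>: "\<beta> \<in> keys F" "lookup \<beta> i = d" for \<beta>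
    proof (rule poly_mapping_eqI)
      fix k
      have ik: "i \<in> keys \<beta>" using \<beta>(2) d0 by (simp add: in_keys_iff)
      have "d = lookup \<beta> i + (\<Sum>i\<in>keys \<beta> - {i}. lookup \<beta> i)"
        using keys(1)[OF \<beta>(1)] ik unfolding mon_deg_def by (simp add: sum.remove)
      then have "\<forall>k\<in>keys \<beta> - {i}. lookup \<beta> k = 0" using \<beta>(2) by simp
      then show "lookup \<beta> k = lookup (single i d) k"
        using \<beta>(2) by (cases "k = i") (auto simp: lookup_single in_keys_iff)
    qed
    define x :: "nat \<Rightarrow> 'a" where "x k = (if k = i then 1 else 0)" for k
    have "i \<in> keys \<alpha>" using ld d0 by (simp add: in_keys_iff)
    then have "i \<le> m" using keys(2)[OF \<alpha>] by auto
    then have "x \<in> coord_space m" unfolding x_def coord_space_def by auto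
    then have "0 = (\<Sum>\<beta>\<in>keys F. lookup F \<beta> * mon_eval \<beta> x)"
      using zero[of x] unfolding eval_mpoly_def mon_eval_def by simp
    also have "\<dots> = lookup F \<alpha> * mon_eval \<alpha> x + (\<Sum>\<beta>\<in>keys F - {\<alpha>}. lookup F \<beta> * mon_eval \<beta> x)"
      using \<alpha> by (intro sum.remove) auto
    also have "(\<Sum>\<beta>\<in>keys F - {\<alpha>}. lookup F \<beta> * mon_eval \<beta> x) = 0"
    proof (rule sum.neutral, rule ballI)
      fix \<beta> assume \<beta>: "\<beta> \<in> keys F - {\<alpha>}"
      then have ne: "lookup \<beta> i \<noteq> d" using pure \<alpha> ld by (metis DiffE singletonI)
      have "\<exists>k\<in>keys \<beta>. k \<noteq> i"
      proof (rule ccontr)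
        assume "\<not> ?thesis"
        then have "keys \<beta> \<subseteq> {i}" by auto
        then have "mon_deg \<beta> = lookup \<beta> i" using mon_deg_superset[of "{i}" \<beta>] by simp
        then show False using keys(1) \<beta> ne by simp
      qed
      then obtain k where "k \<in> keys \<beta>" "k \<noteq> i" by blast
      then have "mon_eval \<beta> x = 0" unfolding mon_eval_def x_def
        by (intro prod_zero) (auto simp: in_keys_iff intro!: bexI[of _ k])
      then show "lookup F \<beta> * mon_eval \<beta> x = 0" by simp
    qed
    also have "mon_eval \<alpha> x = 1"
      using pure[OF \<alpha> ld] unfolding mon_eval_def x_def by (auto simp: lookup_single)
    finally show False using \<alpha> by (simp add: in_keys_iff)
  qed
  obtain \<beta> where \<beta>: "\<beta> \<in> keys F" using \<open>F \<noteq> 0\<close> by (metis all_not_in_conv keys_eq_empty)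
  have "\<exists>u :: 'a \<Rightarrow> 'a. \<forall>j<?q. (\<Sum>t\<in>UNIV. u t * t ^ j) = (if j = lookup \<beta> i then 1 else 0)" for i
    using exists_coefficient_functional[of "lookup \<beta> i"] by metis
  then obtain u :: "nat \<Rightarrow> 'a \<Rightarrow> 'a" where
    u: "\<And>i j. j < ?q \<Longrightarrow> (\<Sum>t\<in>UNIV. u i t * t ^ j) = (if j = lookup \<beta> i then 1 else 0)"
    by metis
  let ?E = "{0..m} \<rightarrow>\<^sub>E (UNIV :: 'a set)"
  have extr: "(\<Sum>g\<in>?E. (\<Prod>i\<in>{0..m}. u i (g i)) * mon_eval \<alpha> (\<lambda>i. if i \<le> m then g i else 0)) = (if \<alpha> = \<beta> then 1 else 0)"
    if \<alpha>: "\<alpha> \<in> keys F" for \<alpha>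
  proof -
    have "(\<Sum>g\<in>?E. (\<Prod>i\<in>{0..m}. u i (g i)) * mon_eval \<alpha> (\<lambda>i. if i \<le> m then g i else 0)) =
      (\<Sum>g\<in>?E. \<Prod>i\<in>{0..m}. u i (g i) * g i ^ lookup \<alpha> i)"
      by (rule sum.cong) (simp_all add: mon_eval_superset[OF _ keys(2)[OF \<alpha>]] prod.distrib)
    also have "\<dots> = (\<Prod>i\<in>{0..m}. \<Sum>t\<in>UNIV. u i t * t ^ lookup \<alpha> i)"
      by (rule prod_sum_PiE[symmetric]) auto
    also have "\<dots> = (\<Prod>i\<in>{0..m}. if lookup \<alpha> i = lookup \<beta> i then 1 else 0)"
      using u lt[OF \<alpha>] by simp
    also have "\<dots> = (if \<alpha> = \<beta> then 1 else 0)"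
    proof (cases "\<alpha> = \<beta>")
      case False
      then obtain i where i: "lookup \<alpha> i \<noteq> lookup \<beta> i" using poly_mapping_eqI[of \<alpha> \<beta>] by blast
      then have "i \<in> keys \<alpha> \<union> keys \<beta>" by (auto simp: in_keys_iff)
      then have "i \<in> {0..m}" using keys(2) \<alpha> \<beta> by blast
      then show ?thesis using i False by (auto intro!: prod_zero bexI[of _ i])
    qed simp
    finally show ?thesis .
  qed
  have "0 = (\<Sum>g\<in>?E. (\<Prod>i\<in>{0..m}. u i (g i)) * eval_mpoly F (\<lambda>i. if i \<le> m then g i else 0))"
    by (rule sum.neutral[symmetric]) (auto intro!: zero simp: coord_space_def)
  also have "\<dots> = (\<Sum>g\<in>?E. \<Sum>\<alpha>\<in>keys F. lookup F \<alpha> * ((\<Prod>i\<in>{0..m}. u i (g i)) * mon_eval \<alpha> (\<lambda>i. if i \<le> m then g i else 0)))"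
    unfolding eval_mpoly_def mon_eval_def[symmetric] sum_distrib_left
    by (intro sum.cong refl mult.left_commute)
  also have "\<dots> = (\<Sum>\<alpha>\<in>keys F. lookup F \<alpha> * (\<Sum>g\<in>?E. (\<Prod>i\<in>{0..m}. u i (g i)) * mon_eval \<alpha> (\<lambda>i. if i \<le> m then g i else 0)))"
    unfolding sum_distrib_left by (rule sum.swap)
  also have "\<dots> = (\<Sum>\<alpha>\<in>keys F. if \<alpha> = \<beta> then lookup F \<beta> else 0)"
    by (rule sum.cong) (auto simp: extr)
  also have "\<dots> = lookup F \<beta>" using \<beta> by simp
  finally show False using \<beta> by (simp add: in_keys_iff)
qed

definition linear_mpoly :: "nat \<Rightarrow> ((nat \<Rightarrow> 'a) \<Rightarrow> 'a) \<Rightarrow> 'a::comm_ring_1 mpoly" where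
  "linear_mpoly m l = (\<Sum>i\<in>{0..m}. single (single i 1) (l (\<lambda>k. if k = i then 1 else 0)))"

lemma homog_keys_linear_mpoly: "homog_keys m 1 (linear_mpoly m l)"
  unfolding linear_mpoly_def by (rule homog_keys_sum) (auto simp: homog_keys_def mon_deg_def)

lemma eval_linear_mpoly:
  fixes l :: "(nat \<Rightarrow> 'a::{field,finite}) \<Rightarrow> 'a"
  assumes l: "coords.lf l" and x: "x \<in> coord_space m"
  shows "eval_mpoly (linear_mpoly m l) x = l x"
proof -
  let ?u = "\<lambda>i k. if k = i then 1 else 0 :: 'a"
  have lsum: "l (\<Sum>i\<in>I. coord_scale (x i) (?u i)) = (\<Sum>i\<in>I. x i * l (?u i))" if "finite I" for I
    using that l by (induction I rule: finite_induct) (auto simp: coords.lf_simps)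
  have "(\<Sum>i\<in>{0..m}. coord_scale (x i) (?u i)) = x"
  proof
    fix k
    have app: "(\<Sum>i\<in>I. coord_scale (x i) (?u i)) k = (\<Sum>i\<in>I. if k = i then x i else 0)" if "finite I" for I
      using that by (induction I rule: finite_induct) (auto simp: coord_scale_def)
    show "(\<Sum>i\<in>{0..m}. coord_scale (x i) (?u i)) k = x k"
      using x unfolding app[OF finite_atLeastAtMost] coord_space_def by simp
  qed
  then have "l x = (\<Sum>i\<in>{0..m}. x i * l (?u i))" using lsum[of "{0..m}"] by simp
  moreover have "eval_mpoly (linear_mpoly m l) x = (\<Sum>i\<in>{0..m}. l (?u i) * x i)"
    unfolding linear_mpoly_def eval_mpoly_sum eval_mpoly_single by (simp add: mon_eval_def)
  ultimately show ?thesis by (simp add: mult.commute)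
qed

text \<open>The counting argument factors only the function; the formal identity follows since the
  difference of the two forms has degree \<open>d \<le> q\<close> and vanishes everywhere.\<close>

lemma union_of_rat_hyperplanes_if_linear_factors:
  fixes F :: "'a::{field,finite} mpoly"
  assumes hom: "homog_poly m d F" and d: "d \<le> CARD('a)"
    and A: "length A = d" "\<forall>l\<in>set A. coords.lf l"
    and F: "\<forall>x\<in>coord_space m. eval_mpoly F x = c * (\<Prod>l\<leftarrow>A. l x)"
  shows "union_of_rat_hyperplanes m F"
proof -
  define G where "G = single 0 c * prod_list (map (linear_mpoly m) A)"
  have homF: "F \<noteq> 0" "homog_keys m d F" using hom by (auto simp: homog_poly_iff)
  have "homog_keys m (length (map (linear_mpoly m) A)) (prod_list (map (linear_mpoly m) A))"
    by (rule homog_keys_prod_list) (use homog_keys_linear_mpoly in force)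
  then have "homog_keys m d G"
    using homog_keys_mult[OF homog_keys_const] A(1) unfolding G_def by fastforce
  then have hD: "homog_keys m d (F - G)" using homF by (intro homog_keys_diff)
  have "F - G = 0"
  proof (rule eval_mpoly_eq_0_imp[OF hD d])
    fix x :: "nat \<Rightarrow> 'a" assume x: "x \<in> coord_space m"
    have "map (\<lambda>l. eval_mpoly (linear_mpoly m l) x) A = map (\<lambda>l. l x) A"
      using A(2) eval_linear_mpoly[OF _ x] by simp
    moreover have "eval_mpoly G x = c * prod_list (map (\<lambda>l. eval_mpoly (linear_mpoly m l) x) A)"
      unfolding G_def by (simp add: eval_mpoly_mult eval_mpoly_single eval_mpoly_prod_list mon_eval_def comp_def)
    ultimately have "eval_mpoly G x = c * (\<Prod>l\<leftarrow>A. l x)" by (simp only:)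
    then show "eval_mpoly (F - G) x = 0" using F x by (simp add: eval_mpoly_diff)
  qed
  then have FG: "F = single 0 c * prod_list (map (linear_mpoly m) A)" unfolding G_def by simp
  have "c \<noteq> 0" using FG homF(1) by auto
  moreover have "homog_poly m 1 L" if L: "L \<in> set (map (linear_mpoly m) A)" for L
  proof -
    have prod0: "prod_list Ls = 0" if "0 \<in> set Ls" for Ls :: "'a mpoly list"
      using that by (induction Ls) auto
    have "L \<noteq> 0"
    proof
      assume "L = 0"
      then have "F = 0" using L prod0[of "map (linear_mpoly m) A"] FG by simp
      then show False using homF(1) by simp
    qed
    moreover obtain l where "L = linear_mpoly m l" using L by auto
    ultimately show ?thesis unfolding homog_poly_iff by (simp only: homog_keys_linear_mpoly simp_thms)
  qed
  ultimately show ?thesis unfolding union_of_rat_hyperplanes_def using FG by blast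
qed

section \<open>Projective points and the final conversion of the bounds\<close>

text \<open>Homogeneity makes the nonzero zeros a union of punctured lines of \<open>q - 1\<close>
  vectors, one for each projective point. The degree is positive, so the origin contributes the
  summand \<open>1\<close>.\<close>

lemma card_hyp_rat_points:
  fixes F :: "'a::{field,finite} mpoly"
  assumes hom: "homog_keys m (Suc e) F"
  shows "card {x \<in> coord_space m. eval_mpoly F x = 0} = 1 + (CARD('a) - 1) * card (hyp_rat_points m F)"
proof -
  define cl :: "(nat \<Rightarrow> 'a) \<Rightarrow> (nat \<Rightarrow> 'a) set" where "cl x = {(\<lambda>i. c * x i) | c. c \<noteq> 0}" for x
  define Z where "Z = {x \<in> nonzero_vecs m. eval_mpoly F x = 0}"
  have HP: "coords.HP (Suc e) (eval_mpoly F)" by (rule HP_eval_mpoly[OF hom])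
  have ev: "eval_mpoly F (\<lambda>i. c * x i) = c ^ Suc e * eval_mpoly F x" for c x
    using coords.HP_homogeneous[OF HP, of c x] unfolding coord_scale_def .
  have nz: "x \<in> nonzero_vecs m \<longleftrightarrow> x \<in> coord_space m \<and> x \<noteq> 0" for x :: "nat \<Rightarrow> 'a"
    unfolding nonzero_vecs_def coord_space_def by (auto simp: fun_eq_iff) (metis not_le)
  have finZ: "finite Z" unfolding Z_def
    by (rule finite_subset[OF _ finite_coord_space[of m]]) (auto simp: nz)
  have H: "hyp_rat_points m F = cl ` Z"
  proof -
    have "(\<forall>y\<in>cl x. eval_mpoly F y = 0) \<longleftrightarrow> eval_mpoly F x = 0" for x
    proof
      assume *: "\<forall>y\<in>cl x. eval_mpoly F y = 0"
      have "(\<lambda>i. 1 * x i) \<in> cl x" unfolding cl_def by (rule CollectI, rule exI[of _ 1]) simp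
      then have "eval_mpoly F (\<lambda>i. 1 * x i) = 0" using * by blast
      then show "eval_mpoly F x = 0" by simp
    qed (auto simp: cl_def ev)
    then show ?thesis unfolding hyp_rat_points_def proj_points_def cl_def[symmetric] Z_def by auto
  qed
  have self: "x \<in> cl x" for x unfolding cl_def by (rule CollectI, rule exI[of _ 1]) simp
  have clZ: "cl x \<subseteq> Z" if "x \<in> Z" for x
    using that unfolding cl_def Z_def nonzero_vecs_def by (auto simp: ev)
  have "\<Union> (cl ` Z) = Z" using self clZ by blast
  moreover have "card P = CARD('a) - 1" if P: "P \<in> cl ` Z" for P
  proof -
    obtain x where x: "x \<in> Z" "P = cl x" using P by blast
    then obtain i where i: "x i \<noteq> 0" unfolding Z_def nonzero_vecs_def by blast
    have "P = (\<lambda>c i. c * x i) ` (UNIV - {0})" unfolding x(2) cl_def by auto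
    moreover have "inj_on (\<lambda>c i. c * x i) (UNIV - {0})" using i by (auto simp: inj_on_def fun_eq_iff)
    ultimately show ?thesis by (simp add: card_image card_Diff_singleton)
  qed
  moreover have "P \<inter> Q = {}" if PQ: "P \<in> cl ` Z" "Q \<in> cl ` Z" "P \<noteq> Q" for P Q
  proof (rule ccontr)
    assume "P \<inter> Q \<noteq> {}"
    have absorb: "cl z = cl x" if z: "z \<in> cl x" for x z
    proof -
      from z obtain c where c: "c \<noteq> 0" "z = (\<lambda>i. c * x i)" by (auto simp: cl_def)
      have "cl z \<subseteq> cl x"
      proof
        fix y assume "y \<in> cl z"
        then obtain b where "b \<noteq> 0" "y = (\<lambda>i. b * z i)" by (auto simp: cl_def)
        then have "b * c \<noteq> 0" "y = (\<lambda>i. (b * c) * x i)" using c by (auto simp: mult.assoc)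
        then show "y \<in> cl x" unfolding cl_def by (intro CollectI exI[of _ "b * c"] conjI)
      qed
      moreover have "cl x \<subseteq> cl z"
      proof
        fix y assume "y \<in> cl x"
        then obtain b where "b \<noteq> 0" "y = (\<lambda>i. b * x i)" by (auto simp: cl_def)
        then have "b / c \<noteq> 0" "y = (\<lambda>i. (b / c) * z i)" using c by auto
        then show "y \<in> cl z" unfolding cl_def by (intro CollectI exI[of _ "b / c"] conjI)
      qed
      ultimately show ?thesis by (rule subset_antisym)
    qed
    from \<open>P \<inter> Q \<noteq> {}\<close> obtain z where "z \<in> P" "z \<in> Q" by blast
    then show False using PQ absorb by blast
  qed
  ultimately have "(CARD('a) - 1) * card (cl ` Z) = card Z"
    using finZ card_partition[of "cl ` Z" "CARD('a) - 1"] by simp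
  moreover have "{x \<in> coord_space m. eval_mpoly F x = 0} = insert 0 Z"
    using coords.HP_at_zero[OF HP] coords.subspace_0[OF subspace_coord_space] unfolding Z_def by (auto simp: nz)
  moreover have "0 \<notin> Z" unfolding Z_def by (simp add: nz)
  ultimately show ?thesis using finZ H by simp
qed

theorem theorem3p6:
  fixes F :: "'a::{finite,field} mpoly" and q d m :: nat
  assumes q_def: "q = card (UNIV :: 'a set)"
    and q3: "q \<ge> 3" and d3: "d \<ge> 3" and m3: "m \<ge> 3"
    and hom: "homog_poly m d F"
    and small: "card (hyp_rat_points m F) < d * q ^ (m - 1) + pk q (m - 2)"
  shows "(2 * d \<le> q + 3 \<longrightarrow>
            int (card (hyp_rat_points m F))
              \<le> int d * int q ^ (m - 1) + int (pk q (m - 2)) - (int d - 2) * int q ^ (m - 2)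
          \<and> (int (card (hyp_rat_points m F))
              = int d * int q ^ (m - 1) + int (pk q (m - 2)) - (int d - 2) * int q ^ (m - 2)
             \<longrightarrow> union_of_rat_hyperplanes m F))
       \<and> (q + 3 < 2 * d \<and> d \<le> q \<longrightarrow>
            int (card (hyp_rat_points m F))
              \<le> (int d - 1) * int q ^ (m - 1) + int d * int q ^ (m - 2)
                 + int (pk q (m - 3)) - (int d - 2) * int q ^ (m - 3))"
proof (cases "d \<le> q")
  case False
  \<comment> \<open>For \<open>d > q\<close> both parts are vacuous; the counting theorem needs
    \<open>e = d - 1 < q\<close>.\<close>
  then have "\<not> 2 * d \<le> q + 3" "\<not> d \<le> q" using q3 by auto
  then show ?thesis by blast
next
  case True
  define N where "N = int (card (hyp_rat_points m F))"
  \<comment> \<open>The smallest power in the statement. In terms of it the ambient space has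
    \<open>Q ^ 4 * r\<close> vectors, and the remaining comparisons are polynomial identities in
    \<open>Q\<close>, \<open>e\<close> and \<open>r\<close>.\<close>
  define r where "r = int q ^ (m - 3)"
  define Q where "Q = int q"
  define e where "e = d - 1"
  define z where "z = int (card {x \<in> coord_space m. eval_mpoly F x = 0})"
  have d: "d = Suc e" using d3 unfolding e_def by simp
  have e: "2 \<le> e" "e < CARD('a)" using d d3 True q_def by auto
  have De: "int d = int e + 1" using d by simp
  have Q3: "Q \<ge> 3" using q3 unfolding Q_def by simp
  have r0: "r > 0" using q3 unfolding r_def by simp
  have homF: "homog_keys m (Suc e) F" using hom d by (simp add: homog_poly_iff)
  have HP: "coords.HP (Suc e) (eval_mpoly F)" by (rule HP_eval_mpoly[OF homF])
  have zN: "z = 1 + (Q - 1) * N"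
    using card_hyp_rat_points[OF homF] q3 unfolding z_def N_def Q_def q_def by (simp add: of_nat_diff)
  have m1: "m - 1 = Suc (Suc (m - 3))" "m - 2 = Suc (m - 3)" "Suc m = m - 3 + 4" using m3 by auto
  have qm: "int q ^ (m - 1) = Q ^ 2 * r" "int q ^ (m - 2) = Q * r"
    unfolding m1 Q_def r_def by (simp_all add: power2_eq_square mult.assoc)
  have v: "int (card (coord_space m :: (nat \<Rightarrow> 'a) set)) = Q ^ 4 * r"
    unfolding card_coord_space m1(3) power_add Q_def r_def q_def by (simp add: mult.commute)
  have pk: "(Q - 1) * int (pk q k) = Q ^ Suc k - 1" for k
    unfolding pk_def Q_def by (induction k) (simp_all add: algebra_simps)
  have pk2: "(Q - 1) * int (pk q (m - 2)) = Q ^ 2 * r - 1" and pk3: "(Q - 1) * int (pk q (m - 3)) = Q * r - 1"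
    unfolding pk unfolding m1 Q_def r_def by (simp_all add: power2_eq_square mult.assoc)
  have smallN: "N < int d * (Q ^ 2 * r) + int (pk q (m - 2))"
  proof -
    have "N < int (d * q ^ (m - 1) + pk q (m - 2))" unfolding N_def using small by (simp only: of_nat_less_iff)
    then show ?thesis using qm(1) by simp
  qed
  have "(Q - 1) * N < (Q - 1) * (int d * (Q ^ 2 * r) + int (pk q (m - 2)))"
    using smallN Q3 by (intro mult_strict_left_mono) auto
  then have "(Q - 1) * N < (Q - 1) * (int d * (Q ^ 2 * r)) + (Q ^ 2 * r - 1)"
    unfolding distrib_left pk2 .
  then have "z < Q ^ 2 * r * ((int e + 1) * Q - int e)"
    unfolding zN De by (simp add: algebra_simps)
  then have "Q ^ 2 * z < Q ^ 2 * (Q ^ 2 * r * ((int e + 1) * Q - int e))"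
    using Q3 by (intro mult_strict_left_mono) auto
  then have small': "int CARD('a) ^ 2 * z < ((int e + 1) * int CARD('a) - int e) * int (card (coord_space m :: (nat \<Rightarrow> 'a) set))"
    unfolding v q_def[symmetric] Q_def[symmetric] by (simp add: algebra_simps power2_eq_square power4_eq_xxxx)
  note main = coords.hypersurface_zero_count[OF HP e subspace_coord_space finite_coord_space small'[unfolded z_def],
    folded z_def, unfolded v, folded q_def, folded Q_def]
  \<comment> \<open>Multiplication by \<open>Q - 1\<close> sums the geometric series in
    \<open>pk\<close>, and \<open>z = 1 + (Q - 1) * N\<close> carries the projective bound exactly
    to the vector bound; being an equivalence, it also transports the case of equality.\<close>
  have A: "(N \<le> int d * (Q ^ 2 * r) + int (pk q (m - 2)) - (int d - 2) * (Q * r) \<longleftrightarrow>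
      Q ^ 3 * z \<le> ((int e + 1) * Q ^ 2 - (2 * int e - 1) * Q + int e - 1) * (Q ^ 4 * r))"
    "(N = int d * (Q ^ 2 * r) + int (pk q (m - 2)) - (int d - 2) * (Q * r) \<longleftrightarrow>
      Q ^ 3 * z = ((int e + 1) * Q ^ 2 - (2 * int e - 1) * Q + int e - 1) * (Q ^ 4 * r))"
  proof -
    let ?b = "int d * (Q ^ 2 * r) + int (pk q (m - 2)) - (int d - 2) * (Q * r)"
    have b: "(Q - 1) * ?b = (Q - 1) * (int d * (Q ^ 2 * r)) + (Q ^ 2 * r - 1) - (Q - 1) * ((int d - 2) * (Q * r))"
      unfolding pk2[symmetric] by (simp add: algebra_simps)
    have "Q ^ 3 * (1 + (Q - 1) * ?b) = ((int e + 1) * Q ^ 2 - (2 * int e - 1) * Q + int e - 1) * (Q ^ 4 * r)"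
      unfolding b unfolding De by (simp add: algebra_simps power2_eq_square power3_eq_cube power4_eq_xxxx)
    moreover have "N \<le> ?b \<longleftrightarrow> Q ^ 3 * (1 + (Q - 1) * N) \<le> Q ^ 3 * (1 + (Q - 1) * ?b)"
      "N = ?b \<longleftrightarrow> Q ^ 3 * (1 + (Q - 1) * N) = Q ^ 3 * (1 + (Q - 1) * ?b)"
      using Q3 by simp_all
    ultimately show "(N \<le> ?b \<longleftrightarrow>
      Q ^ 3 * z \<le> ((int e + 1) * Q ^ 2 - (2 * int e - 1) * Q + int e - 1) * (Q ^ 4 * r))"
    "(N = ?b \<longleftrightarrow>
      Q ^ 3 * z = ((int e + 1) * Q ^ 2 - (2 * int e - 1) * Q + int e - 1) * (Q ^ 4 * r))"
      unfolding zN by (simp_all only:)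
  qed
  have B: "N \<le> (int d - 1) * (Q ^ 2 * r) + int d * (Q * r) + int (pk q (m - 3)) - (int d - 2) * r \<longleftrightarrow>
      Q ^ 4 * z \<le> (int e * Q ^ 3 + Q ^ 2 - int e * Q - (Q - 1) * (int e - 1)) * (Q ^ 4 * r)"
  proof -
    let ?b = "(int d - 1) * (Q ^ 2 * r) + int d * (Q * r) + int (pk q (m - 3)) - (int d - 2) * r"
    have b: "(Q - 1) * ?b = (Q - 1) * ((int d - 1) * (Q ^ 2 * r) + int d * (Q * r)) + (Q * r - 1) - (Q - 1) * ((int d - 2) * r)"
      unfolding pk3[symmetric] by (simp add: algebra_simps)
    have "Q ^ 4 * (1 + (Q - 1) * ?b) = (int e * Q ^ 3 + Q ^ 2 - int e * Q - (Q - 1) * (int e - 1)) * (Q ^ 4 * r)"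
      unfolding b unfolding De by (simp add: algebra_simps power2_eq_square power3_eq_cube power4_eq_xxxx)
    moreover have "N \<le> ?b \<longleftrightarrow> Q ^ 4 * (1 + (Q - 1) * N) \<le> Q ^ 4 * (1 + (Q - 1) * ?b)"
      using Q3 by simp
    ultimately show ?thesis unfolding zN by (simp only:)
  qed
  have "union_of_rat_hyperplanes m F" if d2: "2 * d \<le> q + 3"
    and eq: "N = int d * (Q ^ 2 * r) + int (pk q (m - 2)) - (int d - 2) * (Q * r)"
  proof -
    have "2 * e \<le> q + 1" using d2 d by simp
    then obtain c A where A: "length A = Suc e" "\<forall>l\<in>set A. coords.lf l"
      "\<forall>x\<in>coord_space m. eval_mpoly F x = c * (\<Prod>l\<leftarrow>A. l x)"
      using main(2) eq unfolding A(2) by blast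
    then show ?thesis
      using union_of_rat_hyperplanes_if_linear_factors[OF hom, of A c] True d q_def by simp
  qed
  moreover have "N \<le> int d * (Q ^ 2 * r) + int (pk q (m - 2)) - (int d - 2) * (Q * r)" if "2 * d \<le> q + 3"
    using main(1) that d unfolding A(1) by simp
  moreover have "N \<le> (int d - 1) * (Q ^ 2 * r) + int d * (Q * r) + int (pk q (m - 3)) - (int d - 2) * r"
    if "q + 3 < 2 * d"
    using main(3) that d unfolding B by simp
  ultimately show ?thesis unfolding qm N_def[symmetric] r_def[symmetric] by blast
qed

end
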